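(* Let $\Omega\subset\mathbb{R}^2$ be a bounded open convex set and $M$ a positive integer such that $\{\xi:|\xi|\le 8\}\subset\Omega\subset\overline{\Omega}\subset\{\xi:|\xi|<2^M\}$, suppose $\kappa_\Omega=1/2$, and let $\rho$ be the Minkowski functional of $\Omega$. Let $m:\mathbb{R}\to\mathbb{C}$ be a bounded measurable function supported in $(1/2,2)$. Then for $1<p<\infty$ the operator $T$ defined on Schwartz functions $f$ by $\mathcal{F}[Tf](\xi)=m(\rho(\xi))\mathcal{F}[f](\xi)$ extends to a bounded operator on $L^p(\mathbb{R}^2)$, and $$\|T\|_{H^1(\mathbb{R}^2)\to L^1(\mathbb{R}^2)}\le C_M\|m\|_{B(1/2,0)},\qquad \|m\|_{B(1/2,0)}:=\int_{\mathbb{R}}|\widehat m(\tau)|(1+|\tau|)^{1/2}\,d\tau,$$ where $C_M$ depends only on $M$.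
   Context: $\mathcal{F}$ is the Fourier transform on $\mathbb{R}^2$, $\widehat m$ the one-dimensional Fourier transform of $m$, and $H^1(\mathbb{R}^2)$ the real Hardy space. The Minkowski functional is $\rho(\xi)=\inf\{t>0:\ t^{-1}\xi\in\Omega\}$. For $p\in\partial\Omega$, a supporting line for $\Omega$ at $p$ is a line $\ell$ containing $p$ such that $\Omega$ is contained in the half plane with boundary $\ell$ containing the origin; $\mathcal{T}(\Omega,p)$ is the set of such lines. For $\delta>0$ put $B(p,\ell,\delta)=\{x\in\partial\Omega:\operatorname{dist}(x,\ell)<\delta\}$. $N(\Omega,\delta)$ is the minimum number of sets $B(p,\ell,\delta)$ ($p\in\partial\Omega$, $\ell\in\mathcal{T}(\Omega,p)$) needed to cover $\partial\Omega$, and $\kappa_\Omega=\limsup_{\delta\to0}\frac{\log N(\Omega,\delta)}{\log\delta^{-1}}$.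
   Formalization: The boundedness on L^p for 1<p<∞ is asserted only when the norm of m in B(1/2,0) is finite; without this it fails, e.g. for a disc Ω and m the indicator of (3/4,1), by Fefferman's theorem on the ball multiplier. *)

theory Defs
  imports "HOL-Analysis.Analysis"
begin

section \<open>Convex domains in the plane\<close>

definition minkowski_functional :: "(real^2) set \<Rightarrow> real^2 \<Rightarrow> real" where
  "minkowski_functional \<Omega> \<xi> = Inf {t. t > 0 \<and> (1 / t) *\<^sub>R \<xi> \<in> \<Omega>}"

text \<open>A line is \<open>{x. v \<bullet> x = c}\<close> with \<open>v \<noteq> 0\<close>; the sign of \<open>v\<close> is chosen so that the half plane
  with this boundary containing the origin is \<open>{x. v \<bullet> x \<le> c}\<close>.\<close>

definition supporting_lines :: "(real^2) set \<Rightarrow> real^2 \<Rightarrow> (real^2) set set" where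
  "supporting_lines \<Omega> p =
     {l. p \<in> l \<and> (\<exists>v c. v \<noteq> 0 \<and> l = {x. v \<bullet> x = c} \<and> 0 \<in> {x. v \<bullet> x \<le> c} \<and> \<Omega> \<subseteq> {x. v \<bullet> x \<le> c})}"

definition boundary_cap :: "(real^2) set \<Rightarrow> (real^2) set \<Rightarrow> real \<Rightarrow> (real^2) set" where
  "boundary_cap \<Omega> l \<delta> = {x \<in> frontier \<Omega>. infdist x l < \<delta>}"

definition boundary_caps :: "(real^2) set \<Rightarrow> real \<Rightarrow> (real^2) set set" where
  "boundary_caps \<Omega> \<delta> = {boundary_cap \<Omega> l \<delta> | p l. p \<in> frontier \<Omega> \<and> l \<in> supporting_lines \<Omega> p}"

definition covering_number :: "(real^2) set \<Rightarrow> real \<Rightarrow> nat" where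
  "covering_number \<Omega> \<delta> =
     (LEAST n. \<exists>\<C>. \<C> \<subseteq> boundary_caps \<Omega> \<delta> \<and> finite \<C> \<and> card \<C> = n \<and> frontier \<Omega> \<subseteq> \<Union>\<C>)"

definition kappa :: "(real^2) set \<Rightarrow> ereal" where
  "kappa \<Omega> = Limsup (at_right 0) (\<lambda>\<delta>. ereal (ln (real (covering_number \<Omega> \<delta>)) / ln (1 / \<delta>)))"


section \<open>Fourier transform and Schwartz functions\<close>

text \<open>Convention: the transform carries the phase \<open>exp (- \<i> x \<bullet> \<xi>)\<close> and no constant, so the inverse
  transform carries the factor \<open>(2 \<pi>)\<close> to the power minus the dimension.\<close>

definition fourier :: "('a::euclidean_space \<Rightarrow> complex) \<Rightarrow> 'a \<Rightarrow> complex" where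
  "fourier f \<xi> = (LINT x|lebesgue. cis (- (x \<bullet> \<xi>)) * f x)"

definition inverse_fourier :: "('a::euclidean_space \<Rightarrow> complex) \<Rightarrow> 'a \<Rightarrow> complex" where
  "inverse_fourier g x =
     complex_of_real (1 / (2 * pi) ^ DIM('a)) * (LINT \<xi>|lebesgue. cis (x \<bullet> \<xi>) * g \<xi>)"

primrec partial_derivs :: "2 list \<Rightarrow> (real^2 \<Rightarrow> complex) \<Rightarrow> real^2 \<Rightarrow> complex" where
  "partial_derivs [] f = f"
| "partial_derivs (i # is) f =
     (\<lambda>x. frechet_derivative (partial_derivs is f) (at x) (axis i 1))"

definition schwartz :: "(real^2 \<Rightarrow> complex) \<Rightarrow> bool" where
  "schwartz f \<longleftrightarrow>
     (\<forall>is. (\<forall>x. partial_derivs is f differentiable (at x)) \<and>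
           (\<forall>k::nat. bounded (range (\<lambda>x. (1 + norm x) ^ k * norm (partial_derivs is f x)))))"


section \<open>Function spaces\<close>

text \<open>Elements of the spaces below are functions rather than classes modulo null sets.\<close>

definition Lp_space :: "real \<Rightarrow> (real^2 \<Rightarrow> complex) set" where
  "Lp_space p =
     {f. f \<in> borel_measurable lebesgue \<and> integrable lebesgue (\<lambda>x. norm (f x) powr p)}"

definition Lp_norm :: "real \<Rightarrow> (real^2 \<Rightarrow> complex) \<Rightarrow> real" where
  "Lp_norm p f = (LINT x|lebesgue. norm (f x) powr p) powr (1 / p)"

text \<open>Linearity is required modulo null sets; together with the norm bound it makes \<open>S\<close> respect
  equality almost everywhere, so that \<open>S\<close> induces a bounded linear operator on the quotient.\<close>

definition bounded_operator_Lp :: "real \<Rightarrow> ((real^2 \<Rightarrow> complex) \<Rightarrow> (real^2 \<Rightarrow> complex)) \<Rightarrow> bool" where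
  "bounded_operator_Lp p S \<longleftrightarrow>
     (\<forall>f\<in>Lp_space p. S f \<in> Lp_space p) \<and>
     (\<forall>f\<in>Lp_space p. \<forall>g\<in>Lp_space p. AE x in lebesgue. S (\<lambda>y. f y + g y) x = S f x + S g x) \<and>
     (\<forall>f\<in>Lp_space p. \<forall>c. AE x in lebesgue. S (\<lambda>y. c * f y) x = c * S f x) \<and>
     (\<exists>A. \<forall>f\<in>Lp_space p. Lp_norm p (S f) \<le> A * Lp_norm p f)"

definition extends_to_bounded_operator_Lp ::
    "real \<Rightarrow> ((real^2 \<Rightarrow> complex) \<Rightarrow> (real^2 \<Rightarrow> complex)) \<Rightarrow> bool" where
  "extends_to_bounded_operator_Lp p T \<longleftrightarrow>
     (\<exists>S. bounded_operator_Lp p S \<and> (\<forall>f. schwartz f \<longrightarrow> (AE x in lebesgue. S f x = T f x)))"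

definition L1_norm :: "(real^2 \<Rightarrow> complex) \<Rightarrow> ennreal" where
  "L1_norm f = (\<integral>\<^sup>+ x. ennreal (norm (f x)) \<partial>lebesgue)"

text \<open>The real Hardy space is given by the maximal function
  \<open>sup\<^sub>t |f * \<Phi>\<^sub>t|\<close>, \<open>\<Phi>\<^sub>t(x) = t\<^sup>-\<^sup>2 \<Phi>(x/t)\<close>, for the Gaussian \<open>\<Phi>(x) = (2\<pi>)\<^sup>-\<^sup>1 exp(-|x|\<^sup>2/2)\<close>.
  Any other Schwartz function of nonzero integral gives the same space with an equivalent norm.\<close>

definition gauss_kernel :: "real \<Rightarrow> real^2 \<Rightarrow> real" where
  "gauss_kernel t x = 1 / (2 * pi * t\<^sup>2) * exp (- (norm x)\<^sup>2 / (2 * t\<^sup>2))"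

definition hardy_maximal :: "(real^2 \<Rightarrow> complex) \<Rightarrow> real^2 \<Rightarrow> ennreal" where
  "hardy_maximal f x =
     (SUP t\<in>{0<..}. ennreal (norm (LINT y|lebesgue. complex_of_real (gauss_kernel t (x - y)) * f y)))"

definition H1_norm :: "(real^2 \<Rightarrow> complex) \<Rightarrow> ennreal" where
  "H1_norm f = (\<integral>\<^sup>+ x. hardy_maximal f x \<partial>lebesgue)"

definition H1_space :: "(real^2 \<Rightarrow> complex) set" where
  "H1_space = {f. integrable lebesgue f \<and> H1_norm f < \<infinity>}"

definition opnorm_H1_L1 :: "((real^2 \<Rightarrow> complex) \<Rightarrow> (real^2 \<Rightarrow> complex)) \<Rightarrow> ennreal" where
  "opnorm_H1_L1 T = (SUP f\<in>{f \<in> H1_space. H1_norm f \<le> 1}. L1_norm (T f))"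


section \<open>Quasiradial multipliers\<close>

text \<open>For bounded \<open>m\<close> of bounded support the inverse transform converges absolutely for every
  integrable \<open>f\<close>, because \<open>fourier f\<close> is then bounded. Hence the formula defines the operator not
  only on Schwartz functions but also on the Hardy space.\<close>

definition quasiradial_multiplier ::
    "(real^2) set \<Rightarrow> (real \<Rightarrow> complex) \<Rightarrow> (real^2 \<Rightarrow> complex) \<Rightarrow> (real^2 \<Rightarrow> complex)" where
  "quasiradial_multiplier \<Omega> m f =
     inverse_fourier (\<lambda>\<xi>. m (minkowski_functional \<Omega> \<xi>) * fourier f \<xi>)"

definition B_half_norm :: "(real \<Rightarrow> complex) \<Rightarrow> ennreal" where
  "B_half_norm m =
     (\<integral>\<^sup>+ \<tau>. ennreal (norm (fourier m \<tau>) * (1 + \<bar>\<tau>\<bar>) powr (1/2)) \<partial>lebesgue)"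

end

theory Submission
  imports Defs "HOL-Probability.Distributions"
begin

text \<open>The operator is convolution with the inverse transform \<open>K\<close> of \<open>m \<circ> \<rho>\<close>, and all bounds follow from
  \<open>\<parallel>K\<parallel>\<^sub>1 \<le> C \<parallel>m\<parallel>\<close>. Let \<open>n\<close> and \<open>\<psi>\<close> be the inverse transforms of \<open>m(s)\<close> and \<open>s m(s)\<close>. In polar coordinates adapted
  to \<open>\<rho>\<close>, \<open>K(x)\<close> is the integral of \<open>\<psi>(x \<bullet> \<omega>)\<close> over \<open>\<omega> \<in> \<partial>\<Omega>\<close> for the cone measure. Replace \<open>\<partial>\<Omega>\<close> by an inscribed
  polygon with vertices \<open>p\<^sub>k\<close> and edge directions \<open>v\<^sub>k\<close>, \<open>p\<^sub>k \<times> v\<^sub>k = 1\<close>. Edges almost orthogonal to \<open>x\<close>, in the sense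
  \<open>|x \<bullet> v\<^sub>k| \<le> c |x| / sqrt (1 + |x|)\<close>, are estimated by absolute values. On the others the integral is the difference of
  \<open>n(x \<bullet> p\<^sub>k)\<close> at the end points, divided by \<open>x \<bullet> v\<^sub>k\<close>, and summation by parts leaves the increments of
  \<open>1 / (x \<bullet> v\<^sub>k)\<close>, which are controlled by the total turning. In the unimodular coordinates \<open>(x \<bullet> p\<^sub>k, x \<bullet> v\<^sub>k)\<close> both
  parts become integrals of \<open>\<psi>\<close> and \<open>n\<close> against \<open>sqrt (1 + |a|)\<close>, uniformly in the polygon.\<close>

text \<open>The exponent 1/2 comes from balancing the two kinds of edges. Fix a =
  \<open>x \<bullet> p\<close> and let b = \<open>x \<bullet> v\<close> vary. A strip |b| \<le> c
  has width of order c, while the increments of the reciprocal contribute |a| / b^2, whose integral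
  over |b| \<ge> c is of order |a| / c. For large |a| the two agree when c is of order sqrt |a|,
  which fixes the threshold. It is also at most |x| / (2 P), which makes |x| \<le> |a| inside the
  strip, so that there the threshold can be read off from a. A sharp cutoff would create boundary
  terms in the summation by parts, at edges depending on x. The reciprocal is therefore replaced by
  a Lipschitz function of b, linear for small b, and the sum closes up cyclically. As the number of
  edges grows, constants may only come from quantities bounded uniformly: twice the enclosed area,
  and the total turning of the normalised edge directions. The near part produces the transform of s
  m(s); since m lives on [0, 2], this is an average of translates of the transform of m, at the cost
  of an absolute constant.\<close>

abbreviation mass :: "('a::euclidean_space \<Rightarrow> 'b::real_normed_vector) \<Rightarrow> ennreal" where
  "mass f \<equiv> \<integral>\<^sup>+x. ennreal (norm (f x)) \<partial>lborel"

abbreviation weighted_mass :: "(real \<Rightarrow> complex) \<Rightarrow> ennreal" where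
  "weighted_mass f \<equiv> \<integral>\<^sup>+a. ennreal (norm (f a) * sqrt (1 + \<bar>a\<bar>)) \<partial>lborel"

abbreviation times_id :: "(real \<Rightarrow> complex) \<Rightarrow> real \<Rightarrow> complex" where
  "times_id m \<equiv> \<lambda>s. of_real s * m s"

section \<open>Coordinates in the plane\<close>

definition pt :: "real \<Rightarrow> real \<Rightarrow> real^2" where
  "pt a b = a *\<^sub>R axis 1 1 + b *\<^sub>R axis 2 1"

definition cross2 :: "real^2 \<Rightarrow> real^2 \<Rightarrow> real" where
  "cross2 p v = p $ 1 * v $ 2 - p $ 2 * v $ 1"

lemma pt_nth [simp]: "pt a b $ 1 = a" "pt a b $ 2 = b"
  by (simp_all add: pt_def axis_def)

lemma pt_eta: "pt (x $ 1) (x $ 2) = x"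
  by (simp add: vec_eq_iff forall_2)

lemma inner_pt: "x \<bullet> y = x $ 1 * y $ 1 + x $ 2 * (y::real^2) $ 2"
  by (simp add: inner_vec_def sum_2)

lemma pt_measurable [measurable]:
  assumes [measurable]: "f \<in> borel_measurable M" "g \<in> borel_measurable M"
  shows "(\<lambda>x. pt (f x) (g x)) \<in> borel_measurable M"
  unfolding pt_def by measurable

lemma borel_measurable_nth2 [measurable]: "(\<lambda>x::real^2. x $ i) \<in> borel_measurable borel"
  by (intro borel_measurable_continuous_onI continuous_intros)

lemma Basis_real2: "(Basis :: (real^2) set) = {axis 1 1, axis 2 1}"
  by (auto simp: Basis_vec_def UNIV_2)

text \<open>Both measures give a box the product of its side lengths, and this determines Lebesgue
  measure. It is the bridge from the vector type to iterated one-dimensional integrals.\<close>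

lemma lborel_real2: "lborel = distr (lborel \<Otimes>\<^sub>M lborel) borel (\<lambda>(a, b). pt a b)"
proof (rule lborel_eqI)
  fix l u :: "real^2"
  assume le: "\<And>b. b \<in> Basis \<Longrightarrow> l \<bullet> b \<le> u \<bullet> b"
  have le': "l $ 1 \<le> u $ 1" "l $ 2 \<le> u $ 2"
    using le[of "axis 1 1"] le[of "axis 2 1"] by (simp_all add: Basis_real2 inner_axis)
  have ne: "axis 1 1 \<noteq> (axis 2 1 :: real^2)"
    by (auto simp: axis_eq_axis)
  have eq: "(\<lambda>z. pt (fst z) (snd z)) -` box l u \<inter> space (lborel \<Otimes>\<^sub>M lborel) = {l$1<..<u$1} \<times> {l$2<..<u$2}"
    by (auto simp: box_def Basis_real2 inner_axis space_pair_measure)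
  show "emeasure (distr (lborel \<Otimes>\<^sub>M lborel) borel (\<lambda>(a, b). pt a b)) (box l u) = (\<Prod>b\<in>Basis. (u - l) \<bullet> b)"
    using le' ne
    by (subst emeasure_distr)
       (auto simp: eq lborel.emeasure_pair_measure_Times Basis_real2 inner_axis ennreal_mult' split_beta')
qed simp

lemma nn_integral_real2:
  assumes [measurable]: "f \<in> borel_measurable borel"
  shows "(\<integral>\<^sup>+x. f (x::real^2) \<partial>lborel) = (\<integral>\<^sup>+a. \<integral>\<^sup>+b. f (pt a b) \<partial>lborel \<partial>lborel)"
  by (subst lborel_real2) (simp add: nn_integral_distr split_beta' lborel.nn_integral_fst[symmetric])

lemma integral_real2:
  fixes f :: "real^2 \<Rightarrow> complex"
  assumes "integrable lborel f"
  shows "integrable (lborel \<Otimes>\<^sub>M lborel) (\<lambda>(a, b). f (pt a b))"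
    and "(LINT x|lborel. f x) = (LINT z|(lborel \<Otimes>\<^sub>M lborel). f (pt (fst z) (snd z)))"
proof -
  have m[measurable]: "f \<in> borel_measurable borel" using assms by auto
  show "integrable (lborel \<Otimes>\<^sub>M lborel) (\<lambda>(a, b). f (pt a b))"
    using assms by (subst (asm) lborel_real2, subst (asm) integrable_distr_eq) (auto simp: split_beta')
  show "(LINT x|lborel. f x) = (LINT z|(lborel \<Otimes>\<^sub>M lborel). f (pt (fst z) (snd z)))"
    by (subst lborel_real2, subst integral_distr) (auto simp: split_beta')
qed

lemma nn_integral_real_linear:
  fixes F :: "real \<Rightarrow> ennreal"
  assumes [measurable]: "F \<in> borel_measurable borel" and "c \<noteq> 0"
  shows "(\<integral>\<^sup>+x. F (c * x + t) \<partial>lborel) = ennreal (1 / \<bar>c\<bar>) * (\<integral>\<^sup>+x. F x \<partial>lborel)"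
  using nn_integral_real_affine[OF assms, of t] assms(2)
  by (simp add: mult.assoc[symmetric] ennreal_mult'[symmetric] add.commute)

text \<open>With a = p1 x + p2 y as new variable, the second argument becomes y / p1 + (v1 / p1) a,
  because the determinant is 1. The substitution in x then contributes 1 / |p1|, the one in y
  contributes |p1|, and the factors cancel.\<close>

lemma nn_integral_unimodular_aux:
  fixes F :: "real \<times> real \<Rightarrow> ennreal"
  assumes [measurable]: "F \<in> borel_measurable borel"
    and 1: "p1 * v2 - p2 * v1 = (1::real)" and p1: "p1 \<noteq> 0"
  shows "(\<integral>\<^sup>+y. \<integral>\<^sup>+x. F (p1 * x + p2 * y, v1 * x + v2 * y) \<partial>lborel \<partial>lborel)
    = (\<integral>\<^sup>+a. \<integral>\<^sup>+b. F (a, b) \<partial>lborel \<partial>lborel)"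
proof -
  have [measurable]: "F \<in> borel_measurable (borel \<Otimes>\<^sub>M borel)"
    by (simp add: borel_prod)
  have "(\<integral>\<^sup>+x. F (p1 * x + p2 * y, v1 * x + v2 * y) \<partial>lborel)
      = ennreal (1 / \<bar>p1\<bar>) * (\<integral>\<^sup>+a. F (a, (1 / p1) * y + v1 / p1 * a) \<partial>lborel)" for y
  proof -
    have e: "v1 * x + v2 * y = (1 / p1) * y + v1 / p1 * (p1 * x + p2 * y)" for x
    proof -
      have "v2 = 1 / p1 + v1 / p1 * p2" using 1 p1 by (simp add: field_simps)
      then show ?thesis using p1 by (simp add: algebra_simps)
    qed
    show ?thesis
      unfolding e using nn_integral_real_linear[of "\<lambda>a. F (a, (1 / p1) * y + v1 / p1 * a)" p1 "p2 * y"] p1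
      by simp
  qed
  then have "(\<integral>\<^sup>+y. \<integral>\<^sup>+x. F (p1 * x + p2 * y, v1 * x + v2 * y) \<partial>lborel \<partial>lborel)
    = ennreal (1 / \<bar>p1\<bar>) * (\<integral>\<^sup>+y. \<integral>\<^sup>+a. F (a, (1 / p1) * y + v1 / p1 * a) \<partial>lborel \<partial>lborel)"
    by (simp add: nn_integral_cmult)
  also have "\<dots> = ennreal (1 / \<bar>p1\<bar>) * (\<integral>\<^sup>+a. \<integral>\<^sup>+y. F (a, (1 / p1) * y + v1 / p1 * a) \<partial>lborel \<partial>lborel)"
    by (subst lborel_pair.Fubini') auto
  also have "\<dots> = ennreal (1 / \<bar>p1\<bar>) * (\<integral>\<^sup>+a. ennreal \<bar>p1\<bar> * (\<integral>\<^sup>+b. F (a, b) \<partial>lborel) \<partial>lborel)"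
    using p1 by (subst nn_integral_real_linear) auto
  also have "\<dots> = (\<integral>\<^sup>+a. \<integral>\<^sup>+b. F (a, b) \<partial>lborel \<partial>lborel)"
    using p1 by (simp add: nn_integral_cmult mult.assoc[symmetric] ennreal_mult'[symmetric])
  finally show ?thesis .
qed

lemma nn_integral_unimodular:
  fixes F :: "real \<times> real \<Rightarrow> ennreal"
  assumes [measurable]: "F \<in> borel_measurable borel" and 1: "cross2 p v = 1"
  shows "(\<integral>\<^sup>+x. F (x \<bullet> p, x \<bullet> v) \<partial>lborel) = (\<integral>\<^sup>+a. \<integral>\<^sup>+b. F (a, b) \<partial>lborel \<partial>lborel)"
proof -
  have [measurable]: "F \<in> borel_measurable (borel \<Otimes>\<^sub>M borel)"
    by (simp add: borel_prod)
  have "(\<integral>\<^sup>+x. F (x \<bullet> p, x \<bullet> v) \<partial>lborel)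
      = (\<integral>\<^sup>+a. \<integral>\<^sup>+b. F (p$1 * a + p$2 * b, v$1 * a + v$2 * b) \<partial>lborel \<partial>lborel)"
    by (subst nn_integral_real2) (auto simp: inner_pt mult.commute)
  also have "\<dots> = (\<integral>\<^sup>+a. \<integral>\<^sup>+b. F (a, b) \<partial>lborel \<partial>lborel)"
  proof (cases "p $ 1 = 0")
    case False
    then show ?thesis
      by (subst lborel_pair.Fubini', simp, subst nn_integral_unimodular_aux)
         (use 1 in \<open>auto simp: cross2_def\<close>)
  next
    case True
    \<comment> \<open>Exchanging the two coordinates makes the leading coefficient nonzero but
      reverses the orientation; the reflection of the second argument restores determinant
      1.\<close>
    define G where "G = (\<lambda>z. F (fst z, - snd z))"
    have [measurable]: "G \<in> borel_measurable borel"
      unfolding G_def by (simp add: borel_prod[symmetric])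
    have "p $ 2 \<noteq> 0" using 1 True by (auto simp: cross2_def)
    then have "(\<integral>\<^sup>+a. \<integral>\<^sup>+b. G (p$2 * b + p$1 * a, (- v$2) * b + (- v$1) * a) \<partial>lborel \<partial>lborel)
        = (\<integral>\<^sup>+a. \<integral>\<^sup>+b. G (a, b) \<partial>lborel \<partial>lborel)"
      using 1 by (intro nn_integral_unimodular_aux) (auto simp: cross2_def)
    moreover have "(\<integral>\<^sup>+b. G (a, b) \<partial>lborel) = (\<integral>\<^sup>+b. F (a, b) \<partial>lborel)" for a
      using nn_integral_real_linear[of "\<lambda>b. F (a, b)" "-1" 0] by (simp add: G_def)
    ultimately show ?thesis
      by (simp add: G_def algebra_simps)
  qed
  finally show ?thesis .
qed

section \<open>One-dimensional transforms\<close>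

text \<open>The inverse transform without its constant; for Borel \<open>m\<close> it is the Fourier
  transform at -a. Having no factor 2 pi here keeps constants out of the polygon estimates.\<close>

definition osc :: "(real \<Rightarrow> complex) \<Rightarrow> real \<Rightarrow> complex" where
  "osc m a = (LINT s|lborel. cis (a * s) * m s)"

lemma borel_measurable_cis [measurable]:
  "f \<in> borel_measurable M \<Longrightarrow> (\<lambda>x. cis (f x)) \<in> borel_measurable M"
  by (rule measurable_compose[of f M borel cis])
     (auto intro!: borel_measurable_continuous_onI continuous_intros)

lemma osc_measurable [measurable]:
  assumes [measurable]: "m \<in> borel_measurable borel"
  shows "osc m \<in> borel_measurable borel"
  unfolding osc_def by measurable

lemma nn_integral_even:
  fixes f :: "real \<Rightarrow> ennreal"
  assumes [measurable]: "f \<in> borel_measurable borel"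
  shows "(\<integral>\<^sup>+y. f \<bar>y\<bar> \<partial>lborel) = 2 * (\<integral>\<^sup>+y. f y * indicator {0..} y \<partial>lborel)"
proof -
  have "(\<integral>\<^sup>+y. f \<bar>y\<bar> \<partial>lborel) = (\<integral>\<^sup>+y. f y * indicator {0..} y + f (- y) * indicator {0..} (- y) \<partial>lborel)"
  proof (rule nn_integral_cong_AE)
    have "AE y::real in lborel. y \<noteq> 0" by (rule AE_lborel_singleton)
    then show "AE y in lborel. f \<bar>y\<bar> = f y * indicator {0..} y + f (- y) * indicator {0..} (- y)"
      by eventually_elim (auto simp: indicator_def)
  qed
  also have "\<dots> = 2 * (\<integral>\<^sup>+y. f y * indicator {0..} y \<partial>lborel)"
    using nn_integral_real_affine[of "\<lambda>y. f y * indicator {0..} y" "-1" 0]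
    by (simp add: nn_integral_add mult_2)
  finally show ?thesis .
qed

text \<open>Used with r = 3/2 for the weighted Fejer kernel, and with r = 2 for the far part of the
  polygon kernel and for the decay of Schwartz functions.\<close>

lemma nn_integral_powr_tail:
  fixes t r :: real
  assumes "t > 0" "r > 1"
  shows "(\<integral>\<^sup>+y. ennreal ((t + \<bar>y\<bar>) powr (- r)) \<partial>lborel) = ennreal (2 * t powr (1 - r) / (r - 1))"
proof -
  have "(\<integral>\<^sup>+y. ennreal ((t + y) powr (- r)) * indicator {0..} y \<partial>lborel)
     = ennreal (0 - (- ((t + 0) powr (1 - r) / (r - 1))))"
  proof (rule nn_integral_FTC_atLeast)
    fix x :: real assume "0 \<le> x"
    have "((\<lambda>y. t + y) has_real_derivative 1) (at x)"
      by (auto intro!: derivative_eq_intros)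
    from DERIV_fun_powr[OF this, of "1 - r"] \<open>0 \<le> x\<close> assms
    have "((\<lambda>y. (t + y) powr (1 - r)) has_real_derivative (1 - r) * (t + x) powr (- r)) (at x)"
      by simp
    from DERIV_cmult[OF this, of "- 1 / (r - 1)"]
    have "((\<lambda>y. - ((t + y) powr (1 - r) / (r - 1))) has_real_derivative - 1 / (r - 1) * ((1 - r) * (t + x) powr (- r))) (at x)"
      by simp
    also have "- 1 / (r - 1) * ((1 - r) * (t + x) powr (- r)) = (t + x) powr (- r)"
      using assms by (simp add: field_simps)
    finally show "((\<lambda>y. - ((t + y) powr (1 - r) / (r - 1))) has_real_derivative (t + x) powr (- r)) (at x)" .
  next
    have "((\<lambda>y. - ((t + y) powr (1 - r) / (r - 1))) \<longlongrightarrow> - (0 / (r - 1))) at_top"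
      using assms by (intro tendsto_intros tendsto_neg_powr filterlim_tendsto_add_at_top[OF tendsto_const filterlim_ident]) auto
    then show "((\<lambda>y. - ((t + y) powr (1 - r) / (r - 1))) \<longlongrightarrow> 0) at_top" by simp
  qed (use assms in auto)
  then show ?thesis
    using assms by (subst nn_integral_even[of "\<lambda>y. ennreal ((t + y) powr (- r))"])
      (auto simp: ennreal_mult'[symmetric] ennreal_numeral[symmetric] simp del: ennreal_numeral)
qed


section \<open>The Fejer kernel and multiplication by s\<close>

definition fejer :: "real \<Rightarrow> real \<Rightarrow> real" where
  "fejer c y = (1 - cos (c * y)) / y\<^sup>2"

lemma fejer_measurable [measurable]: "fejer c \<in> borel_measurable borel"
  unfolding fejer_def by measurable

lemma fejer_nonneg: "0 \<le> fejer c y"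
  by (simp add: fejer_def)

text \<open>The constant covers two regimes: for |y| \<le> 1 the half-angle formula gives at most
  c^2 / 2, and for larger |y| the numerator is at most 2; in both, (1 + |y|)^2 is at most 4 times
  max(1, y^2).\<close>

lemma fejer_bound: "fejer c y \<le> (2 * c\<^sup>2 + 8) * (1 + \<bar>y\<bar>) powr (-2)"
proof -
  have p: "(1 + \<bar>y\<bar>) powr (-2) = 1 / (1 + \<bar>y\<bar>)\<^sup>2"
    by (simp add: powr_minus_divide powr_numeral add_pos_nonneg)
  show ?thesis
  proof (cases "\<bar>y\<bar> \<le> 1")
    case True
    have "1 - cos (c * y) = 2 * (sin (c * y / 2))\<^sup>2"
      using cos_double_sin[of "c * y / 2"] by simp
    also have "\<dots> \<le> 2 * (c * y / 2)\<^sup>2"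
      by (intro mult_left_mono iffD1[OF abs_le_square_iff abs_sin_x_le_abs_x]) auto
    finally have "fejer c y \<le> c\<^sup>2 / 2"
      unfolding fejer_def by (cases "y = 0") (auto simp: field_simps power_mult_distrib)
    moreover have "(1 + \<bar>y\<bar>)\<^sup>2 \<le> 2\<^sup>2" using True by (intro power_mono) auto
    ultimately have "fejer c y * (1 + \<bar>y\<bar>)\<^sup>2 \<le> c\<^sup>2 / 2 * 2\<^sup>2"
      by (intro mult_mono) auto
    then have "fejer c y * (1 + \<bar>y\<bar>)\<^sup>2 \<le> 2 * c\<^sup>2 + 8" by simp
    then show ?thesis unfolding p by (simp add: field_simps add_pos_nonneg)
  next
    case False
    then have y: "\<bar>y\<bar> > 1" by simp
    have "(1 + \<bar>y\<bar>)\<^sup>2 \<le> (2 * \<bar>y\<bar>)\<^sup>2" using y by (intro power_mono) auto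
    then have "(1 + \<bar>y\<bar>)\<^sup>2 \<le> 4 * y\<^sup>2" by (simp add: power_mult_distrib)
    moreover have "1 - cos (c * y) \<le> 2" using cos_ge_minus_one[of "c * y"] by linarith
    ultimately have "(1 - cos (c * y)) * (1 + \<bar>y\<bar>)\<^sup>2 \<le> 2 * (4 * y\<^sup>2)"
      by (intro mult_mono) auto
    also have "\<dots> \<le> (2 * c\<^sup>2 + 8) * y\<^sup>2" by (simp add: algebra_simps)
    finally have *: "(1 - cos (c * y)) * (1 + \<bar>y\<bar>)\<^sup>2 \<le> (2 * c\<^sup>2 + 8) * y\<^sup>2" .
    have "A / B \<le> C * (1 / D)" if "0 < B" "0 < D" "A * D \<le> C * B" for A B C D :: real
      using that by (simp add: field_simps)
    from this[OF _ _ *] y show ?thesis unfolding p fejer_def by simp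
  qed
qed

text \<open>The weight raises the decay exponent from -2 to -3/2, which is still integrable. The
  tail integral with r = 3/2 equals 4, hence the constant 4 (2 c^2 + 8).\<close>

lemma fejer_weighted_finite:
  "(\<integral>\<^sup>+y. ennreal (fejer c y * sqrt (1 + \<bar>y\<bar>)) \<partial>lborel) \<le> ennreal (8 * c\<^sup>2 + 32)"
proof -
  have "fejer c y * sqrt (1 + \<bar>y\<bar>) \<le> (2 * c\<^sup>2 + 8) * (1 + \<bar>y\<bar>) powr (- (3/2))" for y
  proof -
    have "fejer c y * sqrt (1 + \<bar>y\<bar>) \<le> (2 * c\<^sup>2 + 8) * (1 + \<bar>y\<bar>) powr (-2) * sqrt (1 + \<bar>y\<bar>)"
      by (intro mult_right_mono fejer_bound) auto
    also have "\<dots> = (2 * c\<^sup>2 + 8) * ((1 + \<bar>y\<bar>) powr (-2) * (1 + \<bar>y\<bar>) powr (1/2))"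
      by (simp add: powr_half_sqrt)
    also have "(1 + \<bar>y\<bar>) powr (-2) * (1 + \<bar>y\<bar>) powr (1/2) = (1 + \<bar>y\<bar>) powr (- (3/2))"
      by (subst powr_add[symmetric]) simp
    finally show ?thesis .
  qed
  then have "(\<integral>\<^sup>+y. ennreal (fejer c y * sqrt (1 + \<bar>y\<bar>)) \<partial>lborel)
      \<le> (\<integral>\<^sup>+y. ennreal (2 * c\<^sup>2 + 8) * ennreal ((1 + \<bar>y\<bar>) powr (- (3/2))) \<partial>lborel)"
    by (intro nn_integral_mono) (simp add: ennreal_mult'[symmetric] del: ennreal_plus)
  also have "\<dots> = ennreal (8 * c\<^sup>2 + 32)"
    using nn_integral_powr_tail[of 1 "3/2"]
    by (subst nn_integral_cmult)
       (simp_all add: ennreal_mult'[symmetric] algebra_simps del: ennreal_plus flip: ennreal_numeral)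
  finally show ?thesis .
qed

lemma integrable_fejer: "integrable lborel (fejer c)"
proof (rule integrableI_bounded)
  have "mass (fejer c) \<le> (\<integral>\<^sup>+y. ennreal (fejer c y * sqrt (1 + \<bar>y\<bar>)) \<partial>lborel)"
    by (intro nn_integral_mono ennreal_leI)
       (use mult_left_mono[OF _ fejer_nonneg, of 1 _ c] in \<open>simp add: fejer_nonneg\<close>)
  also have "\<dots> < \<infinity>"
    using fejer_weighted_finite[of c] by (simp add: le_less_trans)
  finally show "mass (fejer c) < \<infinity>" .
qed simp

text \<open>This number is pi; positivity is the property on which the estimates rest.\<close>

definition fejer_const :: real where
  "fejer_const = (LINT y|lborel. fejer 1 y)"

lemma fejer_const_pos: "fejer_const > 0"
proof -
  have "fejer_const \<ge> 0"
    unfolding fejer_const_def by (intro integral_nonneg_AE) (simp add: fejer_nonneg)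
  moreover have "fejer_const \<noteq> 0"
  proof
    assume "fejer_const = 0"
    then have "AE y in lborel. fejer 1 y = 0"
      unfolding fejer_const_def
      by (subst (asm) integral_nonneg_eq_0_iff_AE) (auto simp: fejer_nonneg integrable_fejer)
    then have "AE y in lborel. y \<notin> {1..2::real}"
    proof eventually_elim
      case (elim y)
      show ?case
      proof
        assume y: "y \<in> {1..2}"
        then have "cos y < cos 0" using pi_gt3 by (intro cos_monotone_0_pi) auto
        then show False using elim y by (auto simp: fejer_def)
      qed
    qed
    then have "emeasure lborel {1..2::real} = 0"
      by (simp add: AE_iff_null null_sets_def del: atLeastAtMost_iff)
    then show False by simp
  qed
  ultimately show ?thesis by simp
qed

lemma integral_fejer: "(LINT y|lborel. fejer c y) = fejer_const * \<bar>c\<bar>"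
proof (cases "c = 0")
  case False
  have e: "fejer 1 (0 + c * y) = inverse (c\<^sup>2) * fejer c y" for y
    by (simp add: fejer_def power_mult_distrib field_simps)
  have "fejer_const = \<bar>c\<bar> * (LINT y|lborel. fejer 1 (0 + c * y))"
    unfolding fejer_const_def using lborel_integral_real_affine[OF False, of "fejer 1" 0] by simp
  also have "\<dots> = \<bar>c\<bar> * inverse (c\<^sup>2) * (LINT y|lborel. fejer c y)"
    unfolding e by simp
  also have "\<bar>c\<bar> * inverse (c\<^sup>2) = inverse \<bar>c\<bar>"
    using False by (cases "c > 0") (auto simp: power2_eq_square field_simps)
  finally show ?thesis using False by (simp add: field_simps)
qed (simp add: fejer_def)

text \<open>The integral of \<open>fejer c\<close> is proportional to |c|. The product formula for
  cosines thus turns the left side into a multiple of |s| / 2 + |s - 4| / 2 - |s - 2|, a tent with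
  top at s = 2 and feet at 0 and 4. On [0, 2] its rising flank is s itself.\<close>

lemma identity_as_fejer_integral:
  assumes "0 \<le> s" "s \<le> 2"
  shows "(LINT y|lborel. fejer 2 y * cos ((s - 2) * y)) = fejer_const * s"
proof -
  have e: "fejer 2 y * cos ((s - 2) * y) = (1/2) * fejer s y + (1/2) * fejer (s - 4) y - fejer (s - 2) y" for y
  proof -
    have "(1 - cos (2 * y)) * cos ((s - 2) * y)
       = (1/2) * (1 - cos (s * y)) + (1/2) * (1 - cos ((s - 4) * y)) - (1 - cos ((s - 2) * y))"
      using cos_times_cos[of "(s - 2) * y" "2 * y"] by (simp add: algebra_simps)
    then show ?thesis unfolding fejer_def by (metis (no_types) add_divide_distrib diff_divide_distrib times_divide_eq_left times_divide_eq_right)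
  qed
  show ?thesis
    unfolding e using assms
    by (simp add: integrable_fejer integral_fejer) (simp add: field_simps)
qed

text \<open>Submultiplicativity is what allows the weight at a to be moved to the translate a + y,
  the kernel paying a factor sqrt (1 + |y|).\<close>

lemma sqrt_weight_submult: "sqrt (1 + \<bar>a\<bar>) \<le> sqrt (1 + \<bar>a + y\<bar>) * sqrt (1 + \<bar>y\<bar>)"
proof -
  have "1 + \<bar>a\<bar> \<le> (1 + \<bar>a + y\<bar>) * (1 + \<bar>y\<bar>)"
  proof -
    have "0 \<le> \<bar>a + y\<bar> * \<bar>y\<bar>" by simp
    then show ?thesis
      using abs_triangle_ineq4[of "a + y" y] unfolding distrib_left distrib_right mult_1_left mult_1_right add_diff_cancel_right'
      by linarith
  qed
  then show ?thesis by (simp flip: real_sqrt_mult)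
qed

text \<open>On \<open>[0, 2]\<close> the function \<open>s\<close> is a superposition of the oscillations \<open>cos ((s - 2) y)\<close> against the
  kernel \<open>fejer 2\<close>, so multiplication of \<open>m\<close> by \<open>s\<close> averages translates of the transform.\<close>

lemma osc_times_id_bound:
  assumes [measurable]: "m \<in> borel_measurable borel" and int: "integrable lborel m"
    and supp: "\<And>s. s \<notin> {0..2} \<Longrightarrow> m s = 0"
  shows "ennreal (norm (osc (times_id m) a))
     \<le> (\<integral>\<^sup>+y. ennreal (1 / (2 * fejer_const) * fejer 2 y) *
           (ennreal (norm (osc m (a + y))) + ennreal (norm (osc m (a - y)))) \<partial>lborel)"
proof -
  let ?D = "\<lambda>y. ennreal (norm (osc m (a + y))) + ennreal (norm (osc m (a - y)))"
  let ?k = "fejer_const"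
  have k: "?k > 0" by (rule fejer_const_pos)
  \<comment> \<open>Integrating this over y multiplies m by s, by the tent identity on [0, 2] and
    because m vanishes elsewhere. Integrating over s gives modulated copies of \<open>osc m\<close>
    at a + y and a - y. Fubini equates the two.\<close>
  define g where "g = (\<lambda>(s, y). cis (a * s) * m s * of_real (fejer 2 y * cos ((s - 2) * y)))"
  have gm[measurable]: "g \<in> borel_measurable (lborel \<Otimes>\<^sub>M lborel)"
    unfolding g_def by measurable
  have gi: "integrable (lborel \<Otimes>\<^sub>M lborel) g"
  proof (rule Bochner_Integration.integrable_bound)
    have "integrable (lborel \<Otimes>\<^sub>M lborel) (\<lambda>(s, y). norm (m s) * fejer 2 y)"
      by (rule lborel_pair.Fubini_integrable)
         (auto simp: int integrable_fejer abs_mult abs_of_nonneg[OF fejer_nonneg])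
    then show "integrable (lborel \<Otimes>\<^sub>M lborel) (\<lambda>(s, y). norm (m s) * fejer 2 y)" .
    show "AE x in lborel \<Otimes>\<^sub>M lborel. norm (g x) \<le> norm (case x of (s, y) \<Rightarrow> norm (m s) * fejer 2 y)"
      by (intro AE_I2) (auto simp: g_def norm_mult abs_mult split_beta' intro!: mult_left_mono mult_left_le)
  qed simp
  have inner: "of_real ?k * (of_real s * m s) * cis (a * s) = (LINT y|lborel. g (s, y))" for s
  proof (cases "s \<in> {0..2}")
    case True
    have "(LINT y|lborel. g (s, y)) = cis (a * s) * m s * of_real (LINT y|lborel. fejer 2 y * cos ((s - 2) * y))"
      unfolding g_def by (simp flip: integral_complex_of_real)
    then show ?thesis using True by (simp add: identity_as_fejer_integral)
  qed (simp add: g_def supp)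
  have outer: "(LINT s|lborel. g (s, y)) = of_real (fejer 2 y) / 2 *
       (cis (- 2 * y) * osc m (a + y) + cis (2 * y) * osc m (a - y))" for y
  proof -
    have i: "integrable lborel (\<lambda>s. cis (b * s) * m s)" for b
      by (rule Bochner_Integration.integrable_bound[OF int]) (auto simp: norm_mult)
    have cc: "of_real (cos t) = (cis t + cis (- t)) / 2" for t
      by (simp add: complex_eq_iff)
    have e: "g (s, y) = of_real (fejer 2 y) / 2 * (cis (- 2 * y) * (cis ((a + y) * s) * m s)
        + cis (2 * y) * (cis ((a - y) * s) * m s))" for s
      unfolding g_def by (simp add: cc algebra_simps cis_mult add_divide_distrib)
    show ?thesis unfolding e osc_def
      by (subst integral_mult_right_zero, subst Bochner_Integration.integral_add)
         (auto intro!: integrable_mult_right i)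
  qed
  have "of_real ?k * osc (times_id m) a = (LINT s|lborel. of_real ?k * (of_real s * m s) * cis (a * s))"
    unfolding osc_def by (subst integral_mult_right_zero[symmetric]) (simp add: mult_ac)
  also have "\<dots> = (LINT y|lborel. LINT s|lborel. g (s, y))"
    unfolding inner using lborel_pair.Fubini_integral[of "\<lambda>s y. g (s, y)"] gi by simp
  finally have eq: "of_real ?k * osc (times_id m) a = (LINT y|lborel. LINT s|lborel. g (s, y))" .
  have gi2: "integrable lborel (\<lambda>y. LINT s|lborel. g (s, y))"
    using lborel_pair.integrable_snd[of "\<lambda>s y. g (s, y)"] gi by simp
  have "ennreal (?k * norm (osc (times_id m) a)) = ennreal (norm (LINT y|lborel. LINT s|lborel. g (s, y)))"
    using k by (simp flip: eq add: norm_mult)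
  also have "\<dots> \<le> (\<integral>\<^sup>+y. ennreal (norm (LINT s|lborel. g (s, y))) \<partial>lborel)"
    by (rule integral_norm_bound_ennreal[OF gi2])
  also have "\<dots> \<le> (\<integral>\<^sup>+y. ennreal (fejer 2 y / 2) * ?D y \<partial>lborel)"
  proof (intro nn_integral_mono)
    fix y
    have "norm (LINT s|lborel. g (s, y)) = fejer 2 y / 2 * norm (cis (- 2 * y) * osc m (a + y) + cis (2 * y) * osc m (a - y))"
      unfolding outer by (simp add: norm_mult norm_divide fejer_nonneg)
    also have "\<dots> \<le> fejer 2 y / 2 * (norm (osc m (a + y)) + norm (osc m (a - y)))"
      by (intro mult_left_mono norm_triangle_le) (auto simp: norm_mult fejer_nonneg)
    finally show "ennreal (norm (LINT s|lborel. g (s, y)))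
        \<le> ennreal (fejer 2 y / 2) * ?D y"
      by (simp add: fejer_nonneg flip: ennreal_mult ennreal_plus)
  qed
  finally have "ennreal (1 / ?k) * ennreal (?k * norm (osc (times_id m) a))
    \<le> ennreal (1 / ?k) * (\<integral>\<^sup>+y. ennreal (fejer 2 y / 2) * ?D y \<partial>lborel)"
    by (intro mult_left_mono) auto
  also have "\<dots> = (\<integral>\<^sup>+y. ennreal (1 / (2 * ?k) * fejer 2 y) *
           ?D y \<partial>lborel)"
    using k by (subst nn_integral_cmult[symmetric])
       (auto simp: mult.assoc[symmetric] fejer_nonneg mult.commute[of fejer_const 2]
          simp flip: ennreal_mult intro!: nn_integral_cong)
  finally show ?thesis
    using k by (simp flip: ennreal_mult)
qed

text \<open>A weighted form of Young's inequality for convolutions. Each of the two translates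
  contributes the weighted mass of \<open>osc m\<close>, which absorbs the 1/2 in the averaging
  formula; the factor 64 is 8 c^2 + 32 at c = 2.\<close>

lemma osc_times_id_weighted:
  assumes [measurable]: "m \<in> borel_measurable borel" and int: "integrable lborel m"
    and supp: "\<And>s. s \<notin> {0..2} \<Longrightarrow> m s = 0"
  shows "weighted_mass (osc (times_id m))
    \<le> ennreal (64 / fejer_const) * (weighted_mass (osc m))"
proof -
  let ?q = "\<lambda>y. ennreal (1 / (2 * fejer_const) * fejer 2 y)"
  let ?w = "\<lambda>y::real. ennreal (sqrt (1 + \<bar>y\<bar>))"
  let ?k = "fejer_const"
  define N where "N = (weighted_mass (osc m))"
  define h where "h b = ennreal (norm (osc m b) * sqrt (1 + \<bar>b\<bar>))" for b
  have [measurable]: "h \<in> borel_measurable borel" unfolding h_def by measurable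
  have k: "?k > 0" by (rule fejer_const_pos)
  have w: "ennreal (norm (osc m (a + y))) * ennreal (sqrt (1 + \<bar>a\<bar>)) \<le> h (a + y) * ?w y" for a y
    unfolding h_def using mult_left_mono[OF sqrt_weight_submult[of a y], of "norm (osc m (a + y))"]
    by (simp add: mult.assoc flip: ennreal_mult)
  have "weighted_mass (osc (times_id m))
    \<le> (\<integral>\<^sup>+a. (\<integral>\<^sup>+y. ?q y *
           (ennreal (norm (osc m (a + y))) + ennreal (norm (osc m (a - y)))) \<partial>lborel) * ennreal (sqrt (1 + \<bar>a\<bar>)) \<partial>lborel)"
    by (intro nn_integral_mono, subst ennreal_mult) (auto intro!: mult_right_mono osc_times_id_bound[simplified] assms)
  also have "\<dots> = (\<integral>\<^sup>+a. \<integral>\<^sup>+y. ?q y *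
           (ennreal (norm (osc m (a + y))) + ennreal (norm (osc m (a - y)))) * ennreal (sqrt (1 + \<bar>a\<bar>)) \<partial>lborel \<partial>lborel)"
    by (simp add: nn_integral_multc)
  also have "\<dots> \<le> (\<integral>\<^sup>+a. \<integral>\<^sup>+y. ?q y *
           (h (a + y) * ?w y + h (a - y) * ?w y) \<partial>lborel \<partial>lborel)"
    using w[of _ "- _"] w
    by (intro nn_integral_mono) (simp add: mult.assoc distrib_right add_mono mult_left_mono)
  also have "\<dots> = (\<integral>\<^sup>+y. \<integral>\<^sup>+a. ?q y *
           (h (a + y) * ?w y + h (a - y) * ?w y) \<partial>lborel \<partial>lborel)"
    by (rule lborel_pair.Fubini') measurable
  also have "\<dots> = (\<integral>\<^sup>+y. ?q y * (2 * (N * ?w y)) \<partial>lborel)"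
  proof (intro nn_integral_cong)
    fix y
    have "(\<integral>\<^sup>+a. h (a + t) \<partial>lborel) = N" for t
      using nn_integral_real_affine[of h 1 t] by (simp add: h_def N_def add.commute)
    from this[of y] this[of "- y"] have N: "(\<integral>\<^sup>+a. h (a + y) \<partial>lborel) = N" "(\<integral>\<^sup>+a. h (a - y) \<partial>lborel) = N"
      by simp_all
    define w where "w = ?w y"
    have "(\<integral>\<^sup>+a. h (a + y) * w + h (a - y) * w \<partial>lborel)
        = (\<integral>\<^sup>+a. h (a + y) * w \<partial>lborel) + (\<integral>\<^sup>+a. h (a - y) * w \<partial>lborel)"
      by (rule nn_integral_add) measurable
    also have "(\<integral>\<^sup>+a. h (a + y) * w \<partial>lborel) = (\<integral>\<^sup>+a. h (a + y) \<partial>lborel) * w"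
      by (rule nn_integral_multc) measurable
    also have "(\<integral>\<^sup>+a. h (a - y) * w \<partial>lborel) = (\<integral>\<^sup>+a. h (a - y) \<partial>lborel) * w"
      by (rule nn_integral_multc) measurable
    finally have e: "(\<integral>\<^sup>+a. h (a + y) * w + h (a - y) * w \<partial>lborel) = 2 * (N * w)"
      unfolding N mult_2 .
    have "(\<integral>\<^sup>+a. ?q y * (h (a + y) * w + h (a - y) * w) \<partial>lborel)
        = ?q y * (\<integral>\<^sup>+a. h (a + y) * w + h (a - y) * w \<partial>lborel)"
      by (rule nn_integral_cmult) measurable
    then show "(\<integral>\<^sup>+a. ?q y *
           (h (a + y) * ?w y + h (a - y) * ?w y) \<partial>lborel)
       = ?q y * (2 * (N * ?w y))"
      unfolding e unfolding w_def .
  qed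
  also have "\<dots> = (\<integral>\<^sup>+y. (ennreal (1 / ?k) * N) * ennreal (fejer 2 y * sqrt (1 + \<bar>y\<bar>)) \<partial>lborel)"
  proof (intro nn_integral_cong)
    fix y
    have "?q y * 2 = ennreal (1 / ?k) * ennreal (fejer 2 y)"
      using k by (simp add: fejer_nonneg flip: ennreal_mult ennreal_numeral)
    then have "(?q y * 2) * (N * ?w y)
       = (ennreal (1 / ?k) * ennreal (fejer 2 y)) * (N * ?w y)"
      by (rule arg_cong)
    then show "?q y * (2 * (N * ?w y))
       = (ennreal (1 / ?k) * N) * ennreal (fejer 2 y * sqrt (1 + \<bar>y\<bar>))"
      by (simp only: ennreal_mult[OF fejer_nonneg real_sqrt_ge_zero[OF add_nonneg_nonneg[OF zero_le_one abs_ge_zero]]]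
            mult.assoc mult.left_commute)
  qed
  also have "\<dots> = (ennreal (1 / ?k) * N) * (\<integral>\<^sup>+y. ennreal (fejer 2 y * sqrt (1 + \<bar>y\<bar>)) \<partial>lborel)"
    by (rule nn_integral_cmult) measurable
  also have "\<dots> \<le> (ennreal (1 / ?k) * N) * ennreal 64"
    using fejer_weighted_finite[of 2] by (intro mult_left_mono) auto
  also have "\<dots> = ennreal (64 / ?k) * N"
  proof -
    have "ennreal (1 / ?k) * ennreal 64 = ennreal (64 / ?k)"
      using k by (simp flip: ennreal_mult del: ennreal_numeral)
    then show ?thesis by (metis mult.assoc mult.commute)
  qed
  finally show ?thesis unfolding N_def .
qed

section \<open>Kernels of cyclic polygons\<close>

text \<open>The threshold for |\<open>x \<bullet> v\<close>| at |x| = r: of order sqrt r / P for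
  large r, so that strip width and tail balance, and never above r / (2 P), so that on the strip |x|
  is controlled by |\<open>x \<bullet> p\<close>|.\<close>

definition cap_scale :: "real \<Rightarrow> real \<Rightarrow> real" where
  "cap_scale P r = r / (2 * P * sqrt (1 + r))"

abbreviation far_term :: "real \<Rightarrow> (real \<Rightarrow> complex) \<Rightarrow> real \<Rightarrow> real \<Rightarrow> real" where
  "far_term s m a b \<equiv> norm (osc m a) * (\<bar>a\<bar> / (max \<bar>b\<bar> s)\<^sup>2)"

abbreviation strip :: "real \<Rightarrow> real^2 \<Rightarrow> (real^2) set" where
  "strip P v \<equiv> {x. \<bar>x \<bullet> v\<bar> \<le> cap_scale P (norm x)}"

lemma cap_scale_pos: "0 < P \<Longrightarrow> 0 < r \<Longrightarrow> 0 < cap_scale P r"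
  by (simp add: cap_scale_def)

lemma cap_scale_nonneg: "0 < P \<Longrightarrow> 0 \<le> r \<Longrightarrow> 0 \<le> cap_scale P r"
  by (simp add: cap_scale_def)

lemma cap_scale_le: "0 < P \<Longrightarrow> 0 \<le> r \<Longrightarrow> cap_scale P r \<le> r / (2 * P)"
  unfolding cap_scale_def by (intro divide_left_mono mult_pos_pos) auto

lemma cap_scale_mono:
  assumes "0 < P" "0 \<le> r" "r \<le> r'"
  shows "cap_scale P r \<le> cap_scale P r'"
proof -
  have "r\<^sup>2 * (1 + r') \<le> r'\<^sup>2 * (1 + r)"
  proof -
    have "r\<^sup>2 \<le> r'\<^sup>2" using assms by (intro power_mono) auto
    moreover have "r\<^sup>2 * r' \<le> r'\<^sup>2 * r"
      using assms by (simp add: power2_eq_square mult_left_mono mult.assoc mult.left_commute mult_mono)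
    ultimately show ?thesis by (simp add: algebra_simps)
  qed
  then have "sqrt (r\<^sup>2 * (1 + r')) \<le> sqrt (r'\<^sup>2 * (1 + r))" by simp
  then have "r * sqrt (1 + r') \<le> r' * sqrt (1 + r)"
    using assms by (simp add: real_sqrt_mult)
  then have "r / sqrt (1 + r) \<le> r' / sqrt (1 + r')"
    using assms by (simp add: field_simps)
  then show ?thesis
    using assms divide_right_mono[of "r / sqrt (1 + r)" "r' / sqrt (1 + r')" "2 * P"]
    by (simp add: cap_scale_def mult.commute)
qed

lemma cap_scale_measurable [measurable]: "cap_scale P \<in> borel_measurable borel"
  unfolding cap_scale_def by measurable

text \<open>Expand x in the basis dual to (p, v). Since the determinant is 1, the dual basis
  consists of v and p turned by right angles, so it has the same norms.\<close>

lemma norm_le_unimodular: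
  assumes "cross2 p v = 1"
  shows "norm (x::real^2) \<le> \<bar>x \<bullet> p\<bar> * norm v + \<bar>x \<bullet> v\<bar> * norm p"
proof -
  have "x $ 1 = (x $ 1) * cross2 p v" "x $ 2 = (x $ 2) * cross2 p v" using assms by auto
  then have "x = (x \<bullet> p) *\<^sub>R pt (v $ 2) (- v $ 1) + (x \<bullet> v) *\<^sub>R pt (- p $ 2) (p $ 1)"
    unfolding vec_eq_iff forall_2 by (simp add: inner_pt cross2_def algebra_simps)
  then have "norm x \<le> norm ((x \<bullet> p) *\<^sub>R pt (v $ 2) (- v $ 1)) + norm ((x \<bullet> v) *\<^sub>R pt (- p $ 2) (p $ 1))"
    by (metis norm_triangle_ineq)
  moreover have "norm (pt (v $ 2) (- v $ 1)) = norm v" "norm (pt (- p $ 2) (p $ 1)) = norm p"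
    by (simp_all add: norm_eq_sqrt_inner inner_pt add.commute)
  ultimately show ?thesis by simp
qed

text \<open>On the strip |\<open>x \<bullet> v\<close>| times the norm of p is at most |x| / 2, and
  the norm of v is at most 1/2; the dual expansion then gives |x| \<le>
  |\<open>x \<bullet> p\<close>|. In the coordinates (a, b) the strip therefore lies in |b| \<le>
  \<open>cap_scale P \<bar>a\<bar>\<close>, an interval of length at most sqrt (1 + |a|).\<close>

lemma near_integral:
  fixes f :: "real \<Rightarrow> ennreal"
  assumes [measurable]: "f \<in> borel_measurable borel" and pv: "cross2 p v = 1"
    and P: "1 \<le> P" "norm p \<le> P" and v: "norm v \<le> 1/2"
  shows "(\<integral>\<^sup>+x. f (x \<bullet> p) * indicator (strip P v) x \<partial>lborel)
    \<le> (\<integral>\<^sup>+a. f a * ennreal (sqrt (1 + \<bar>a\<bar>)) \<partial>lborel)"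
proof -
  define F where "F = (\<lambda>z. f (fst z) * indicator {z. \<bar>snd z\<bar> \<le> cap_scale P \<bar>fst z\<bar>} z)"
  have [measurable]: "F \<in> borel_measurable borel"
    unfolding F_def borel_prod[symmetric] by measurable
  have "f (x \<bullet> p) * indicator (strip P v) x \<le> F (x \<bullet> p, x \<bullet> v)" for x
  proof (cases "\<bar>x \<bullet> v\<bar> \<le> cap_scale P (norm x)")
    case True
    then have "\<bar>x \<bullet> v\<bar> \<le> norm x / (2 * P)"
      using cap_scale_le[of P "norm x"] P by simp
    then have "\<bar>x \<bullet> v\<bar> * P \<le> norm x / 2" using P by (simp add: field_simps)
    moreover have "\<bar>x \<bullet> v\<bar> * norm p \<le> \<bar>x \<bullet> v\<bar> * P" using P by (intro mult_left_mono) auto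
    moreover have "\<bar>x \<bullet> p\<bar> * norm v \<le> \<bar>x \<bullet> p\<bar> * (1/2)" using v by (intro mult_left_mono) auto
    ultimately have "norm x \<le> \<bar>x \<bullet> p\<bar>"
      using norm_le_unimodular[OF pv, of x] by linarith
    then have "cap_scale P (norm x) \<le> cap_scale P \<bar>x \<bullet> p\<bar>"
      using P by (intro cap_scale_mono) auto
    then show ?thesis using True by (auto simp: F_def indicator_def)
  qed (simp add: indicator_def)
  then have "(\<integral>\<^sup>+x. f (x \<bullet> p) * indicator (strip P v) x \<partial>lborel)
      \<le> (\<integral>\<^sup>+x. F (x \<bullet> p, x \<bullet> v) \<partial>lborel)"
    by (intro nn_integral_mono)
  also have "\<dots> = (\<integral>\<^sup>+a. \<integral>\<^sup>+b. F (a, b) \<partial>lborel \<partial>lborel)"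
    by (rule nn_integral_unimodular) (auto simp: pv)
  also have "\<dots> \<le> (\<integral>\<^sup>+a. f a * ennreal (sqrt (1 + \<bar>a\<bar>)) \<partial>lborel)"
  proof (intro nn_integral_mono)
    fix a :: real
    have "F (a, b) = f a * indicator {- cap_scale P \<bar>a\<bar>..cap_scale P \<bar>a\<bar>} b" for b
      by (auto simp: F_def indicator_def)
    then have "(\<integral>\<^sup>+b. F (a, b) \<partial>lborel) = f a * ennreal (2 * cap_scale P \<bar>a\<bar>)"
      using cap_scale_nonneg[of P "\<bar>a\<bar>"] P by (simp add: nn_integral_cmult)
    also have "2 * cap_scale P \<bar>a\<bar> \<le> sqrt (1 + \<bar>a\<bar>)"
    proof -
      have "2 * cap_scale P \<bar>a\<bar> = \<bar>a\<bar> / (P * sqrt (1 + \<bar>a\<bar>))" by (simp add: cap_scale_def)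
      also have "\<dots> \<le> \<bar>a\<bar> / (1 * sqrt (1 + \<bar>a\<bar>))"
        using P by (intro divide_left_mono mult_right_mono mult_pos_pos) auto
      also have "\<dots> \<le> (1 + \<bar>a\<bar>) / sqrt (1 + \<bar>a\<bar>)"
        by (simp add: divide_right_mono)
      also have "\<dots> = sqrt (1 + \<bar>a\<bar>)" by (simp add: real_div_sqrt)
      finally show ?thesis .
    qed
    finally show "(\<integral>\<^sup>+b. F (a, b) \<partial>lborel) \<le> f a * ennreal (sqrt (1 + \<bar>a\<bar>))"
      by (simp add: mult_left_mono ennreal_leI)
  qed
  finally show ?thesis .
qed

lemma far_integral:
  fixes f :: "real \<Rightarrow> ennreal"
  assumes [measurable]: "f \<in> borel_measurable borel" and pv: "cross2 p v = 1"
    and P: "1 \<le> P" "norm p \<le> P"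
  shows "(\<integral>\<^sup>+x. f (x \<bullet> p) * ennreal (\<bar>x \<bullet> p\<bar> / (max \<bar>x \<bullet> v\<bar> (cap_scale P (norm x)))\<^sup>2) \<partial>lborel)
    \<le> (\<integral>\<^sup>+a. f a * ennreal (16 * P\<^sup>2 * sqrt (1 + \<bar>a\<bar>)) \<partial>lborel)"
proof -
  \<comment> \<open>The true threshold depends on |x|. As |x| is at least |a| / P, it is bounded
    below by this function of a alone, and the inner integral becomes |a| times the integral of (T a
    + |b|)^(-2), up to a factor 4. Its value 8 |a| / T a is 16 P^2 sqrt (1 + |a|).\<close>
  define T where "T a = cap_scale P \<bar>a\<bar> / P" for a
  define F where "F = (\<lambda>(a, b). f a * (ennreal (4 * \<bar>a\<bar>) * ennreal ((T a + \<bar>b\<bar>) powr (-2))))"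
  have Tm[measurable]: "T \<in> borel_measurable borel"
    unfolding T_def by measurable
  have [measurable]: "F \<in> borel_measurable borel"
    unfolding F_def borel_prod[symmetric] by measurable
  have Tpos: "T a > 0" if "a \<noteq> 0" for a
    using that P cap_scale_pos[of P "\<bar>a\<bar>"] by (simp add: T_def)
  have "f (x \<bullet> p) * ennreal (\<bar>x \<bullet> p\<bar> / (max \<bar>x \<bullet> v\<bar> (cap_scale P (norm x)))\<^sup>2) \<le> F (x \<bullet> p, x \<bullet> v)" for x
  proof (cases "x \<bullet> p = 0")
    case False
    define M where "M = max \<bar>x \<bullet> v\<bar> (cap_scale P (norm x))"
    have "\<bar>x \<bullet> p\<bar> \<le> norm x * norm p" by (rule Cauchy_Schwarz_ineq2)
    also have "\<dots> \<le> norm x * P" using P by (intro mult_left_mono) auto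
    finally have "\<bar>x \<bullet> p\<bar> / P \<le> norm x" using P by (simp add: field_simps)
    then have "cap_scale P (\<bar>x \<bullet> p\<bar> / P) \<le> cap_scale P (norm x)"
      using P by (intro cap_scale_mono) auto
    moreover have "T (x \<bullet> p) \<le> cap_scale P (\<bar>x \<bullet> p\<bar> / P)"
    proof -
      have "sqrt (1 + \<bar>x \<bullet> p\<bar> / P) \<le> sqrt (1 + \<bar>x \<bullet> p\<bar>)"
        using P by (simp add: divide_le_eq mult_le_cancel_left1)
      then have "\<bar>x \<bullet> p\<bar> / P / (2 * P * sqrt (1 + \<bar>x \<bullet> p\<bar>)) \<le> \<bar>x \<bullet> p\<bar> / P / (2 * P * sqrt (1 + \<bar>x \<bullet> p\<bar> / P))"
        using P by (intro divide_left_mono mult_left_mono mult_pos_pos) (auto intro!: add_pos_nonneg)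
      then show ?thesis
        unfolding T_def cap_scale_def by (simp add: mult.commute)
    qed
    ultimately have "T (x \<bullet> p) + \<bar>x \<bullet> v\<bar> \<le> 2 * M"
      unfolding M_def by linarith
    moreover have t: "T (x \<bullet> p) > 0" by (rule Tpos[OF False])
    ultimately have "(T (x \<bullet> p) + \<bar>x \<bullet> v\<bar>)\<^sup>2 \<le> (2 * M)\<^sup>2" by (intro power_mono) auto
    then have "1 / M\<^sup>2 \<le> 4 * (1 / (T (x \<bullet> p) + \<bar>x \<bullet> v\<bar>)\<^sup>2)"
      using t \<open>T (x \<bullet> p) + \<bar>x \<bullet> v\<bar> \<le> 2 * M\<close> by (simp add: field_simps)
    also have "1 / (T (x \<bullet> p) + \<bar>x \<bullet> v\<bar>)\<^sup>2 = (T (x \<bullet> p) + \<bar>x \<bullet> v\<bar>) powr (-2)"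
      using t by (simp add: powr_minus_divide powr_numeral add_pos_nonneg)
    finally have "\<bar>x \<bullet> p\<bar> * (1 / M\<^sup>2) \<le> \<bar>x \<bullet> p\<bar> * (4 * (T (x \<bullet> p) + \<bar>x \<bullet> v\<bar>) powr (-2))"
      by (intro mult_left_mono) auto
    then show ?thesis
      unfolding F_def M_def by (auto simp: mult_ac simp flip: ennreal_mult intro!: mult_left_mono ennreal_leI)
  qed simp
  then have "(\<integral>\<^sup>+x. f (x \<bullet> p) * ennreal (\<bar>x \<bullet> p\<bar> / (max \<bar>x \<bullet> v\<bar> (cap_scale P (norm x)))\<^sup>2) \<partial>lborel)
      \<le> (\<integral>\<^sup>+x. F (x \<bullet> p, x \<bullet> v) \<partial>lborel)"
    by (intro nn_integral_mono)
  also have "\<dots> = (\<integral>\<^sup>+a. \<integral>\<^sup>+b. F (a, b) \<partial>lborel \<partial>lborel)"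
    by (rule nn_integral_unimodular) (auto simp: pv)
  also have "\<dots> \<le> (\<integral>\<^sup>+a. f a * ennreal (16 * P\<^sup>2 * sqrt (1 + \<bar>a\<bar>)) \<partial>lborel)"
  proof (intro nn_integral_mono)
    fix a :: real
    show "(\<integral>\<^sup>+b. F (a, b) \<partial>lborel) \<le> f a * ennreal (16 * P\<^sup>2 * sqrt (1 + \<bar>a\<bar>))"
    proof (cases "a = 0")
      case False
      have "(\<integral>\<^sup>+b. F (a, b) \<partial>lborel) = f a * (ennreal (4 * \<bar>a\<bar>) * ennreal (2 * T a powr (- 1)))"
        using nn_integral_powr_tail[OF Tpos[OF False], of 2] by (simp add: F_def nn_integral_cmult)
      also have "4 * \<bar>a\<bar> * (2 * T a powr (- 1)) = 16 * P\<^sup>2 * sqrt (1 + \<bar>a\<bar>)"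
        using False P Tpos[OF False]
        by (simp add: powr_minus_divide T_def cap_scale_def field_simps power2_eq_square)
      then have "ennreal (4 * \<bar>a\<bar>) * ennreal (2 * T a powr (- 1)) = ennreal (16 * P\<^sup>2 * sqrt (1 + \<bar>a\<bar>))"
        by (simp flip: ennreal_mult)
      finally show ?thesis by simp
    qed (simp add: F_def)
  qed
  finally show ?thesis .
qed

section \<open>Summation by parts with a regularised reciprocal\<close>

definition reg_inverse :: "real \<Rightarrow> real \<Rightarrow> real" where
  "reg_inverse s b = b / (max \<bar>b\<bar> s)\<^sup>2"

text \<open>Beyond s the function is the reciprocal and the bound is an identity up to signs; within
  [-s, s] it is linear with slope s^(-2). Only the mixed case needs an argument. The product in the
  denominator is chosen so that it later splits into one term for each of two adjacent
  edges.\<close>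

lemma reg_inverse_diff:
  assumes "s > 0"
  shows "\<bar>reg_inverse s b - reg_inverse s b'\<bar> \<le> \<bar>b - b'\<bar> / (max \<bar>b\<bar> s * max \<bar>b'\<bar> s)"
proof -
  define M M' where MM: "M = max \<bar>b\<bar> s" "M' = max \<bar>b'\<bar> s"
  have pos: "M > 0" "M' > 0" using assms by (auto simp: MM)
  \<comment> \<open>squaring reduces this to \<open>0 \<le> (y\<^sup>2 - s\<^sup>2) (s\<^sup>2 - z\<^sup>2)\<close>\<close>
  have mixed: "\<bar>y * s\<^sup>2 - z * \<bar>y\<bar>\<^sup>2\<bar> \<le> \<bar>y - z\<bar> * (\<bar>y\<bar> * s)" if "\<bar>z\<bar> \<le> s" "s \<le> \<bar>y\<bar>" for y z
  proof -
    have "0 \<le> (y\<^sup>2 - s\<^sup>2) * (s\<^sup>2 - z\<^sup>2)"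
      using that assms by (intro mult_nonneg_nonneg) (auto simp: abs_le_square_iff[symmetric])
    then have "(s\<^sup>2 - y * z)\<^sup>2 \<le> (s * (y - z))\<^sup>2"
      by (simp add: power2_eq_square algebra_simps)
    then have "\<bar>s\<^sup>2 - y * z\<bar> \<le> s * \<bar>y - z\<bar>"
      using assms by (simp add: abs_le_square_iff[symmetric] abs_mult)
    then have "\<bar>y\<bar> * \<bar>s\<^sup>2 - y * z\<bar> \<le> \<bar>y\<bar> * (s * \<bar>y - z\<bar>)" by (intro mult_left_mono) auto
    then show ?thesis
      by (simp add: abs_mult[symmetric] power2_eq_square algebra_simps)
  qed
  have "\<bar>b * M'\<^sup>2 - b' * M\<^sup>2\<bar> \<le> \<bar>b - b'\<bar> * (M * M')"
  proof (cases "\<bar>b\<bar> \<le> s"; cases "\<bar>b'\<bar> \<le> s")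
    assume "\<bar>b\<bar> \<le> s" "\<bar>b'\<bar> \<le> s"
    then have "M = s" "M' = s" by (auto simp: MM)
    then show ?thesis using assms by (simp add: power2_eq_square abs_mult flip: left_diff_distrib)
  next
    assume "\<not> \<bar>b\<bar> \<le> s" "\<not> \<bar>b'\<bar> \<le> s"
    then have "M = \<bar>b\<bar>" "M' = \<bar>b'\<bar>" by (auto simp: MM)
    moreover have "b * b'\<^sup>2 - b' * b\<^sup>2 = - ((b - b') * (b * b'))"
      by (simp add: power2_eq_square algebra_simps)
    ultimately show ?thesis by (simp add: abs_mult del: minus_mult_left)
  next
    assume h: "\<bar>b\<bar> \<le> s" "\<not> \<bar>b'\<bar> \<le> s"
    then have "M = s" "M' = \<bar>b'\<bar>" by (auto simp: MM)
    then show ?thesis using mixed[of b b'] h by (simp add: abs_minus_commute mult.commute)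
  next
    assume h: "\<not> \<bar>b\<bar> \<le> s" "\<bar>b'\<bar> \<le> s"
    then have "M = \<bar>b\<bar>" "M' = s" by (auto simp: MM)
    then show ?thesis using mixed[of b' b] h by simp
  qed
  then have "\<bar>b * M'\<^sup>2 - b' * M\<^sup>2\<bar> / (M\<^sup>2 * M'\<^sup>2) \<le> \<bar>b - b'\<bar> * (M * M') / (M\<^sup>2 * M'\<^sup>2)"
    by (intro divide_right_mono) auto
  also have "\<dots> = \<bar>b - b'\<bar> / (M * M')" using pos by (simp add: power2_eq_square)
  also have "\<bar>b * M'\<^sup>2 - b' * M\<^sup>2\<bar> / (M\<^sup>2 * M'\<^sup>2) = \<bar>(b * M'\<^sup>2 - b' * M\<^sup>2) / (M\<^sup>2 * M'\<^sup>2)\<bar>"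
    using pos by (simp add: abs_mult)
  also have "(b * M'\<^sup>2 - b' * M\<^sup>2) / (M\<^sup>2 * M'\<^sup>2) = b / M\<^sup>2 - b' / M'\<^sup>2"
    using pos by (simp add: field_simps)
  finally show ?thesis by (simp add: reg_inverse_def MM)
qed

lemma reg_inverse_near:
  assumes "s \<ge> 0"
  shows "\<bar>1 - b * reg_inverse s b\<bar> \<le> indicator {b. \<bar>b\<bar> \<le> s} b"
proof (cases "\<bar>b\<bar> \<le> s")
  case True
  have "0 \<le> b\<^sup>2 / (max \<bar>b\<bar> s)\<^sup>2" by simp
  moreover have "b\<^sup>2 / (max \<bar>b\<bar> s)\<^sup>2 \<le> 1"
    by (intro divide_le_eq_1[THEN iffD2]) (auto simp: abs_le_square_iff[symmetric] le_max_iff_disj)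
  ultimately show ?thesis using True by (simp add: reg_inverse_def power2_eq_square)
next
  case False
  then have "max \<bar>b\<bar> s = \<bar>b\<bar>" by auto
  then show ?thesis using False by (cases "b = 0") (use assms in \<open>auto simp: reg_inverse_def power2_eq_square\<close>)
qed

text \<open>The derivative of \<open>osc m\<close> is \<i> times \<open>osc (times_id m)\<close>.
  The integrated form along a segment follows from Fubini and the fundamental theorem applied to the
  phase alone, with no differentiation under the integral.\<close>

lemma osc_increment:
  assumes [measurable]: "m \<in> borel_measurable borel" and int: "integrable lborel (times_id m)"
    and int0: "integrable lborel m"
  shows "\<i> * of_real d * (LINT t|lborel. indicator {0..1} t *\<^sub>R osc (times_id m) (a + t * d))
     = osc m (a + d) - osc m a"
proof -
  define g where "g = (\<lambda>(t, s). indicator {0..1} t *\<^sub>R (cis ((a + t * d) * s) * (of_real s * m s)))"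
  have [measurable]: "g \<in> borel_measurable (lborel \<Otimes>\<^sub>M lborel)"
    unfolding g_def by measurable
  have gi: "integrable (lborel \<Otimes>\<^sub>M lborel) g"
  proof (rule Bochner_Integration.integrable_bound)
    show "integrable (lborel \<Otimes>\<^sub>M lborel) (\<lambda>(t, s). indicator {0..1::real} t * norm (of_real s * m s))"
      using int by (intro lborel_pair.Fubini_integrable) (auto simp: abs_mult intro!: integrable_mult_right)
    show "AE x in lborel \<Otimes>\<^sub>M lborel. norm (g x) \<le> norm (case x of (t, s) \<Rightarrow> indicator {0..1::real} t * norm (of_real s * m s))"
      by (intro AE_I2) (auto simp: g_def norm_mult abs_mult split_beta')
  qed simp
  have inner: "\<i> * of_real d * (LINT t|lborel. g (t, s)) = (cis ((a + d) * s) - cis (a * s)) * m s" for s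
  proof -
    have "((\<lambda>t. cis ((a + t * d) * s)) has_vector_derivative (\<i> * of_real (d * s) * cis ((a + t * d) * s))) (at t within {0..1})" for t
      unfolding has_vector_derivative_def
      by (auto intro!: derivative_eq_intros simp: scaleR_conv_of_real)
    then have "(LINT t|lborel. indicator {0..1} t *\<^sub>R (\<i> * of_real (d * s) * cis ((a + t * d) * s))) = cis ((a + 1 * d) * s) - cis ((a + 0 * d) * s)"
      by (intro integral_FTC_Icc) (auto intro!: continuous_intros)
    moreover have "\<i> * of_real d * (LINT t|lborel. g (t, s))
        = (LINT t|lborel. indicator {0..1} t *\<^sub>R (\<i> * of_real (d * s) * cis ((a + t * d) * s))) * m s"
      unfolding g_def integral_mult_right_zero[symmetric] integral_mult_left_zero[symmetric]
      by (intro Bochner_Integration.integral_cong) (auto simp: scaleR_conv_of_real mult_ac)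
    ultimately show ?thesis by simp
  qed
  have i: "integrable lborel (\<lambda>s. cis (b * s) * m s)" for b
    by (rule Bochner_Integration.integrable_bound[OF int0]) (auto simp: norm_mult)
  have "(LINT t|lborel. indicator {0..1} t *\<^sub>R osc (times_id m) (a + t * d)) = (LINT t|lborel. LINT s|lborel. g (t, s))"
    by (simp add: osc_def g_def)
  also have "\<dots> = (LINT s|lborel. LINT t|lborel. g (t, s))"
    using lborel_pair.Fubini_integral[of "\<lambda>t s. g (t, s)"] gi by simp
  also have "\<i> * of_real d * \<dots> = (LINT s|lborel. (cis ((a + d) * s) - cis (a * s)) * m s)"
    by (simp flip: inner)
  also have "\<dots> = osc m (a + d) - osc m a"
    unfolding osc_def left_diff_distrib by (rule Bochner_Integration.integral_diff[OF i i])
  finally show ?thesis .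
qed

text \<open>The edge directions are normalised by the origin, not by length: the line through edge k
  is the set of y with \<open>cross2 y (v k)\<close> = 1. So \<open>d k\<close> is twice the area of
  the triangle spanned by 0 and the edge, and a quarter turn of \<open>v k\<close> is a vertex of
  the polar polygon. Adjacent directions agree on their common vertex, hence differ by a multiple of
  it; \<gamma> \<ge> 0 expresses convexity.\<close>

locale cyclic_polygon =
  fixes P :: real and n :: nat and p v :: "nat \<Rightarrow> real^2" and d \<gamma> :: "nat \<Rightarrow> real"
  assumes P: "1 \<le> P" and p_cyclic: "p n = p 0" and v_cyclic: "v n = v 0"
    and norm_p: "\<And>k. norm (p k) \<le> P" and norm_v: "\<And>k. norm (v k) \<le> 1/2"
    and d_pos: "\<And>k. 0 < d k"
    and edge: "\<And>k. p (Suc k) - p k = d k *\<^sub>R v k"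
    and cross_pv: "\<And>k. cross2 (p k) (v k) = 1"
    and \<gamma>_nonneg: "\<And>k. 0 \<le> \<gamma> k"
    and turn: "\<And>k. v k - v (Suc k) = \<gamma> k *\<^sub>R p (Suc k)"
begin

definition edge_mean :: "(real \<Rightarrow> complex) \<Rightarrow> nat \<Rightarrow> real^2 \<Rightarrow> complex" where
  "edge_mean f k x = (LINT t|lborel. indicator {0..1} t *\<^sub>R f (x \<bullet> p k + t * (x \<bullet> (p (Suc k) - p k))))"

text \<open>The integral of f(\<open>x \<bullet> \<omega>\<close>) over the polygon for its cone
  measure (normalised as twice the area), which is uniform along each edge and gives edge k the mass
  \<open>d k\<close>.\<close>

definition polygon_kernel :: "(real \<Rightarrow> complex) \<Rightarrow> real^2 \<Rightarrow> complex" where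
  "polygon_kernel f x = (\<Sum>k<n. of_real (d k) * edge_mean f k x)"

lemma edge_mean_measurable [measurable]:
  assumes [measurable]: "f \<in> borel_measurable borel"
  shows "edge_mean f k \<in> borel_measurable borel"
  unfolding edge_mean_def by measurable

lemma cross_edge: "cross2 (p k + t *\<^sub>R (p (Suc k) - p k)) (v k) = 1"
  using cross_pv[of k] unfolding edge by (simp add: cross2_def algebra_simps)

lemma cross_Suc: "cross2 (p (Suc k)) (v k) = 1"
  using cross_edge[of k 1] by simp

lemma norm_edge:
  assumes "t \<in> {0..1}"
  shows "norm (p k + t *\<^sub>R (p (Suc k) - p k)) \<le> P"
proof -
  have "p k + t *\<^sub>R (p (Suc k) - p k) = (1 - t) *\<^sub>R p k + t *\<^sub>R p (Suc k)"
    by (simp add: algebra_simps)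
  moreover have "(1 - t) *\<^sub>R p k + t *\<^sub>R p (Suc k) \<in> cball 0 P"
    using assms norm_p by (intro convexD[OF convex_cball]) auto
  ultimately show ?thesis by simp
qed

text \<open>The strip depends on the edge only through its direction, and every point q of the edge
  satisfies \<open>cross2 q (v k)\<close> = 1. The near estimate thus holds at each q with the same
  strip and is averaged over the edge.\<close>

lemma near_edge:
  assumes [measurable]: "f \<in> borel_measurable borel"
  shows "(\<integral>\<^sup>+x. ennreal (norm (edge_mean f k x)) * indicator (strip P (v k)) x \<partial>lborel)
    \<le> (weighted_mass f)"
proof -
  let ?I = "indicator (strip P (v k)) :: real^2 \<Rightarrow> ennreal"
  let ?q = "\<lambda>t. p k + t *\<^sub>R (p (Suc k) - p k)"
  have "ennreal (norm (edge_mean f k x)) \<le> (\<integral>\<^sup>+t. indicator {0..1} t * ennreal (norm (f (x \<bullet> ?q t))) \<partial>lborel)" for x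
  proof (cases "integrable lborel (\<lambda>t. indicator {0..1::real} t *\<^sub>R f (x \<bullet> p k + t * (x \<bullet> (p (Suc k) - p k))))")
    case True
    from integral_norm_bound_ennreal[OF True] show ?thesis
      by (simp add: edge_mean_def inner_add_right ennreal_mult' ennreal_indicator)
  next
    \<comment> \<open>A divergent mean has value 0 by convention, so the bound is trivial.\<close>
    case False
    then show ?thesis by (simp add: edge_mean_def not_integrable_integral_eq)
  qed
  then have "(\<integral>\<^sup>+x. ennreal (norm (edge_mean f k x)) * ?I x \<partial>lborel)
     \<le> (\<integral>\<^sup>+x. (\<integral>\<^sup>+t. indicator {0..1} t * ennreal (norm (f (x \<bullet> ?q t))) \<partial>lborel) * ?I x \<partial>lborel)"
    by (intro nn_integral_mono mult_right_mono) auto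
  also have "\<dots> = (\<integral>\<^sup>+x. \<integral>\<^sup>+t. indicator {0..1} t * (ennreal (norm (f (x \<bullet> ?q t))) * ?I x) \<partial>lborel \<partial>lborel)"
    by (subst nn_integral_multc[symmetric]) (auto simp: mult_ac)
  also have "\<dots> = (\<integral>\<^sup>+t. \<integral>\<^sup>+x. indicator {0..1} t * (ennreal (norm (f (x \<bullet> ?q t))) * ?I x) \<partial>lborel \<partial>lborel)"
    by (rule lborel_pair.Fubini') measurable
  also have "\<dots> \<le> (\<integral>\<^sup>+t. indicator {0..1::real} t * (weighted_mass f) \<partial>lborel)"
  proof (intro nn_integral_mono)
    fix t :: real
    have "(\<integral>\<^sup>+x. ennreal (norm (f (x \<bullet> ?q t))) * ?I x \<partial>lborel)
        \<le> (\<integral>\<^sup>+a. ennreal (norm (f a)) * ennreal (sqrt (1 + \<bar>a\<bar>)) \<partial>lborel)" if "t \<in> {0..1}"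
      by (intro near_integral cross_edge P norm_edge norm_v that) measurable
    then show "(\<integral>\<^sup>+x. indicator {0..1} t * (ennreal (norm (f (x \<bullet> ?q t))) * ?I x) \<partial>lborel)
        \<le> indicator {0..1} t * (weighted_mass f)"
      by (simp add: indicator_def ennreal_mult)
  qed
  also have "\<dots> = (weighted_mass f)"
    by (simp add: nn_integral_multc)
  finally show ?thesis .
qed

lemma edge_mean_osc:
  assumes "m \<in> borel_measurable borel" "integrable lborel m" "integrable lborel (times_id m)"
  shows "of_real (d k) * of_real (x \<bullet> v k) * edge_mean (osc (times_id m)) k x
     = - \<i> * (osc m (x \<bullet> p (Suc k)) - osc m (x \<bullet> p k))"
proof -
  have "\<i> * of_real (x \<bullet> (p (Suc k) - p k)) * edge_mean (osc (times_id m)) k x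
     = osc m (x \<bullet> p k + x \<bullet> (p (Suc k) - p k)) - osc m (x \<bullet> p k)"
    unfolding edge_mean_def by (rule osc_increment) (use assms in auto)
  also have "x \<bullet> p k + x \<bullet> (p (Suc k) - p k) = x \<bullet> p (Suc k)"
    by (simp add: inner_diff_right)
  also have "x \<bullet> (p (Suc k) - p k) = d k * (x \<bullet> v k)"
    by (simp add: edge)
  finally have "\<i> * of_real (d k * (x \<bullet> v k)) * edge_mean (osc (times_id m)) k x
     = osc m (x \<bullet> p (Suc k)) - osc m (x \<bullet> p k)" .
  from this[symmetric] show ?thesis by (simp add: mult.assoc)
qed

text \<open>Write 1 = (1 - b r) + b r on each edge, with b = \<open>x \<bullet> v k\<close> and r
  its regularised reciprocal. The factor b makes the second piece an exact increment of
  \<open>osc m\<close>, and summation by parts moves the difference onto r. The boundary term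
  vanishes because the polygon closes up in both vertices and directions.\<close>

lemma polygon_kernel_split:
  assumes m: "m \<in> borel_measurable borel" "integrable lborel m" "integrable lborel (times_id m)"
  defines "\<psi> \<equiv> osc (times_id m)"
  shows "polygon_kernel \<psi> x =
     (\<Sum>k<n. of_real (1 - (x \<bullet> v k) * reg_inverse s (x \<bullet> v k)) * (of_real (d k) * edge_mean \<psi> k x))
     - \<i> * (\<Sum>k<n. of_real (reg_inverse s (x \<bullet> v k) - reg_inverse s (x \<bullet> v (Suc k))) * osc m (x \<bullet> p (Suc k)))"
proof -
  define g where "g k = complex_of_real (reg_inverse s (x \<bullet> v k))" for k
  define H where "H k = osc m (x \<bullet> p k)" for k
  define D where "D k = of_real (d k) * edge_mean \<psi> k x" for k
  have bD: "of_real (x \<bullet> v k) * D k = - \<i> * (H (Suc k) - H k)" for k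
    unfolding D_def H_def \<psi>_def using edge_mean_osc[OF m, of k x] by (simp add: mult_ac)
  have D: "D k = of_real (1 - (x \<bullet> v k) * reg_inverse s (x \<bullet> v k)) * D k - \<i> * (g k * (H (Suc k) - H k))" for k
  proof -
    have "D k = of_real (1 - (x \<bullet> v k) * reg_inverse s (x \<bullet> v k)) * D k + g k * (of_real (x \<bullet> v k) * D k)"
      by (simp add: g_def algebra_simps)
    then show ?thesis unfolding bD by (simp add: mult_ac)
  qed
  have "polygon_kernel \<psi> x = (\<Sum>k<n. of_real (1 - (x \<bullet> v k) * reg_inverse s (x \<bullet> v k)) * D k
     - \<i> * (g k * (H (Suc k) - H k)))"
    unfolding polygon_kernel_def D_def[symmetric] by (intro sum.cong refl D)
  also have "\<dots> = (\<Sum>k<n. of_real (1 - (x \<bullet> v k) * reg_inverse s (x \<bullet> v k)) * D k)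
     - \<i> * (\<Sum>k<n. g k * (H (Suc k) - H k))"
    by (simp only: sum_subtractf sum_distrib_left)
  also have "(\<Sum>k<n. g k * (H (Suc k) - H k)) = (\<Sum>k<n. (g k - g (Suc k)) * H (Suc k)) + (\<Sum>k<n. g (Suc k) * H (Suc k) - g k * H k)"
    by (simp add: algebra_simps flip: sum.distrib sum_subtractf)
  also have "(\<Sum>k<n. g (Suc k) * H (Suc k) - g k * H k) = 0"
    unfolding sum_lessThan_telescope[of "\<lambda>k. g k * H k"] by (simp add: g_def H_def p_cyclic v_cyclic)
  finally show ?thesis by (simp add: g_def H_def D_def)
qed

lemma polygon_kernel_bound:
  assumes m: "m \<in> borel_measurable borel" "integrable lborel m" "integrable lborel (times_id m)"
    and x: "x \<noteq> 0"
  defines "\<psi> \<equiv> osc (times_id m)" and "s \<equiv> cap_scale P (norm x)"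
  shows "norm (polygon_kernel \<psi> x) \<le>
     (\<Sum>k<n. d k * (norm (edge_mean \<psi> k x) * indicator (strip P (v k)) x))
     + (\<Sum>k<n. \<gamma> k / 2 * (far_term s m (x \<bullet> p (Suc k)) (x \<bullet> v k)
          + far_term s m (x \<bullet> p (Suc k)) (x \<bullet> v (Suc k))))"
proof -
  have s: "s > 0" unfolding s_def using x P by (intro cap_scale_pos) auto
  have 1: "norm (of_real (1 - (x \<bullet> v k) * reg_inverse s (x \<bullet> v k)) * (of_real (d k) * edge_mean \<psi> k x))
     \<le> d k * (norm (edge_mean \<psi> k x) * indicator (strip P (v k)) x)" for k
  proof -
    have "\<bar>1 - (x \<bullet> v k) * reg_inverse s (x \<bullet> v k)\<bar> \<le> indicator (strip P (v k)) x"
      using reg_inverse_near[of s "x \<bullet> v k"] s by (simp add: indicator_def s_def)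
    from mult_right_mono[OF this, of "d k * norm (edge_mean \<psi> k x)"] show ?thesis
      using d_pos[of k] by (simp add: norm_mult mult_ac del: of_real_diff of_real_mult)
  qed
  have 2: "norm (of_real (reg_inverse s (x \<bullet> v k) - reg_inverse s (x \<bullet> v (Suc k))) * osc m (x \<bullet> p (Suc k)))
     \<le> \<gamma> k / 2 * (far_term s m (x \<bullet> p (Suc k)) (x \<bullet> v k)
          + far_term s m (x \<bullet> p (Suc k)) (x \<bullet> v (Suc k)))" for k
  proof -
    let ?b = "x \<bullet> v k" and ?b' = "x \<bullet> v (Suc k)"
    let ?M = "max \<bar>?b\<bar> s" and ?M' = "max \<bar>?b'\<bar> s"
    have "?b - ?b' = \<gamma> k * (x \<bullet> p (Suc k))"
      using turn[of k] by (metis inner_diff_right inner_scaleR_right)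
    then have bb: "\<bar>?b - ?b'\<bar> = \<gamma> k * \<bar>x \<bullet> p (Suc k)\<bar>"
      using \<gamma>_nonneg by (simp add: abs_mult)
    \<comment> \<open>The arithmetic-geometric inequality decouples the two edges meeting at
      \<open>p (Suc k)\<close>. Each resulting term contains that vertex and one direction, a
      unimodular pair, as the far estimate requires.\<close>
    have am: "1 / (M * M') \<le> (1 / M\<^sup>2 + 1 / M'\<^sup>2) / 2" for M M' :: real
      using sum_squares_bound[of "1 / M" "1 / M'"] by (simp add: power_divide)
    have "\<bar>reg_inverse s ?b - reg_inverse s ?b'\<bar> \<le> \<bar>?b - ?b'\<bar> * (1 / (?M * ?M'))"
      using reg_inverse_diff[OF s] by simp
    also have "\<dots> \<le> \<bar>?b - ?b'\<bar> * ((1 / ?M\<^sup>2 + 1 / ?M'\<^sup>2) / 2)"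
      by (intro mult_left_mono am) auto
    finally have "\<bar>reg_inverse s ?b - reg_inverse s ?b'\<bar> * norm (osc m (x \<bullet> p (Suc k)))
       \<le> \<gamma> k * \<bar>x \<bullet> p (Suc k)\<bar> * ((1 / ?M\<^sup>2 + 1 / ?M'\<^sup>2) / 2) * norm (osc m (x \<bullet> p (Suc k)))"
      unfolding bb by (intro mult_right_mono) auto
    also have "\<dots> = \<gamma> k / 2 * (norm (osc m (x \<bullet> p (Suc k))) * (\<bar>x \<bullet> p (Suc k)\<bar> / ?M\<^sup>2)
          + norm (osc m (x \<bullet> p (Suc k))) * (\<bar>x \<bullet> p (Suc k)\<bar> / ?M'\<^sup>2))"
      by (simp add: field_simps)
    finally show ?thesis by (simp add: norm_mult del: of_real_diff)
  qed
  show ?thesis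
    unfolding \<psi>_def polygon_kernel_split[OF m, of x s]
    by (rule order_trans[OF norm_triangle_ineq4])
       (use 1 2 in \<open>auto simp: norm_mult \<psi>_def intro!: add_mono sum_norm_le simp del: of_real_diff\<close>)
qed

text \<open>The polygon enters only through P, the sum of the \<open>d k\<close> and the sum of the
  \<gamma>; the number of edges does not appear. The two far terms at each vertex cancel the 1/2
  from the arithmetic-geometric inequality.\<close>

lemma nn_integral_polygon_kernel:
  assumes m[measurable]: "m \<in> borel_measurable borel" and mi: "integrable lborel m" "integrable lborel (times_id m)"
  shows "mass (polygon_kernel (osc (times_id m)))
    \<le> ennreal (\<Sum>k<n. d k) * (weighted_mass (osc (times_id m)))
     + ennreal (16 * P\<^sup>2 * (\<Sum>k<n. \<gamma> k)) * (weighted_mass (osc m))"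
proof -
  define \<psi> where "\<psi> = osc (times_id m)"
  define A where "A = (weighted_mass \<psi>)"
  define B where "B = (weighted_mass (osc m))"
  have [measurable]: "\<psi> \<in> borel_measurable borel" unfolding \<psi>_def by measurable
  define N' where "N' k x = norm (edge_mean \<psi> k x) * indicator (strip P (v k)) x" for k x
  define F' where "F' k j x = far_term (cap_scale P (norm x)) m (x \<bullet> p (Suc k)) (x \<bullet> v j)" for k j x
  define N where "N k x = ennreal (N' k x)" for k x
  define F where "F k j x = ennreal (F' k j x)" for k j x
  have [measurable]: "N k \<in> borel_measurable borel" "F k j \<in> borel_measurable borel" for k j
    unfolding N_def F_def N'_def F'_def by measurable
  have N: "(\<integral>\<^sup>+x. N k x \<partial>lborel) \<le> A" for k
    using near_edge[of \<psi> k] by (simp add: N_def N'_def A_def ennreal_mult ennreal_indicator)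
  have F: "(\<integral>\<^sup>+x. F k j x \<partial>lborel) \<le> ennreal (16 * P\<^sup>2) * B" if "cross2 (p (Suc k)) (v j) = 1" for k j
  proof -
    have "(\<integral>\<^sup>+x. F k j x \<partial>lborel) \<le> (\<integral>\<^sup>+a. ennreal (norm (osc m a)) * ennreal (16 * P\<^sup>2 * sqrt (1 + \<bar>a\<bar>)) \<partial>lborel)"
      unfolding F_def F'_def ennreal_mult[OF norm_ge_zero divide_nonneg_nonneg[OF abs_ge_zero zero_le_power2]]
      by (intro far_integral that P norm_p) measurable
    also have "\<dots> = (\<integral>\<^sup>+a. ennreal (16 * P\<^sup>2) * ennreal (norm (osc m a) * sqrt (1 + \<bar>a\<bar>)) \<partial>lborel)"
      by (intro nn_integral_cong) (simp add: mult_ac flip: ennreal_mult)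
    also have "\<dots> = ennreal (16 * P\<^sup>2) * B"
      unfolding B_def by (rule nn_integral_cmult) measurable
    finally show ?thesis .
  qed
  have pw: "ennreal (norm (polygon_kernel \<psi> x)) \<le> (\<Sum>k<n. ennreal (d k) * N k x) + (\<Sum>k<n. ennreal (\<gamma> k / 2) * (F k k x + F k (Suc k) x))"
    if "x \<noteq> 0" for x
  proof -
    have nn: "0 \<le> d k * N' k x" "0 \<le> F' k k x" "0 \<le> F' k (Suc k) x" "0 \<le> \<gamma> k / 2 * (F' k k x + F' k (Suc k) x)" for k
      using d_pos[of k] \<gamma>_nonneg[of k] by (auto simp: N'_def F'_def)
    have "norm (polygon_kernel \<psi> x) \<le> (\<Sum>k<n. d k * N' k x) + (\<Sum>k<n. \<gamma> k / 2 * (F' k k x + F' k (Suc k) x))"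
      unfolding \<psi>_def N'_def F'_def by (rule polygon_kernel_bound[OF m mi that])
    then have "ennreal (norm (polygon_kernel \<psi> x)) \<le> ennreal ((\<Sum>k<n. d k * N' k x) + (\<Sum>k<n. \<gamma> k / 2 * (F' k k x + F' k (Suc k) x)))"
      by (rule ennreal_leI)
    also have "\<dots> = (\<Sum>k<n. ennreal (d k * N' k x)) + (\<Sum>k<n. ennreal (\<gamma> k / 2 * (F' k k x + F' k (Suc k) x)))"
      by (subst ennreal_plus) (auto intro!: sum_nonneg nn simp del: times_divide_eq_left simp flip: sum_ennreal[OF nn(1)] sum_ennreal[OF nn(4)])
    also have "\<dots> = (\<Sum>k<n. ennreal (d k) * N k x) + (\<Sum>k<n. ennreal (\<gamma> k / 2) * (F k k x + F k (Suc k) x))"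
      using d_pos[THEN less_imp_le] \<gamma>_nonneg
      by (simp add: N_def F_def ennreal_mult' ennreal_plus[OF nn(2,3), symmetric] del: ennreal_plus times_divide_eq_left)
    finally show ?thesis .
  qed
  have "mass (polygon_kernel \<psi>)
     \<le> (\<integral>\<^sup>+x. (\<Sum>k<n. ennreal (d k) * N k x) + (\<Sum>k<n. ennreal (\<gamma> k / 2) * (F k k x + F k (Suc k) x)) \<partial>lborel)"
  proof (rule nn_integral_mono_AE)
    have "AE x::real^2 in lborel. x \<noteq> 0" by (rule AE_lborel_singleton)
    then show "AE x in lborel. ennreal (norm (polygon_kernel \<psi> x))
       \<le> (\<Sum>k<n. ennreal (d k) * N k x) + (\<Sum>k<n. ennreal (\<gamma> k / 2) * (F k k x + F k (Suc k) x))"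
      by eventually_elim (rule pw)
  qed
  also have "\<dots> = (\<Sum>k<n. ennreal (d k) * (\<integral>\<^sup>+x. N k x \<partial>lborel))
      + (\<Sum>k<n. ennreal (\<gamma> k / 2) * ((\<integral>\<^sup>+x. F k k x \<partial>lborel) + (\<integral>\<^sup>+x. F k (Suc k) x \<partial>lborel)))"
    by (simp add: nn_integral_add nn_integral_sum nn_integral_cmult)
  also have "\<dots> \<le> (\<Sum>k<n. ennreal (d k) * A) + (\<Sum>k<n. ennreal (\<gamma> k / 2) * (ennreal (16 * P\<^sup>2) * B + ennreal (16 * P\<^sup>2) * B))"
    by (intro add_mono sum_mono mult_left_mono N F cross_Suc cross_pv) auto
  also have "(\<Sum>k<n. ennreal (d k) * A) = ennreal (\<Sum>k<n. d k) * A"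
    using d_pos[THEN less_imp_le] by (simp flip: sum_distrib_right)
  also have "(\<Sum>k<n. ennreal (\<gamma> k / 2) * (ennreal (16 * P\<^sup>2) * B + ennreal (16 * P\<^sup>2) * B)) = ennreal (16 * P\<^sup>2 * (\<Sum>k<n. \<gamma> k)) * B"
  proof -
    have "ennreal (\<gamma> k / 2) * (ennreal (16 * P\<^sup>2) * B + ennreal (16 * P\<^sup>2) * B) = ennreal (16 * P\<^sup>2 * \<gamma> k) * B" for k
    proof -
      have "ennreal (\<gamma> k / 2) * (ennreal (16 * P\<^sup>2) + ennreal (16 * P\<^sup>2)) = ennreal (16 * P\<^sup>2 * \<gamma> k)"
        using \<gamma>_nonneg[of k] by (simp add: field_simps flip: ennreal_mult ennreal_plus)
      then show ?thesis by (metis distrib_right mult.assoc)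
    qed
    then have "(\<Sum>k<n. ennreal (\<gamma> k / 2) * (ennreal (16 * P\<^sup>2) * B + ennreal (16 * P\<^sup>2) * B)) = (\<Sum>k<n. ennreal (16 * P\<^sup>2 * \<gamma> k)) * B"
      by (simp add: sum_distrib_right)
    also have "(\<Sum>k<n. ennreal (16 * P\<^sup>2 * \<gamma> k)) = ennreal (16 * P\<^sup>2 * (\<Sum>k<n. \<gamma> k))"
      using \<gamma>_nonneg by (simp add: sum_distrib_left)
    finally show ?thesis .
  qed
  finally show ?thesis unfolding A_def B_def \<psi>_def .
qed

end

section \<open>Polygons inscribed in a convex curve\<close>

definition rot90 :: "real^2 \<Rightarrow> real^2" where
  "rot90 x = pt (- x $ 2) (x $ 1)"

definition square_pt :: "nat \<Rightarrow> real \<Rightarrow> real^2" where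
  "square_pt j t = (rot90 ^^ j) (pt 1 t)"

lemma rot90_inner [simp]: "rot90 x \<bullet> rot90 y = x \<bullet> y"
  by (simp add: rot90_def inner_pt)

lemma rot90_pow_inner: "(rot90 ^^ j) x \<bullet> (rot90 ^^ j) y = x \<bullet> y"
  by (induction j) auto

lemma rot90_cross [simp]: "cross2 (rot90 x) (rot90 y) = cross2 x y"
  by (simp add: rot90_def cross2_def)

lemma rot90_pow_cross: "cross2 ((rot90 ^^ j) x) ((rot90 ^^ j) y) = cross2 x y"
  by (induction j) auto

lemma norm_rot90_pow [simp]: "norm ((rot90 ^^ j) x) = norm x"
  by (simp add: norm_eq_sqrt_inner rot90_pow_inner)

lemma rot90_diff: "rot90 (x - y) = rot90 x - rot90 y"
  by (simp add: rot90_def vec_eq_iff forall_2)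

lemma rot90_pow_diff: "(rot90 ^^ j) (x - y) = (rot90 ^^ j) x - (rot90 ^^ j) y"
  by (induction j) (auto simp: rot90_diff)

lemma rot90_pow4: "(rot90 ^^ (4 + j)) x = (rot90 ^^ j) x"
proof -
  have "(rot90 ^^ 4) y = y" for y
    by (simp add: eval_nat_numeral rot90_def pt_eta)
  then show ?thesis by (simp only: funpow_add comp_apply)
qed

lemma square_pt_cross: "cross2 (square_pt j s) (square_pt j t) = t - s"
  by (simp add: square_pt_def rot90_pow_cross) (simp add: cross2_def)

lemma square_pt_inner: "square_pt j s \<bullet> square_pt j t = 1 + s * t"
  by (simp add: square_pt_def rot90_pow_inner) (simp add: inner_pt)

lemma square_pt_dist: "norm (square_pt j s - square_pt j t) = \<bar>s - t\<bar>"
  unfolding square_pt_def rot90_pow_diff[symmetric] norm_rot90_pow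
  by (simp add: norm_eq_sqrt_inner inner_pt)

lemma square_pt_corner: "square_pt (Suc j) (-1) = square_pt j 1"
proof -
  have "rot90 (pt 1 (-1)) = pt 1 1" by (simp add: rot90_def)
  then show ?thesis by (simp only: square_pt_def funpow_Suc_right comp_apply)
qed

lemma norm_square_pt_ge: "1 \<le> norm (square_pt j t)"
  by (simp add: norm_eq_sqrt_inner square_pt_inner)

lemma norm_square_pt_le:
  assumes "t \<in> {-1..1}"
  shows "norm (square_pt j t) \<le> 3/2"
proof -
  have "t * t \<le> 1" using assms abs_square_le_1[of t] by (auto simp: power2_eq_square abs_le_iff)
  then have "sqrt (1 + t * t) \<le> 3/2"
    by (intro real_le_lsqrt) (auto simp: power2_eq_square)
  then show ?thesis
    by (simp add: norm_eq_sqrt_inner square_pt_inner)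
qed

lemma cross2_cramer: "cross2 a b *\<^sub>R c = cross2 c b *\<^sub>R a - cross2 c a *\<^sub>R b"
  unfolding vec_eq_iff forall_2 by (simp add: cross2_def algebra_simps)

lemma cross2_scaleR [simp]:
  "cross2 (r *\<^sub>R a) b = r * cross2 a b" "cross2 a (r *\<^sub>R b) = r * cross2 a b"
  by (simp_all add: cross2_def algebra_simps)

lemma cross2_diff:
  "cross2 (a - a') b = cross2 a b - cross2 a' b" "cross2 a (b - b') = cross2 a b - cross2 a b'"
  by (simp_all add: cross2_def algebra_simps)

lemma cross2_self [simp]: "cross2 a a = 0"
  by (simp add: cross2_def)

lemma cross2_swap: "cross2 a b = - cross2 b a"
  by (simp add: cross2_def)

text \<open>The Minkowski functional in the form in which it is used: \<open>upper\<close> says that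
  the ball of radius 8 is inside, \<open>lower\<close> that the domain lies within radius P, and
  convexity appears as subadditivity.\<close>

locale planar_gauge =
  fixes \<rho> :: "real^2 \<Rightarrow> real" and P :: real
  assumes homogeneous: "\<And>t x. 0 \<le> t \<Longrightarrow> \<rho> (t *\<^sub>R x) = t * \<rho> x"
    and subadditive: "\<And>x y. \<rho> (x + y) \<le> \<rho> x + \<rho> y"
    and lower: "\<And>x. norm x \<le> P * \<rho> x"
    and upper: "\<And>x. \<rho> x \<le> norm x / 8"
    and P1: "1 \<le> P"
begin

lemma gauge_nonneg: "0 \<le> \<rho> x"
proof -
  have "0 \<le> P * \<rho> x" using lower[of x] norm_ge_zero[of x] by linarith
  then show ?thesis using P1 by (simp add: zero_le_mult_iff)
qed

lemma gauge_pos: "x \<noteq> 0 \<Longrightarrow> 0 < \<rho> x"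
  using lower[of x] gauge_nonneg[of x] by (cases "\<rho> x = 0") auto

lemma gauge_lipschitz: "\<bar>\<rho> x - \<rho> y\<bar> \<le> norm (x - y) / 8"
proof -
  have "\<rho> x \<le> \<rho> (x - y) + \<rho> y" "\<rho> y \<le> \<rho> (y - x) + \<rho> x"
    using subadditive[of "x - y" y] subadditive[of "y - x" x] by simp_all
  then show ?thesis
    using upper[of "x - y"] upper[of "y - x"] unfolding norm_minus_commute[of y x] by linarith
qed

lemma gauge_continuous: "continuous_on S \<rho>"
proof -
  have "(1/8)-lipschitz_on S \<rho>"
    using gauge_lipschitz by (intro lipschitz_onI) (auto simp: dist_norm)
  then show ?thesis by (rule lipschitz_on_continuous_on)
qed

definition bdry :: "nat \<Rightarrow> real \<Rightarrow> real^2" where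
  "bdry j t = (1 / \<rho> (square_pt j t)) *\<^sub>R square_pt j t"

lemma gauge_square_pos [simp]: "0 < \<rho> (square_pt j t)"
  using norm_square_pt_ge[of j t] by (intro gauge_pos) auto

lemma gauge_square_nz [simp]: "\<rho> (square_pt j t) \<noteq> 0"
  using gauge_square_pos[of j t] by linarith

lemma gauge_square_ge: "1 \<le> P * \<rho> (square_pt j t)"
  using norm_square_pt_ge[of j t] lower[of "square_pt j t"] by linarith

lemma gauge_bdry: "\<rho> (bdry j t) = 1"
  unfolding bdry_def by (subst homogeneous) (auto intro: less_imp_le)

lemma norm_bdry: "norm (bdry j t) \<le> P"
  using lower[of "bdry j t"] by (simp add: gauge_bdry)

lemma cross_bdry: "cross2 (bdry j s) (bdry j t) = (t - s) / (\<rho> (square_pt j s) * \<rho> (square_pt j t))"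
  unfolding bdry_def by (simp add: square_pt_cross)

definition grid :: "nat \<Rightarrow> nat \<Rightarrow> real" where
  "grid N i = 2 * real i / real N - 1"

text \<open>Each side of the square carries N cells, so the polygon has 4 N edges. Indices beyond 4
  N need no special treatment, because the quarter turn has order four.\<close>

definition vert :: "nat \<Rightarrow> nat \<Rightarrow> real^2" where
  "vert N k = bdry (k div N) (grid N (k mod N))"

text \<open>Not the Euclidean length but twice the area of the triangle over the edge, that is, its
  mass for the cone measure.\<close>

definition edge_len :: "nat \<Rightarrow> nat \<Rightarrow> real" where
  "edge_len N k = cross2 (vert N k) (vert N (Suc k))"

definition edge_dir :: "nat \<Rightarrow> nat \<Rightarrow> real^2" where
  "edge_dir N k = (1 / edge_len N k) *\<^sub>R (vert N (Suc k) - vert N k)"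

definition turning :: "nat \<Rightarrow> nat \<Rightarrow> real" where
  "turning N k = cross2 (edge_dir N k) (edge_dir N (Suc k))"

lemma grid_mem: "i \<le> N \<Longrightarrow> 0 < N \<Longrightarrow> grid N i \<in> {-1..1}"
  by (simp add: grid_def field_simps)

text \<open>At a corner the next index already belongs to the following side at parameter -1, which
  is the same point as parameter 1 on the current side. Hence both ends of every edge can be
  computed on a single side.\<close>

lemma vert_Suc:
  assumes "0 < N"
  shows "vert N (Suc k) = bdry (k div N) (grid N (Suc (k mod N)))"
proof (cases "Suc (k mod N) = N")
  case True
  then have "Suc k div N = Suc (k div N)" "Suc k mod N = 0"
    by (simp_all add: div_Suc mod_Suc)
  moreover have "grid N N = 1" "grid N 0 = -1" using assms by (simp_all add: grid_def)
  ultimately show ?thesis using True by (simp add: vert_def bdry_def square_pt_corner)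
next
  case False
  then have "Suc k div N = k div N" "Suc k mod N = Suc (k mod N)"
    by (simp_all add: div_Suc mod_Suc)
  then show ?thesis by (simp add: vert_def)
qed

lemma edge_len_eq:
  assumes "0 < N"
  shows "edge_len N k = (2 / real N) /
    (\<rho> (square_pt (k div N) (grid N (k mod N))) * \<rho> (square_pt (k div N) (grid N (Suc (k mod N)))))"
  unfolding edge_len_def vert_Suc[OF assms] unfolding vert_def cross_bdry
  by (simp add: grid_def diff_divide_distrib[symmetric] algebra_simps)

lemma edge_len_pos: "0 < N \<Longrightarrow> 0 < edge_len N k"
  by (simp add: edge_len_eq)

lemma edge_len_le:
  assumes "0 < N"
  shows "edge_len N k \<le> 2 * P\<^sup>2 / real N"
proof -
  let ?a = "\<rho> (square_pt (k div N) (grid N (k mod N)))" and ?b = "\<rho> (square_pt (k div N) (grid N (Suc (k mod N))))"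
  have "1 * 1 \<le> (P * ?a) * (P * ?b)"
    using P1 by (intro mult_mono gauge_square_ge) (auto intro!: mult_nonneg_nonneg gauge_nonneg)
  then have "1 / (?a * ?b) \<le> P\<^sup>2" by (simp add: field_simps power2_eq_square)
  then have "2 / real N * (1 / (?a * ?b)) \<le> 2 / real N * P\<^sup>2" by (intro mult_left_mono) auto
  then show ?thesis unfolding edge_len_eq[OF assms] by simp
qed

lemma vert_cyclic: "0 < N \<Longrightarrow> vert N (k + 4 * N) = vert N k"
  by (simp add: vert_def bdry_def square_pt_def rot90_pow4)

lemma norm_vert: "norm (vert N k) \<le> P"
  by (simp add: vert_def norm_bdry)

text \<open>For consecutive square points q and r at parameters s < t, the direction is \<rho>(q)
  times the unit vector of the side, minus the difference quotient of \<rho> times q. Both terms are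
  at most |q| / 8, and |q| \<le> 3/2. The inner radius 8 is thus what makes directions short enough
  for the near estimate.\<close>

lemma norm_edge_dir:
  assumes N: "0 < N"
  shows "norm (edge_dir N k) \<le> 1/2"
proof -
  define j s t where "j = k div N" and "s = grid N (k mod N)" and "t = grid N (Suc (k mod N))"
  let ?q = "square_pt j s" and ?r = "square_pt j t"
  have ts: "t - s = 2 / real N" by (simp add: s_def t_def grid_def diff_divide_distrib[symmetric])
  have ts0: "t - s > 0" unfolding ts using N by simp
  have "edge_dir N k = (1 / (t - s)) *\<^sub>R (\<rho> ?q *\<^sub>R (?r - ?q) - (\<rho> ?r - \<rho> ?q) *\<^sub>R ?q)"
    unfolding edge_dir_def edge_len_def vert_Suc[OF N] unfolding vert_def j_def[symmetric] s_def[symmetric] t_def[symmetric] cross_bdry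
    unfolding bdry_def using ts0 by (simp add: algebra_simps)
  then have "norm (edge_dir N k) = (1 / (t - s)) * norm (\<rho> ?q *\<^sub>R (?r - ?q) - (\<rho> ?r - \<rho> ?q) *\<^sub>R ?q)"
    using ts0 by simp
  also have "\<dots> \<le> (1 / (t - s)) * (\<rho> ?q * (t - s) + (t - s) / 8 * norm ?q)"
  proof (intro mult_left_mono order_trans[OF norm_triangle_ineq4] add_mono)
    show "norm (\<rho> ?q *\<^sub>R (?r - ?q)) \<le> \<rho> ?q * (t - s)"
      using ts0 gauge_nonneg[of ?q] by (simp add: square_pt_dist)
    show "norm ((\<rho> ?r - \<rho> ?q) *\<^sub>R ?q) \<le> (t - s) / 8 * norm ?q"
      unfolding norm_scaleR using gauge_lipschitz[of ?r ?q] ts0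
      by (intro mult_right_mono) (simp_all add: square_pt_dist)
  qed (use ts0 in auto)
  also have "\<dots> = \<rho> ?q + norm ?q / 8" using ts0 by (simp add: field_simps)
  also have "\<dots> \<le> 1/2"
    using upper[of ?q] norm_square_pt_le[of s j] N grid_mem[of "k mod N" N] by (simp add: s_def)
  finally show ?thesis .
qed

lemma cross_vert_dir: "0 < N \<Longrightarrow> cross2 (vert N k) (edge_dir N k) = 1"
  using edge_len_pos[of N k] by (simp add: edge_dir_def cross2_diff edge_len_def)

lemma cross_vert_Suc_dir:
  assumes N: "0 < N"
  shows "cross2 (vert N (Suc k)) (edge_dir N k) = 1"
proof -
  have "cross2 (vert N (Suc k)) (vert N k) = - edge_len N k"
    unfolding edge_len_def by (rule cross2_swap)
  then show ?thesis
    using edge_len_pos[OF N, of k] by (simp add: edge_dir_def cross2_diff)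
qed

text \<open>Cramer's rule for three vectors in the plane, where the cross products of the common
  vertex with both directions are 1.\<close>

lemma turning_eq: "0 < N \<Longrightarrow> edge_dir N k - edge_dir N (Suc k) = turning N k *\<^sub>R vert N (Suc k)"
  using cross2_cramer[of "edge_dir N k" "edge_dir N (Suc k)" "vert N (Suc k)"]
  by (simp add: turning_def cross_vert_dir cross_vert_Suc_dir)

text \<open>The boundary curve turns left, because \<open>\<rho>\<close> is subadditive and equal to \<open>1\<close> on the vertices.\<close>

lemma turning_nonneg:
  assumes N: "0 < N"
  shows "0 \<le> turning N k"
proof -
  let ?a = "vert N k" and ?b = "vert N (Suc k)" and ?c = "vert N (Suc (Suc k))"
  have one: "\<rho> (vert N i) = 1" for i by (simp add: vert_def gauge_bdry)
  have d: "0 < edge_len N k" "0 < edge_len N (Suc k)" using edge_len_pos[OF N] by auto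
  have "cross2 ?a ?c \<le> edge_len N k + edge_len N (Suc k)"
  proof (cases "cross2 ?a ?c \<ge> 0")
    case True
    have "cross2 ?a ?c *\<^sub>R ?b = edge_len N (Suc k) *\<^sub>R ?a + edge_len N k *\<^sub>R ?c"
      unfolding cross2_cramer[of ?a ?c ?b] edge_len_def using cross2_swap[of ?b ?a] by simp
    then have "cross2 ?a ?c * 1 = \<rho> (edge_len N (Suc k) *\<^sub>R ?a + edge_len N k *\<^sub>R ?c)"
      using homogeneous[OF True, of ?b] by (simp add: one)
    also have "\<dots> \<le> edge_len N (Suc k) + edge_len N k"
      using subadditive[of "edge_len N (Suc k) *\<^sub>R ?a" "edge_len N k *\<^sub>R ?c"] d
      by (simp add: homogeneous one)
    finally show ?thesis by simp
  qed (use d in auto)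
  then have "0 \<le> (1 / (edge_len N k * edge_len N (Suc k))) * cross2 (?b - ?a) (?c - ?b)"
    using d by (intro mult_nonneg_nonneg) (auto simp: cross2_diff edge_len_def)
  then show ?thesis by (simp add: turning_def edge_dir_def mult.commute)
qed

text \<open>Over one side with normal e every vertex has inner product 1 / \<rho>(q) \<ge> 1 with e.
  So the turning is at most the drop of the inner product of the direction with e; these drops
  telescope to at most 1/2 + 1/2. The four sides give 4.\<close>

lemma sum_turning:
  assumes N: "0 < N"
  shows "(\<Sum>k<4 * N. turning N k) \<le> 4"
proof -
  have "(\<Sum>k\<in>{j * N..<j * N + N}. turning N k) \<le> 1" for j
  proof -
    let ?e = "square_pt j 0"
    have "(\<Sum>k\<in>{j * N..<j * N + N}. turning N k) \<le> (\<Sum>k\<in>{j * N..<j * N + N}. (edge_dir N k - edge_dir N (Suc k)) \<bullet> ?e)"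
    proof (rule sum_mono)
      fix k assume k: "k \<in> {j * N..<j * N + N}"
      then have kj: "k div N = j"
        by (intro div_nat_eqI) (auto simp: mult.commute)
      let ?q = "square_pt j (grid N (Suc (k mod N)))"
      have "vert N (Suc k) \<bullet> ?e = 1 / \<rho> ?q"
        by (simp add: vert_Suc[OF N] kj bdry_def square_pt_inner)
      moreover have "\<rho> ?q \<le> 1"
        using upper[of ?q] norm_square_pt_le[of "grid N (Suc (k mod N))" j] grid_mem[of "Suc (k mod N)" N] N
        by (simp add: Suc_leI)
      ultimately have "1 \<le> vert N (Suc k) \<bullet> ?e" by simp
      then have "turning N k * 1 \<le> turning N k * (vert N (Suc k) \<bullet> ?e)"
        by (intro mult_left_mono turning_nonneg N)
      then show "turning N k \<le> (edge_dir N k - edge_dir N (Suc k)) \<bullet> ?e"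
        unfolding turning_eq[OF N] by simp
    qed
    also have "\<dots> = - (\<Sum>k\<in>{j * N..<j * N + N}. edge_dir N (Suc k) \<bullet> ?e - edge_dir N k \<bullet> ?e)"
      by (simp add: inner_diff_left flip: sum_negf)
    also have "\<dots> = edge_dir N (j * N) \<bullet> ?e - edge_dir N (j * N + N) \<bullet> ?e"
      by (subst sum_Suc_diff') auto
    also have "\<dots> \<le> 1/2 + 1/2"
    proof -
      have "\<bar>edge_dir N i \<bullet> ?e\<bar> \<le> 1/2" for i
        using Cauchy_Schwarz_ineq2[of "edge_dir N i" ?e] norm_edge_dir[OF N, of i]
        by (simp add: norm_eq_sqrt_inner[of ?e] square_pt_inner)
      from this[of "j * N"] this[of "j * N + N"] show ?thesis by linarith
    qed
    finally show ?thesis by simp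
  qed
  then have "(\<Sum>j<4. \<Sum>k\<in>{j * N..<j * N + N}. turning N k) \<le> (\<Sum>j<4::nat. 1)"
    by (intro sum_mono)
  then show ?thesis by (simp add: sum.nat_group)
qed

lemma sum_edge_len:
  assumes N: "0 < N"
  shows "(\<Sum>k<4 * N. edge_len N k) \<le> 8 * P\<^sup>2"
proof -
  have "(\<Sum>k<4 * N. edge_len N k) \<le> (\<Sum>k<4 * N. 2 * P\<^sup>2 / real N)"
    by (intro sum_mono edge_len_le N)
  then show ?thesis using N by simp
qed

lemma cyclic_polygon:
  assumes N: "0 < N"
  shows "cyclic_polygon P (4 * N) (vert N) (edge_dir N) (edge_len N) (turning N)"
proof
  fix k
  have cyc: "vert N (i + 4 * N) = vert N i" for i by (rule vert_cyclic[OF N])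
  show "vert N (4 * N) = vert N 0" using cyc[of 0] by simp
  show "edge_dir N (4 * N) = edge_dir N 0"
    using cyc[of 0] cyc[of 1] by (simp add: edge_dir_def edge_len_def)
  show "vert N (Suc k) - vert N k = edge_len N k *\<^sub>R edge_dir N k"
    using edge_len_pos[OF N, of k] by (simp add: edge_dir_def)
qed (fact P1 norm_vert norm_edge_dir[OF N] edge_len_pos[OF N] cross_vert_dir[OF N] turning_nonneg[OF N] turning_eq[OF N])+

end

section \<open>Polar coordinates\<close>

lemma rot90_measurable [measurable]: "rot90 \<in> borel_measurable borel"
  unfolding rot90_def by measurable

lemma distr_rot90: "distr lborel borel rot90 = lborel"
proof (rule measure_eqI)
  fix A :: "(real^2) set"
  assume "A \<in> sets (distr lborel borel rot90)"
  then have [measurable]: "A \<in> sets borel" by simp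
  define F where "F z = (indicator A (pt (fst z) (snd z)) :: ennreal)" for z
  have [measurable]: "F \<in> borel_measurable borel"
    unfolding F_def borel_prod[symmetric] by measurable
  have "emeasure (distr lborel borel rot90) A = (\<integral>\<^sup>+x. indicator A x \<partial>distr lborel borel rot90)"
    by simp
  also have "\<dots> = (\<integral>\<^sup>+x. indicator A (rot90 x) \<partial>lborel)"
    by (rule nn_integral_distr) auto
  also have "\<dots> = (\<integral>\<^sup>+x. F (x \<bullet> pt 0 (-1), x \<bullet> pt 1 0) \<partial>lborel)"
    by (simp add: F_def inner_pt rot90_def)
  also have "\<dots> = (\<integral>\<^sup>+a. \<integral>\<^sup>+b. F (a, b) \<partial>lborel \<partial>lborel)"
    by (rule nn_integral_unimodular) (auto simp: cross2_def)
  also have "\<dots> = (\<integral>\<^sup>+x. indicator A x \<partial>lborel)"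
    by (subst nn_integral_real2) (auto simp: F_def)
  finally show "emeasure (distr lborel borel rot90) A = emeasure lborel A" by simp
qed simp

lemma rot90_pow_measurable [measurable]: "(rot90 ^^ j) \<in> borel_measurable borel"
  by (induction j) auto

lemma distr_rot90_pow: "distr lborel borel (rot90 ^^ j) = lborel"
proof (induction j)
  case (Suc j)
  have "distr lborel borel (rot90 ^^ Suc j) = distr (distr lborel borel (rot90 ^^ j)) borel rot90"
    by (subst distr_distr) (auto simp: comp_def)
  then show ?case unfolding Suc.IH distr_rot90 .
next
  case 0
  show ?case by (simp add: distr_id2 id_def)
qed

text \<open>The sector over the right side of the square, not a coordinate quadrant. It is closed on
  one ray only, so that its four rotations partition the punctured plane.\<close>

definition quadrant :: "(real^2) set" where
  "quadrant = {x. 0 < x $ 1 \<and> - x $ 1 < x $ 2 \<and> x $ 2 \<le> x $ 1}"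

lemma quadrant_sets [measurable]: "quadrant \<in> sets borel"
  unfolding quadrant_def by measurable

lemma quadrant_partition:
  assumes "x \<noteq> 0"
  shows "(\<Sum>j<4. indicator quadrant ((rot90 ^^ j) x)) = (1::real)"
proof -
  have "x $ 1 \<noteq> 0 \<or> x $ 2 \<noteq> 0"
    using assms by (auto simp: vec_eq_iff forall_2)
  then show ?thesis
    by (simp add: eval_nat_numeral rot90_def quadrant_def indicator_def) arith
qed

lemma integral_rot90_pow:
  fixes F :: "real^2 \<Rightarrow> complex"
  assumes "F \<in> borel_measurable borel"
  shows "(LINT x|lborel. F ((rot90 ^^ j) x)) = (LINT x|lborel. F x)"
    and "integrable lborel (\<lambda>x. F ((rot90 ^^ j) x)) \<longleftrightarrow> integrable lborel F"
proof -
  show "(LINT x|lborel. F ((rot90 ^^ j) x)) = (LINT x|lborel. F x)"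
    by (subst (2) distr_rot90_pow[of j, symmetric], subst integral_distr) (use assms in auto)
  show "integrable lborel (\<lambda>x. F ((rot90 ^^ j) x)) \<longleftrightarrow> integrable lborel F"
    by (subst (2) distr_rot90_pow[of j, symmetric], subst integrable_distr_eq) (use assms in auto)
qed

lemma integral_quadrant_sum:
  fixes F :: "real^2 \<Rightarrow> complex"
  assumes F: "integrable lborel F"
  shows "(LINT x|lborel. F x) = (\<Sum>j<4. LINT x|lborel. indicator quadrant x *\<^sub>R F ((rot90 ^^ j) x))"
proof -
  have [measurable]: "F \<in> borel_measurable borel" using F by auto
  have p4: "(rot90 ^^ 4) x = x" for x using rot90_pow4[of 0 x] by simp
  have i: "integrable lborel (\<lambda>x. indicator quadrant ((rot90 ^^ j) x) *\<^sub>R F x)" for j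
    by (rule Bochner_Integration.integrable_bound[OF F]) (auto simp: indicator_def)
  have "(LINT x|lborel. F x) = (LINT x|lborel. (\<Sum>j<4. indicator quadrant ((rot90 ^^ j) x) *\<^sub>R F x))"
  proof (rule integral_cong_AE)
    have "AE x::real^2 in lborel. x \<noteq> 0" by (rule AE_lborel_singleton)
    then show "AE x in lborel. F x = (\<Sum>j<4. indicator quadrant ((rot90 ^^ j) x) *\<^sub>R F x)"
      by eventually_elim (simp add: quadrant_partition flip: scaleR_sum_left)
  qed auto
  also have "\<dots> = (\<Sum>j<4. LINT x|lborel. indicator quadrant ((rot90 ^^ j) x) *\<^sub>R F x)"
    by (rule Bochner_Integration.integral_sum) (rule i)
  \<comment> \<open>Rotating by 4 - j quarter turns undoes j of them. The exponents 4, 3, 2, 1 then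
    run through the same four rotations as 0, 1, 2, 3.\<close>
  also have "\<dots> = (\<Sum>j<4. LINT x|lborel. indicator quadrant x *\<^sub>R F ((rot90 ^^ (4 - j)) x))"
  proof (intro sum.cong refl)
    fix j :: nat assume "j \<in> {..<4}"
    then have "(rot90 ^^ (4 - j)) ((rot90 ^^ j) x) = x" for x
      using p4[of x] by (simp flip: funpow_add comp_apply[of "rot90 ^^ (4 - j)"])
    then show "(LINT x|lborel. indicator quadrant ((rot90 ^^ j) x) *\<^sub>R F x)
        = (LINT x|lborel. indicator quadrant x *\<^sub>R F ((rot90 ^^ (4 - j)) x))"
      using integral_rot90_pow(1)[of "\<lambda>x. indicator quadrant x *\<^sub>R F ((rot90 ^^ (4 - j)) x)" j] by simp
  qed
  also have "\<dots> = (\<Sum>j<4. LINT x|lborel. indicator quadrant x *\<^sub>R F ((rot90 ^^ j) x))"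
  proof -
    have "rot90 (rot90 (rot90 (rot90 x))) = x" for x by (simp add: rot90_def pt_eta)
    then show ?thesis by (simp add: eval_nat_numeral)
  qed
  finally show ?thesis .
qed

text \<open>For fixed first coordinate a the substitution b = a t has Jacobian a and straightens the
  sector to -1 < t \<le> 1. Fubini then exchanges a and t; the fibrewise bound by the norm of G
  supplies its integrability.\<close>

lemma integral_quadrant:
  fixes G :: "real^2 \<Rightarrow> complex"
  assumes G: "integrable lborel G"
  shows "(LINT x|lborel. indicator quadrant x *\<^sub>R G x)
    = (LINT t|lborel. indicator {-1<..1} t *\<^sub>R (LINT a|lborel. (indicator {0<..} a * a) *\<^sub>R G (a *\<^sub>R pt 1 t)))"
proof -
  let ?g = "\<lambda>a b. indicator quadrant (pt a b) *\<^sub>R G (pt a b)"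
  let ?h = "\<lambda>a t. indicator quadrant (pt a (0 + a * t)) *\<^sub>R G (pt a (0 + a * t))"
  have [measurable]: "G \<in> borel_measurable borel" using G by auto
  define h where "h = (\<lambda>(a, t). (indicator {0<..} a * a * indicator {-1<..1} t) *\<^sub>R G (a *\<^sub>R pt 1 t))"
  have [measurable]: "h \<in> borel_measurable (lborel \<Otimes>\<^sub>M lborel)"
    unfolding h_def by measurable
  have ap: "a *\<^sub>R pt 1 t = pt a (a * t)" for a t by (simp add: vec_eq_iff forall_2)
  have qi: "integrable lborel (\<lambda>x. indicator quadrant x *\<^sub>R G x)"
    by (rule Bochner_Integration.integrable_bound[OF G]) (auto simp: indicator_def)
  note q2 = integral_real2[OF qi]
  have fibre: "indicator quadrant (pt a (a * t)) = (indicator {0<..} a * indicator {-1<..1} t :: real)" for a t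
  proof (cases "0 < a")
    case True
    have "- a < a * t \<longleftrightarrow> - 1 < t" "a * t \<le> a \<longleftrightarrow> t \<le> 1"
      using mult_less_cancel_left_pos[OF True, of "-1" t] mult_le_cancel_left_pos[OF True, of t 1] by simp_all
    then show ?thesis using True by (simp add: quadrant_def indicator_def)
  qed (simp add: quadrant_def)
  have inner: "(LINT b|lborel. ?g a b) = (LINT t|lborel. h (a, t))" for a
  proof (cases "0 < a")
    case True
    have "(LINT b|lborel. ?g a b)
        = \<bar>a\<bar> *\<^sub>R (LINT t|lborel. ?h a t)"
      using True by (intro lborel_integral_real_affine) auto
    also have "\<dots> = (LINT t|lborel. \<bar>a\<bar> *\<^sub>R (?h a t))"
      by (rule integral_scaleR_right[symmetric])
    also have "\<dots> = (LINT t|lborel. h (a, t))"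
      using True by (intro Bochner_Integration.integral_cong) (simp_all add: h_def ap fibre)
    finally show ?thesis .
  next
    case False
    then show ?thesis by (simp add: h_def quadrant_def)
  qed
  have nn: "(\<integral>\<^sup>+t. ennreal (norm (h (a, t))) \<partial>lborel) \<le> (\<integral>\<^sup>+b. ennreal (norm (G (pt a b))) \<partial>lborel)" for a
  proof (cases "0 < a")
    case True
    have "(\<integral>\<^sup>+b. ennreal (norm (G (pt a b))) \<partial>lborel) = ennreal \<bar>a\<bar> * (\<integral>\<^sup>+t. ennreal (norm (G (pt a (0 + a * t)))) \<partial>lborel)"
      using True by (intro nn_integral_real_affine) auto
    also have "\<dots> = (\<integral>\<^sup>+t. ennreal \<bar>a\<bar> * ennreal (norm (G (pt a (a * t)))) \<partial>lborel)"
      by (simp add: nn_integral_cmult)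
    also have "\<dots> \<ge> (\<integral>\<^sup>+t. ennreal (norm (h (a, t))) \<partial>lborel)"
      using True by (intro nn_integral_mono) (auto simp: h_def ap indicator_def simp flip: ennreal_mult)
    finally show ?thesis .
  qed (simp add: h_def)
  have hi: "integrable (lborel \<Otimes>\<^sub>M lborel) h"
  proof (rule integrableI_bounded)
    have "(\<integral>\<^sup>+z. ennreal (norm (h z)) \<partial>(lborel \<Otimes>\<^sub>M lborel)) = (\<integral>\<^sup>+a. \<integral>\<^sup>+t. ennreal (norm (h (a, t))) \<partial>lborel \<partial>lborel)"
      by (rule lborel.nn_integral_fst[symmetric]) measurable
    also have "\<dots> \<le> (\<integral>\<^sup>+a. \<integral>\<^sup>+b. ennreal (norm (G (pt a b))) \<partial>lborel \<partial>lborel)"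
      by (intro nn_integral_mono nn)
    also have "\<dots> = (mass G)"
      by (rule nn_integral_real2[symmetric]) measurable
    also have "\<dots> < \<infinity>" using G by (simp add: integrable_iff_bounded)
    finally show "(\<integral>\<^sup>+z. ennreal (norm (h z)) \<partial>(lborel \<Otimes>\<^sub>M lborel)) < \<infinity>" .
  qed simp
  have "(LINT x|lborel. indicator quadrant x *\<^sub>R G x) = (LINT a|lborel. LINT b|lborel. ?g a b)"
    using q2 lborel_pair.integral_fst'[of "\<lambda>z. indicator quadrant (pt (fst z) (snd z)) *\<^sub>R G (pt (fst z) (snd z))"]
    by (simp add: split_beta')
  also have "\<dots> = (LINT a|lborel. LINT t|lborel. h (a, t))"
    by (simp only: inner)
  also have "\<dots> = (LINT t|lborel. LINT a|lborel. h (a, t))"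
    using lborel_pair.Fubini_integral[of "\<lambda>a t. h (a, t)"] hi by simp
  also have "\<dots> = (LINT t|lborel. indicator {-1<..1} t *\<^sub>R (LINT a|lborel. (indicator {0<..} a * a) *\<^sub>R G (a *\<^sub>R pt 1 t)))"
    unfolding h_def integral_scaleR_right[symmetric]
    by (intro Bochner_Integration.integral_cong refl) (simp add: scaleR_conv_of_real[where 'a = complex] mult_ac)
  finally show ?thesis .
qed

lemma rot90_pow_scaleR: "(rot90 ^^ j) (a *\<^sub>R x) = a *\<^sub>R (rot90 ^^ j) x"
  by (induction j) (auto simp: rot90_def vec_eq_iff forall_2)

lemma integral_polar:
  fixes F :: "real^2 \<Rightarrow> complex"
  assumes F: "integrable lborel F"
  shows "(LINT x|lborel. F x) = (\<Sum>j<4. LINT t|lborel. indicator {-1<..1} t *\<^sub>R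
     (LINT a|lborel. (indicator {0<..} a * a) *\<^sub>R F (a *\<^sub>R square_pt j t)))"
proof -
  have [measurable]: "F \<in> borel_measurable borel" using F by auto
  have "integrable lborel (\<lambda>x. F ((rot90 ^^ j) x))" for j
    using F by (subst integral_rot90_pow(2)) auto
  then show ?thesis
    unfolding integral_quadrant_sum[OF F] by (simp add: integral_quadrant rot90_pow_scaleR square_pt_def)
qed

section \<open>The kernel as an integral over the boundary curve\<close>

context planar_gauge
begin

text \<open>The density 1 / \<rho>(q)^2 in the side parameter is that of the cone measure: it is the
  limit of \<open>edge_len\<close> divided by the cell length. End points of sides are counted
  twice, on a null set.\<close>

definition curve_kernel :: "(real \<Rightarrow> complex) \<Rightarrow> real^2 \<Rightarrow> complex" where
  "curve_kernel \<psi> x = (\<Sum>j<4. LINT t|lborel. indicator {-1..1} t *\<^sub>R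
      ((1 / \<rho> (square_pt j t))\<^sup>2 *\<^sub>R \<psi> (x \<bullet> bdry j t)))"

lemma gauge_measurable [measurable]: "\<rho> \<in> borel_measurable borel"
  by (rule borel_measurable_continuous_onI) (rule gauge_continuous)

lemma integrable_gauge_multiplier:
  fixes m :: "real \<Rightarrow> complex"
  assumes m[measurable]: "m \<in> borel_measurable borel" and bd: "\<And>s. norm (m s) \<le> B"
    and supp: "\<And>s. s \<notin> {0<..<2} \<Longrightarrow> m s = 0"
  shows "integrable lborel (\<lambda>\<xi>. m (\<rho> \<xi>))"
proof (rule Bochner_Integration.integrable_bound)
  show "integrable lborel (\<lambda>\<xi>. indicator (cball (0::real^2) (2 * P)) \<xi> * B :: real)"
    using emeasure_bounded_finite[OF bounded_cball, of "0 :: real^2" "2 * P"]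
    by (intro integrable_mult_left integrable_real_indicator) auto
  have "norm (m (\<rho> \<xi>)) \<le> norm (indicator (cball (0::real^2) (2 * P)) \<xi> * B :: real)" for \<xi>
  proof (cases "\<rho> \<xi> < 2")
    case True
    then have "P * \<rho> \<xi> \<le> P * 2" using P1 by (intro mult_left_mono) auto
    then have "norm \<xi> \<le> 2 * P" using lower[of \<xi>] by linarith
    then show ?thesis using bd[of "\<rho> \<xi>"] by (auto simp: indicator_def)
  qed (simp add: supp)
  then show "AE \<xi> in lborel. norm (m (\<rho> \<xi>)) \<le> norm (indicator (cball (0::real^2) (2 * P)) \<xi> * B :: real)" by simp
qed measurable

text \<open>On the ray through q the substitution s = \<rho>(q) a turns a da into s ds /
  \<rho>(q)^2. The factor s passes to the multiplier, giving \<open>times_id m\<close>, and the rest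
  is the cone density.\<close>

lemma transform_gauge_multiplier:
  assumes m[measurable]: "m \<in> borel_measurable borel" and bd: "\<And>s. norm (m s) \<le> B"
    and supp: "\<And>s. s \<notin> {0<..<2} \<Longrightarrow> m s = 0"
  shows "(LINT \<xi>|lborel. cis (x \<bullet> \<xi>) * m (\<rho> \<xi>)) = curve_kernel (osc (times_id m)) x"
proof -
  let ?I = "\<lambda>j t. (1 / \<rho> (square_pt j t))\<^sup>2 *\<^sub>R osc (times_id m) (x \<bullet> bdry j t)"
  let ?F = "\<lambda>\<xi>. cis (x \<bullet> \<xi>) * m (\<rho> \<xi>)"
  have F: "integrable lborel ?F"
    by (rule Bochner_Integration.integrable_bound[OF integrable_gauge_multiplier[OF assms]]) (auto simp: norm_mult)
  have "(LINT a|lborel. (indicator {0<..} a * a) *\<^sub>R ?F (a *\<^sub>R square_pt j t))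
     = ?I j t" for j t
  proof -
    define r where "r = \<rho> (square_pt j t)"
    have r: "r > 0" by (simp add: r_def)
    define I where "I = (LINT a|lborel. (indicator {0<..} a * a) *\<^sub>R ?F (a *\<^sub>R square_pt j t))"
    have "osc (times_id m) (x \<bullet> bdry j t)
       = \<bar>r\<bar> *\<^sub>R (LINT a|lborel. cis ((x \<bullet> bdry j t) * (0 + r * a)) * (of_real (0 + r * a) * m (0 + r * a)))"
      unfolding osc_def using r by (intro lborel_integral_real_affine) auto
    also have "\<dots> = r *\<^sub>R (LINT a|lborel. r *\<^sub>R ((indicator {0<..} a * a) *\<^sub>R ?F (a *\<^sub>R square_pt j t)))"
    proof -
      have "cis ((x \<bullet> bdry j t) * (0 + r * a)) * (of_real (0 + r * a) * m (0 + r * a))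
          = r *\<^sub>R ((indicator {0<..} a * a) *\<^sub>R ?F (a *\<^sub>R square_pt j t))" for a
      proof (cases "0 < a")
        case True
        have "(x \<bullet> bdry j t) * (r * a) = x \<bullet> (a *\<^sub>R square_pt j t)"
          using r by (simp add: bdry_def r_def)
        then show ?thesis using True
            by (simp add: homogeneous r_def scaleR_conv_of_real[where 'a = complex] mult_ac)
      next
        case False
        then have "r * a \<le> 0" using r by (simp add: mult_nonneg_nonpos)
        then show ?thesis using False by (simp add: supp)
      qed
      then show ?thesis using r by simp
    qed
    also have "\<dots> = r *\<^sub>R (r *\<^sub>R I)"
      unfolding I_def by (simp only: integral_scaleR_right)
    finally show ?thesis
      unfolding I_def[symmetric] r_def[symmetric] using r by (simp add: power2_eq_square)
  qed
  then have "(LINT \<xi>|lborel. ?F \<xi>) = (\<Sum>j<4. LINT t|lborel. indicator {-1<..1} t *\<^sub>R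
     ?I j t)"
    unfolding integral_polar[OF F] by simp
  also have "\<dots> = curve_kernel (osc (times_id m)) x"
    unfolding curve_kernel_def
  proof (intro sum.cong refl integral_cong_AE)
    fix j
    have "AE t::real in lborel. t \<noteq> - 1" by (rule AE_lborel_singleton)
    then show "AE t in lborel. indicator {-1<..1} t *\<^sub>R (?I j t)
      = indicator {-1..1} t *\<^sub>R (?I j t)"
      by eventually_elim (auto simp: indicator_def)
  qed (unfold bdry_def square_pt_def, measurable)
  finally show ?thesis .
qed

end

section \<open>Approximation by polygons\<close>

lemma cell_integral_bound:
  fixes f :: "real \<Rightarrow> complex"
  assumes "continuous_on {s..u} f" "s \<le> u" "\<And>t. t \<in> {s..u} \<Longrightarrow> norm (c - f t) \<le> e" "0 \<le> e"
  shows "norm ((u - s) *\<^sub>R c - integral {s..u} f) \<le> e * (u - s)"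
proof -
  have "((\<lambda>t. c - f t) has_integral ((u - s) *\<^sub>R c - integral {s..u} f)) (cbox s u)"
    using has_integral_const_real[of c s u] assms
    by (intro has_integral_diff) (auto intro: integrable_integral integrable_continuous_real)
  from has_integral_bound[OF _ this] show ?thesis using assms by simp
qed

lemma lipschitz_imp_continuous:
  fixes f :: "real \<Rightarrow> complex"
  assumes "\<And>a b. norm (f a - f b) \<le> L * \<bar>a - b\<bar>" "0 \<le> L"
  shows "continuous_on S f"
  using assms by (intro lipschitz_on_continuous_on[of L] lipschitz_onI) (auto simp: dist_norm)

lemma unit_mean_bound:
  fixes g :: "real \<Rightarrow> complex"
  assumes "continuous_on {0..1} g" "\<And>t. t \<in> {0..1} \<Longrightarrow> norm (g t - c) \<le> e" "0 \<le> e"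
  shows "norm ((LINT t|lborel. indicator {0..1} t *\<^sub>R g t) - c) \<le> e"
proof -
  have "(LINT t|lborel. indicator {0..1} t *\<^sub>R g t) = integral {0..1} g"
    using set_borel_integral_eq_integral(2)[OF borel_integrable_atLeastAtMost'[OF assms(1)]]
    by (simp add: set_lebesgue_integral_def)
  moreover have "norm ((1 - 0) *\<^sub>R c - integral {0..1} g) \<le> e * (1 - 0)"
    using assms by (intro cell_integral_bound) (auto simp: norm_minus_commute)
  ultimately show ?thesis by (simp add: norm_minus_commute)
qed

context planar_gauge
begin

lemma grid_diff: "grid N (Suc i) - grid N i = 2 / real N"
  by (simp add: grid_def diff_divide_distrib[symmetric])

lemma grid_le: "grid N i \<le> grid N (Suc i)"
  by (simp add: grid_def divide_right_mono)

lemma integral_grid: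
  fixes f :: "real \<Rightarrow> complex"
  assumes f: "continuous_on {-1..1} f" and N: "0 < N" and n: "n \<le> N"
  shows "integral {-1..grid N n} f = (\<Sum>i<n. integral {grid N i..grid N (Suc i)} f)"
  using n
proof (induction n)
  case 0
  then show ?case by (simp add: grid_def)
next
  case (Suc n)
  have g: "grid N n \<in> {-1..1}" "grid N (Suc n) \<in> {-1..1}" using grid_mem[of _ N] Suc N by auto
  have "grid N n \<le> grid N (Suc n)" by (rule grid_le)
  then have "integral {-1..grid N n} f + integral {grid N n..grid N (Suc n)} f = integral {-1..grid N (Suc n)} f"
    using g by (intro Henstock_Kurzweil_Integration.integral_combine integrable_continuous_real
        continuous_on_subset[OF f]) auto
  then show ?case using Suc by simp
qed

lemma inverse_gauge_bound: "1 / \<rho> (square_pt j t) \<le> P"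
  using gauge_square_ge[of j t] gauge_square_pos[of j t] by (simp add: field_simps)

lemma inverse_gauge_lipschitz: "\<bar>1 / \<rho> (square_pt j s) - 1 / \<rho> (square_pt j t)\<bar> \<le> P\<^sup>2 / 8 * \<bar>s - t\<bar>"
proof -
  have "1 / \<rho> (square_pt j s) - 1 / \<rho> (square_pt j t)
      = (\<rho> (square_pt j t) - \<rho> (square_pt j s)) * ((1 / \<rho> (square_pt j s)) * (1 / \<rho> (square_pt j t)))"
    by (simp add: field_simps)
  also have "\<bar>\<dots>\<bar> = \<bar>\<rho> (square_pt j t) - \<rho> (square_pt j s)\<bar> * ((1 / \<rho> (square_pt j s)) * (1 / \<rho> (square_pt j t)))"
    by (simp add: abs_mult gauge_nonneg)
  also have "\<dots> \<le> (\<bar>s - t\<bar> / 8) * (P * P)"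
    using gauge_lipschitz[of "square_pt j t" "square_pt j s"] P1
    by (intro mult_mono inverse_gauge_bound) (auto simp: square_pt_dist gauge_nonneg abs_minus_commute)
  finally show ?thesis by (simp add: power2_eq_square mult.commute)
qed

lemma bdry_lipschitz:
  assumes "t \<in> {-1..1}"
  shows "norm (bdry j s - bdry j t) \<le> 2 * P\<^sup>2 * \<bar>s - t\<bar>"
proof -
  let ?r = "\<lambda>t. 1 / \<rho> (square_pt j t)"
  have "bdry j s - bdry j t = ?r s *\<^sub>R (square_pt j s - square_pt j t) + (?r s - ?r t) *\<^sub>R square_pt j t"
    by (simp add: bdry_def algebra_simps)
  also have "norm \<dots> \<le> ?r s * \<bar>s - t\<bar> + \<bar>?r s - ?r t\<bar> * norm (square_pt j t)"
    by (rule order_trans[OF norm_triangle_ineq]) (simp add: square_pt_dist gauge_nonneg)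
  also have "\<dots> \<le> P * \<bar>s - t\<bar> + P\<^sup>2 / 8 * \<bar>s - t\<bar> * (3/2)"
    using norm_square_pt_le[OF assms, of j] inverse_gauge_bound inverse_gauge_lipschitz P1
    by (intro add_mono mult_mono) auto
  also have "\<dots> \<le> P\<^sup>2 * \<bar>s - t\<bar> + P\<^sup>2 * \<bar>s - t\<bar>"
  proof (intro add_mono)
    have "P * 1 \<le> P\<^sup>2" unfolding power2_eq_square using P1 by (intro mult_left_mono) auto
    then show "P * \<bar>s - t\<bar> \<le> P\<^sup>2 * \<bar>s - t\<bar>" by (intro mult_right_mono) auto
  qed auto
  finally show ?thesis by (simp add: mult_ac)
qed

lemma bdry_continuous: "continuous_on {-1..1} (bdry j)"
proof -
  have "(2 * P\<^sup>2)-lipschitz_on {-1..1} (bdry j)"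
    by (intro lipschitz_onI) (auto simp: dist_norm intro!: bdry_lipschitz)
  then show ?thesis by (rule lipschitz_on_continuous_on)
qed

lemma square_pt_continuous: "continuous_on S (square_pt j)"
proof -
  have "1-lipschitz_on S (square_pt j)"
    by (intro lipschitz_onI) (auto simp: dist_norm square_pt_dist)
  then show ?thesis by (rule lipschitz_on_continuous_on)
qed

lemma inverse_gauge_continuous: "continuous_on S (\<lambda>t. 1 / \<rho> (square_pt j t))"
  by (intro continuous_intros continuous_on_compose2[OF gauge_continuous[of UNIV] square_pt_continuous]) auto

abbreviation inscribed_kernel :: "nat \<Rightarrow> (real \<Rightarrow> complex) \<Rightarrow> real^2 \<Rightarrow> complex" where
  "inscribed_kernel N \<equiv> cyclic_polygon.polygon_kernel (4 * N) (vert N) (edge_len N)"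

text \<open>A chord point and a curve point of the same cell differ by two increments of the curve.
  Each is at most its Lipschitz constant 2 P^2 times the cell length 2 / N.\<close>

lemma edge_mean_close:
  fixes \<psi> :: "real \<Rightarrow> complex"
  assumes lip: "\<And>a b. norm (\<psi> a - \<psi> b) \<le> L * \<bar>a - b\<bar>" and L: "0 \<le> L" and N: "0 < N"
    and t: "t \<in> {grid N (k mod N)..grid N (Suc (k mod N))}"
  shows "norm (cyclic_polygon.edge_mean (vert N) \<psi> k x - \<psi> (x \<bullet> bdry (k div N) t)) \<le> L * norm x * (8 * P\<^sup>2 / real N)"
proof -
  let ?y = "\<lambda>\<theta>. x \<bullet> vert N k + \<theta> * (x \<bullet> (vert N (Suc k) - vert N k))"
  let ?h = "2 * P\<^sup>2 * (2 / real N)"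
  interpret poly: cyclic_polygon P "4 * N" "vert N" "edge_dir N" "edge_len N" "turning N"
    by (rule cyclic_polygon[OF N])
  define j s u where "j = k div N" and "s = grid N (k mod N)" and "u = grid N (Suc (k mod N))"
  have mem: "s \<in> {-1..1}" "u \<in> {-1..1}"
    unfolding s_def u_def using N by (auto simp: Suc_leI simp del: atLeastAtMost_iff intro!: grid_mem)
  have us: "u - s = 2 / real N" unfolding s_def u_def by (rule grid_diff)
  have st: "s \<le> t" "t \<le> u" using t by (auto simp: s_def u_def)
  have tm: "t \<in> {-1..1}" using st mem by auto
  have v: "vert N k = bdry j s" "vert N (Suc k) = bdry j u"
    unfolding vert_Suc[OF N] by (simp_all add: vert_def j_def s_def u_def)
  have \<psi>c: "continuous_on S \<psi>" for S
    by (rule lipschitz_imp_continuous[OF lip L])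
  have "norm (\<psi> (?y \<theta>) - \<psi> (x \<bullet> bdry j t)) \<le> L * norm x * (8 * P\<^sup>2 / real N)"
    if \<theta>: "\<theta> \<in> {0..1}" for \<theta>
  proof -
    have "?y \<theta> - x \<bullet> bdry j t
       = x \<bullet> ((bdry j s - bdry j t) + \<theta> *\<^sub>R (bdry j u - bdry j s))"
      by (simp add: v inner_diff_right inner_add_right algebra_simps)
    then have "\<bar>?y \<theta> - x \<bullet> bdry j t\<bar>
       \<le> norm x * norm ((bdry j s - bdry j t) + \<theta> *\<^sub>R (bdry j u - bdry j s))"
      by (metis Cauchy_Schwarz_ineq2)
    also have "\<dots> \<le> norm x * (?h + 1 * (?h))"
    proof (intro mult_left_mono order_trans[OF norm_triangle_ineq] add_mono)
      have "norm (bdry j s - bdry j t) \<le> 2 * P\<^sup>2 * \<bar>s - t\<bar>" by (rule bdry_lipschitz[OF tm])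
      also have "\<dots> \<le> ?h" using st us by (intro mult_left_mono) auto
      finally show "norm (bdry j s - bdry j t) \<le> ?h" .
      have "norm (bdry j u - bdry j s) \<le> 2 * P\<^sup>2 * \<bar>u - s\<bar>" by (rule bdry_lipschitz[OF mem(1)])
      then have "norm (bdry j u - bdry j s) \<le> ?h" unfolding us by simp
      then show "norm (\<theta> *\<^sub>R (bdry j u - bdry j s)) \<le> 1 * (?h)"
        unfolding norm_scaleR using \<theta> by (intro mult_mono) auto
    qed auto
    finally have "L * \<bar>?y \<theta> - x \<bullet> bdry j t\<bar>
        \<le> L * (norm x * (?h + 1 * (?h)))"
      using L by (intro mult_left_mono) auto
    also have "\<dots> = L * norm x * (8 * P\<^sup>2 / real N)" by simp
    finally show ?thesis using lip order_trans by blast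
  qed
  then show ?thesis
    unfolding poly.edge_mean_def j_def[symmetric] using L N
    by (intro unit_mean_bound) (auto intro!: continuous_on_compose2[OF \<psi>c[of UNIV]] continuous_intros)
qed

text \<open>In each cell the chord mean is compared with the value on the curve, and the density 1 /
  (\<rho>(q) \<rho>(r)) at the ends with 1 / \<rho>^2 in between; both errors are of order 1 / N.
  The leading 8 is the total parameter length of four sides. The bound grows with |x|, but it is
  used only for pointwise convergence.\<close>

lemma polygon_kernel_close:
  fixes \<psi> :: "real \<Rightarrow> complex"
  assumes lip: "\<And>a b. norm (\<psi> a - \<psi> b) \<le> L * \<bar>a - b\<bar>" and L: "0 \<le> L"
    and bd: "\<And>a. norm (\<psi> a) \<le> B" and N: "0 < N"
  shows "norm (inscribed_kernel N \<psi> x - curve_kernel \<psi> x)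
     \<le> 8 * (P\<^sup>2 * (L * norm x * (8 * P\<^sup>2)) + P ^ 3 * B) / real N"
proof -
  let ?a = "L * norm x * (8 * P\<^sup>2 / real N)"
  let ?b = "P * (P\<^sup>2 / 8 * (2 / real N)) + P * (P\<^sup>2 / 8 * (2 / real N))"
  interpret poly: cyclic_polygon P "4 * N" "vert N" "edge_dir N" "edge_len N" "turning N"
    by (rule cyclic_polygon[OF N])
  have B: "0 \<le> B" using bd[of 0] norm_ge_zero order_trans by blast
  have \<psi>c: "continuous_on S \<psi>" for S
    by (rule lipschitz_imp_continuous[OF lip L])
  define f where "f j t = (1 / \<rho> (square_pt j t))\<^sup>2 *\<^sub>R \<psi> (x \<bullet> bdry j t)" for j t
  define e where "e = (P\<^sup>2 * (L * norm x * (8 * P\<^sup>2)) + P ^ 3 * B) / real N"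
  have e: "0 \<le> e" using L B P1 by (simp add: e_def)
  have fc: "continuous_on {-1..1} (f j)" for j
    unfolding f_def
    by (intro continuous_intros inverse_gauge_continuous[THEN continuous_on_power]
        continuous_on_compose2[OF \<psi>c[of UNIV]] bdry_continuous) auto
  have curve: "curve_kernel \<psi> x = (\<Sum>j<4. \<Sum>i<N. integral {grid N i..grid N (Suc i)} (f j))"
  proof -
    have "(LINT t|lborel. indicator {-1..1} t *\<^sub>R f j t) = integral {-1..grid N N} (f j)" for j
      using set_borel_integral_eq_integral(2)[OF borel_integrable_atLeastAtMost'[OF fc]] N
      by (simp add: set_lebesgue_integral_def grid_def)
    then show ?thesis
      unfolding curve_kernel_def f_def[symmetric] using integral_grid[OF fc N order_refl] by simp
  qed
  have poly: "poly.polygon_kernel \<psi> x = (\<Sum>j<4. \<Sum>i<N. of_real (edge_len N (i + j * N)) * poly.edge_mean \<psi> (i + j * N) x)"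
  proof -
    have "poly.polygon_kernel \<psi> x = (\<Sum>j<4. \<Sum>k\<in>{j * N..<j * N + N}. of_real (edge_len N k) * poly.edge_mean \<psi> k x)"
      unfolding poly.polygon_kernel_def by (rule sum.nat_group[symmetric])
    also have "\<dots> = (\<Sum>j<4. \<Sum>i<N. of_real (edge_len N (i + j * N)) * poly.edge_mean \<psi> (i + j * N) x)"
      using sum.shift_bounds_nat_ivl[of "\<lambda>k. of_real (edge_len N k) * poly.edge_mean \<psi> k x" 0 "_ * N" N]
      by (simp add: add.commute lessThan_atLeast0)
    finally show ?thesis .
  qed
  have cell: "norm (of_real (edge_len N (i + j * N)) * poly.edge_mean \<psi> (i + j * N) x - integral {grid N i..grid N (Suc i)} (f j))
     \<le> e * (2 / real N)" if i: "i < N" for i j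
  proof -
    define k where "k = i + j * N"
    have kd: "k div N = j" "k mod N = i" using i by (auto simp: k_def)
    define s u where "s = grid N i" and "u = grid N (Suc i)"
    have us: "u - s = 2 / real N" unfolding s_def u_def by (rule grid_diff)
    have mem: "s \<in> {-1..1}" "u \<in> {-1..1}"
      unfolding s_def u_def using N i by (auto simp: Suc_leI simp del: atLeastAtMost_iff intro!: grid_mem)
    let ?r = "\<lambda>t. 1 / \<rho> (square_pt j t)"
    have r: "0 \<le> ?r t" "?r t \<le> P" for t using inverse_gauge_bound[of j t] by (auto simp: gauge_nonneg)
    define E where "E = poly.edge_mean \<psi> k x"
    have "edge_len N k = (u - s) * (?r s * ?r u)"
      unfolding edge_len_eq[OF N] kd s_def[symmetric] u_def[symmetric] us by simp
    then have el: "of_real (edge_len N k) * E = (u - s) *\<^sub>R ((?r s * ?r u) *\<^sub>R E)"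
      by (simp add: scaleR_conv_of_real)
    have "norm ((u - s) *\<^sub>R ((?r s * ?r u) *\<^sub>R E) - integral {s..u} (f j)) \<le> e * (u - s)"
    proof (rule cell_integral_bound)
      show "continuous_on {s..u} (f j)" using mem by (intro continuous_on_subset[OF fc]) auto
      show "s \<le> u" unfolding s_def u_def by (rule grid_le)
      fix t assume t: "t \<in> {s..u}"
      have "(?r s * ?r u) *\<^sub>R E - f j t = (?r s * ?r u) *\<^sub>R (E - \<psi> (x \<bullet> bdry j t))
          + (?r s * (?r u - ?r t) + ?r t * (?r s - ?r t)) *\<^sub>R \<psi> (x \<bullet> bdry j t)"
        unfolding f_def by (simp add: algebra_simps power2_eq_square)
      also have "norm \<dots> \<le> P * P * (?a) + (?b) * B"
      proof (intro order_trans[OF norm_triangle_ineq] add_mono)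
        have "norm (E - \<psi> (x \<bullet> bdry j t)) \<le> ?a"
          unfolding E_def using edge_mean_close[OF lip L N, of t k x] t unfolding kd s_def u_def by simp
        then show "norm ((?r s * ?r u) *\<^sub>R (E - \<psi> (x \<bullet> bdry j t))) \<le> P * P * (?a)"
          unfolding norm_scaleR abs_mult using r P1 by (intro mult_mono) auto
        have rl: "\<bar>?r y - ?r t\<bar> \<le> P\<^sup>2 / 8 * (2 / real N)" if "y \<in> {s..u}" for y
        proof -
          have "\<bar>?r y - ?r t\<bar> \<le> P\<^sup>2 / 8 * \<bar>y - t\<bar>" by (rule inverse_gauge_lipschitz)
          also have "\<dots> \<le> P\<^sup>2 / 8 * (2 / real N)" using that t us by (intro mult_left_mono) auto
          finally show ?thesis .
        qed
        have "\<bar>?r s * (?r u - ?r t) + ?r t * (?r s - ?r t)\<bar> \<le> ?b"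
          using t r P1 by (intro order_trans[OF abs_triangle_ineq] add_mono; unfold abs_mult; intro mult_mono rl) auto
        then show "norm ((?r s * (?r u - ?r t) + ?r t * (?r s - ?r t)) *\<^sub>R \<psi> (x \<bullet> bdry j t))
          \<le> (?b) * B"
          unfolding norm_scaleR using bd P1 B by (intro mult_mono) auto
      qed
      also have "\<dots> \<le> e"
      proof -
        have "(?b) * B = (P ^ 3 * B) / real N / 2"
          by (simp add: power2_eq_square power3_eq_cube)
        also have "\<dots> \<le> (P ^ 3 * B) / real N"
        proof -
          have "0 \<le> (P ^ 3 * B) / real N" using P1 B by simp
          moreover have "y / 2 \<le> y" if "0 \<le> y" for y :: real using that by simp
          ultimately show ?thesis by blast
        qed
        finally have "P * P * (?a) + (?b) * B
           \<le> P * P * (?a) + (P ^ 3 * B) / real N" by simp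
        also have "\<dots> = e" unfolding e_def by (simp add: add_divide_distrib power2_eq_square)
        finally show ?thesis .
      qed
      finally show "norm ((?r s * ?r u) *\<^sub>R E - f j t) \<le> e" .
    qed (rule e)
    then show ?thesis unfolding k_def[symmetric] E_def[symmetric] el s_def[symmetric] u_def[symmetric] us .
  qed
  have "norm (poly.polygon_kernel \<psi> x - curve_kernel \<psi> x) \<le> (\<Sum>j<4::nat. \<Sum>i<N. e * (2 / real N))"
    unfolding poly curve sum_subtractf[symmetric] by (intro sum_norm_le cell) auto
  also have "\<dots> = 8 * e" using N by simp
  finally show ?thesis by (simp add: e_def)
qed

lemma polygon_kernel_tendsto:
  fixes \<psi> :: "real \<Rightarrow> complex"
  assumes lip: "\<And>a b. norm (\<psi> a - \<psi> b) \<le> L * \<bar>a - b\<bar>" and L: "0 \<le> L"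
    and bd: "\<And>a. norm (\<psi> a) \<le> B"
  shows "(\<lambda>n. inscribed_kernel (Suc n) \<psi> x) \<longlonglongrightarrow> curve_kernel \<psi> x"
proof -
  let ?C = "8 * (P\<^sup>2 * (L * norm x * (8 * P\<^sup>2)) + P ^ 3 * B)"
  have "(\<lambda>n. ?C / real (Suc n)) \<longlonglongrightarrow> 0"
    using LIMSEQ_Suc[OF lim_const_over_n[of ?C]] by simp
  then have "(\<lambda>n. inscribed_kernel (Suc n) \<psi> x - curve_kernel \<psi> x) \<longlonglongrightarrow> 0"
    by (rule Lim_null_comparison[rotated])
       (intro always_eventually allI polygon_kernel_close lip L bd, simp)
  then show ?thesis by (simp add: LIM_zero_iff)
qed

end

section \<open>The kernel of a quasiradial multiplier\<close>

lemma norm_cis_diff_le: "norm (cis a - cis b) \<le> \<bar>a - b\<bar>"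
proof -
  have "cis a - cis b = cis ((a + b) / 2) * (cis ((a - b) / 2) - cis (- ((a - b) / 2)))"
  proof -
    have "(a + b) / 2 + (a - b) / 2 = a" "(a + b) / 2 + - ((a - b) / 2) = b"
      by (simp_all add: field_simps)
    then show ?thesis by (simp only: right_diff_distrib cis_mult)
  qed
  also have "cis ((a - b) / 2) - cis (- ((a - b) / 2)) = 2 * \<i> * of_real (sin ((a - b) / 2))"
    by (simp add: complex_eq_iff)
  finally have "norm (cis a - cis b) = 2 * \<bar>sin ((a - b) / 2)\<bar>"
    by (simp add: norm_mult)
  also have "\<dots> \<le> 2 * \<bar>(a - b) / 2\<bar>"
    by (intro mult_left_mono abs_sin_x_le_abs_x) auto
  finally show ?thesis by simp
qed

lemma osc_lipschitz:
  assumes g: "integrable lborel g" and sg: "integrable lborel (times_id g)"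
  shows "norm (osc g a - osc g b) \<le> (LINT s|lborel. norm (of_real s * g s)) * \<bar>a - b\<bar>"
proof -
  have i: "integrable lborel (\<lambda>s. cis (c * s) * g s)" for c
    by (rule Bochner_Integration.integrable_bound[OF g]) (use g in \<open>auto simp: norm_mult\<close>)
  have "osc g a - osc g b = (LINT s|lborel. cis (a * s) * g s - cis (b * s) * g s)"
    unfolding osc_def by (rule Bochner_Integration.integral_diff[symmetric]) (rule i)+
  also have "norm \<dots> \<le> (LINT s|lborel. norm (cis (a * s) * g s - cis (b * s) * g s))"
    by (rule integral_norm_bound)
  also have "\<dots> \<le> (LINT s|lborel. norm (of_real s * g s) * \<bar>a - b\<bar>)"
  proof (rule integral_mono)
    show "integrable lborel (\<lambda>s. norm (cis (a * s) * g s - cis (b * s) * g s))"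
      by (intro integrable_norm Bochner_Integration.integrable_diff i)
    show "integrable lborel (\<lambda>s. norm (of_real s * g s) * \<bar>a - b\<bar>)"
      using sg by (intro integrable_mult_left integrable_norm)
    show "norm (cis (a * s) * g s - cis (b * s) * g s) \<le> norm (of_real s * g s) * \<bar>a - b\<bar>" for s
    proof -
      have "norm (cis (a * s) * g s - cis (b * s) * g s) = norm (cis (a * s) - cis (b * s)) * norm (g s)"
        by (simp add: norm_mult flip: left_diff_distrib)
      also have "\<dots> \<le> \<bar>a * s - b * s\<bar> * norm (g s)" by (intro mult_right_mono norm_cis_diff_le) auto
      also have "\<dots> = norm (of_real s * g s) * \<bar>a - b\<bar>"
        by (simp add: norm_mult abs_mult flip: left_diff_distrib)
      finally show ?thesis .
    qed
  qed
  finally show ?thesis by simp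
qed

lemma norm_osc_le:
  assumes g: "integrable lborel g"
  shows "norm (osc g a) \<le> (LINT s|lborel. norm (g s))"
  unfolding osc_def using integral_norm_bound[of lborel "\<lambda>s. cis (a * s) * g s"] by (simp add: norm_mult)

lemma integrable_compact_supp:
  fixes m :: "real \<Rightarrow> complex"
  assumes [measurable]: "m \<in> borel_measurable borel" and bd: "\<And>s. norm (m s) \<le> B"
    and supp: "\<And>s. s \<notin> {0<..<2} \<Longrightarrow> m s = 0"
  shows "integrable lborel m"
proof (rule Bochner_Integration.integrable_bound)
  show "integrable lborel (\<lambda>s. indicator {0..2::real} s * B :: real)"
    by (intro integrable_mult_left integrable_real_indicator) auto
  have "norm (m s) \<le> norm (indicator {0..2::real} s * B :: real)" for s
    using bd[of s] supp[of s] by (auto simp: indicator_def)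
  then show "AE s in lborel. norm (m s) \<le> norm (indicator {0..2::real} s * B :: real)" by simp
qed simp

lemma norm_times_id_le:
  fixes m :: "real \<Rightarrow> complex"
  assumes bd: "\<And>s. norm (m s) \<le> B" and supp: "\<And>s. s \<notin> {0<..<2} \<Longrightarrow> m s = 0"
  shows "norm (times_id m s) \<le> 2 * B"
proof (cases "s \<in> {0<..<2}")
  case True
  then have "\<bar>s\<bar> * norm (m s) \<le> 2 * B" by (intro mult_mono bd) auto
  then show ?thesis by (simp add: norm_mult)
next
  case False
  have "0 \<le> B" using bd[of 0] norm_ge_zero order_trans by blast
  then show ?thesis using supp[OF False] by simp
qed

lemma integrable_times_id_compact_supp:
  fixes m :: "real \<Rightarrow> complex"
  assumes [measurable]: "m \<in> borel_measurable borel" and bd: "\<And>s. norm (m s) \<le> B"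
    and supp: "\<And>s. s \<notin> {0<..<2} \<Longrightarrow> m s = 0"
  shows "integrable lborel (times_id m)"
proof (rule integrable_compact_supp)
  show "norm (times_id m s) \<le> 2 * B" for s by (rule norm_times_id_le[OF bd supp])
qed (use supp in auto)

text \<open>The first summand is the bound 8 P^2 for the total cone mass times the cost of passing
  from s m(s) to m(s); the second is 16 P^2 times the total turning 4.\<close>

definition kernel_const :: "real \<Rightarrow> real" where
  "kernel_const P = 8 * P\<^sup>2 * (64 / fejer_const) + 64 * P\<^sup>2"

lemma kernel_const_pos: "1 \<le> P \<Longrightarrow> 0 < kernel_const P"
  unfolding kernel_const_def using fejer_const_pos by (intro add_pos_pos mult_pos_pos) auto

context planar_gauge
begin

text \<open>The polygon estimate is uniform in the number of edges, so it passes to the pointwise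
  limit by Fatou's lemma.\<close>

lemma nn_integral_curve_kernel:
  fixes m :: "real \<Rightarrow> complex"
  assumes m[measurable]: "m \<in> borel_measurable borel" and bd: "\<And>s. norm (m s) \<le> B"
    and supp: "\<And>s. s \<notin> {0<..<2} \<Longrightarrow> m s = 0"
  shows "mass (curve_kernel (osc (times_id m)))
    \<le> ennreal (kernel_const P) * (weighted_mass (osc m))"
proof -
  define \<psi> where "\<psi> = osc (times_id m)"
  define A where "A = (weighted_mass (osc m))"
  have m1: "integrable lborel m" by (rule integrable_compact_supp[OF assms])
  have m2: "integrable lborel (times_id m)" by (rule integrable_times_id_compact_supp[OF assms])
  \<comment> \<open>The Lipschitz constant of \<open>osc (times_id m)\<close> is the integral of s^2
    |m(s)|.\<close>
  have m3: "integrable lborel (times_id (times_id m))"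
  proof (rule integrable_times_id_compact_supp)
    show "norm (times_id m s) \<le> 2 * B" for s by (rule norm_times_id_le[OF bd supp])
  qed (use supp in auto)
  define K where "K n = inscribed_kernel (Suc n) \<psi>" for n
  have Kb: "K n \<in> borel_measurable borel \<and> (mass (K n)) \<le> ennreal (kernel_const P) * A" for n
  proof -
    interpret poly: cyclic_polygon P "4 * Suc n" "vert (Suc n)" "edge_dir (Suc n)" "edge_len (Suc n)" "turning (Suc n)"
      by (rule cyclic_polygon) simp
    have [measurable]: "\<psi> \<in> borel_measurable borel" unfolding \<psi>_def by measurable
    have meas: "K n \<in> borel_measurable borel"
      unfolding K_def poly.polygon_kernel_def by measurable
    have "mass (K n)
      \<le> ennreal (\<Sum>k<4 * Suc n. edge_len (Suc n) k) * (weighted_mass \<psi>)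
       + ennreal (16 * P\<^sup>2 * (\<Sum>k<4 * Suc n. turning (Suc n) k)) * A"
      unfolding K_def A_def \<psi>_def by (rule poly.nn_integral_polygon_kernel[OF m m1 m2])
    also have "\<dots> \<le> ennreal (8 * P\<^sup>2) * (ennreal (64 / fejer_const) * A) + ennreal (16 * P\<^sup>2 * 4) * A"
    proof (intro add_mono mult_mono ennreal_leI)
      show "weighted_mass \<psi> \<le> ennreal (64 / fejer_const) * A"
        unfolding \<psi>_def A_def using supp by (intro osc_times_id_weighted m m1) auto
    qed (use sum_edge_len[of "Suc n"] sum_turning[of "Suc n"] in \<open>auto intro!: sum_nonneg turning_nonneg\<close>)
    also have "\<dots> = ennreal (kernel_const P) * A"
      using fejer_const_pos unfolding kernel_const_def
      by (simp add: ennreal_plus distrib_right mult.assoc[symmetric] flip: ennreal_mult)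
    finally show ?thesis using meas by simp
  qed
  have lim: "(\<lambda>n. K n x) \<longlonglongrightarrow> curve_kernel \<psi> x" for x
    unfolding K_def
  proof (rule polygon_kernel_tendsto)
    show "norm (\<psi> a - \<psi> b) \<le> (LINT s|lborel. norm (of_real s * (of_real s * m s))) * \<bar>a - b\<bar>" for a b
      unfolding \<psi>_def by (rule osc_lipschitz[OF m2 m3])
    show "norm (\<psi> a) \<le> (LINT s|lborel. norm (of_real s * m s))" for a
      unfolding \<psi>_def by (rule norm_osc_le[OF m2])
  qed simp
  have "mass (curve_kernel \<psi>) = (\<integral>\<^sup>+x. liminf (\<lambda>n. ennreal (norm (K n x))) \<partial>lborel)"
  proof (intro nn_integral_cong)
    fix x
    have "(\<lambda>n. ennreal (norm (K n x))) \<longlonglongrightarrow> ennreal (norm (curve_kernel \<psi> x))"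
      by (intro tendsto_ennrealI tendsto_norm lim)
    then show "ennreal (norm (curve_kernel \<psi> x)) = liminf (\<lambda>n. ennreal (norm (K n x)))"
      by (rule lim_imp_Liminf[OF trivial_limit_sequentially, symmetric])
  qed
  also have "\<dots> \<le> liminf (\<lambda>n. \<integral>\<^sup>+x. ennreal (norm (K n x)) \<partial>lborel)"
  proof (rule nn_integral_liminf)
    have "K n \<in> borel_measurable borel" for n using Kb by blast
    then show "(\<lambda>x. ennreal (norm (K n x))) \<in> borel_measurable lborel" for n by measurable
  qed
  also have "\<dots> \<le> liminf (\<lambda>n. ennreal (kernel_const P) * A)"
    using Kb by (intro Liminf_mono always_eventually) auto
  also have "\<dots> = ennreal (kernel_const P) * A"
    by (simp add: Liminf_const)
  finally show ?thesis unfolding \<psi>_def A_def .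
qed

end

section \<open>Convolution operators\<close>

text \<open>The notions are stated for the completed measure, whereas the Fubini arguments run over
  products of \<open>lborel\<close>. Each operator is therefore evaluated on a Borel representative
  first.\<close>

lemma lebesgue_borel_representative:
  fixes f :: "'a::euclidean_space \<Rightarrow> complex"
  assumes f: "f \<in> borel_measurable lebesgue"
  obtains f0 where "f0 \<in> borel_measurable borel" "AE x in lborel. f x = f0 x"
proof -
  have "(\<lambda>x. Re (f x)) \<in> borel_measurable lebesgue" "(\<lambda>x. Im (f x)) \<in> borel_measurable lebesgue"
    using f by auto
  then obtain u v where uv: "u \<in> borel_measurable lborel" "AE x in lborel. Re (f x) = u x"
    "v \<in> borel_measurable lborel" "AE x in lborel. Im (f x) = v x"
    by (blast dest: completion_ex_borel_measurable_real)
  show thesis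
  proof
    show "(\<lambda>x. Complex (u x) (v x)) \<in> borel_measurable borel"
      using uv by (simp add: complex_eq_iff borel_measurable_complex_iff)
    show "AE x in lborel. f x = Complex (u x) (v x)"
      using uv(2,4) by eventually_elim (simp add: complex_eq_iff)
  qed
qed

lemma lebesgue_integral_representative:
  fixes f f0 h :: "'a::euclidean_space \<Rightarrow> complex"
  assumes f: "f \<in> borel_measurable lebesgue" and f0[measurable]: "f0 \<in> borel_measurable borel"
    and ae: "AE x in lborel. f x = f0 x" and h[measurable]: "h \<in> borel_measurable borel"
  shows "(LINT x|lebesgue. h x * f x) = (LINT x|lborel. h x * f0 x)"
proof -
  have h': "h \<in> borel_measurable lebesgue" by (rule measurable_completion) simp
  have f0': "f0 \<in> borel_measurable lebesgue" by (rule measurable_completion) simp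
  have "(LINT x|lebesgue. h x * f x) = (LINT x|lebesgue. h x * f0 x)"
  proof (rule integral_cong_AE)
    show "AE x in lebesgue. h x * f x = h x * f0 x"
      using AE_completion[OF ae] by eventually_elim simp
  qed (use f h' f0' in auto)
  also have "\<dots> = (LINT x|lborel. h x * f0 x)"
    by (rule integral_completion) measurable
  finally show ?thesis .
qed

definition convol :: "(real^2 \<Rightarrow> complex) \<Rightarrow> (real^2 \<Rightarrow> complex) \<Rightarrow> real^2 \<Rightarrow> complex" where
  "convol K f x = (LINT y|lebesgue. K (x - y) * f y)"

lemma convol_representative:
  assumes "f \<in> borel_measurable lebesgue" "f0 \<in> borel_measurable borel" "AE x in lborel. f x = f0 x"
    and [measurable]: "K \<in> borel_measurable borel"
  shows "convol K f x = (LINT y|lborel. K (x - y) * f0 y)"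
  unfolding convol_def by (rule lebesgue_integral_representative[OF assms(1-3)]) measurable

lemma nn_integral_representative:
  fixes f f0 :: "'a::euclidean_space \<Rightarrow> complex"
  assumes "AE x in lborel. f x = f0 x"
  shows "(\<integral>\<^sup>+x. F (f x) \<partial>lebesgue) = (\<integral>\<^sup>+x. F (f0 x) \<partial>lborel)"
  unfolding nn_integral_completion using assms by (intro nn_integral_cong_AE) auto

lemma convol_measurable [measurable]:
  assumes "f \<in> borel_measurable lebesgue" and [measurable]: "K \<in> borel_measurable borel"
  shows "convol K f \<in> borel_measurable borel"
proof -
  obtain f0 where f0: "f0 \<in> borel_measurable borel" "AE x in lborel. f x = f0 x"
    using lebesgue_borel_representative[OF assms(1)] by blast
  have [measurable]: "f0 \<in> borel_measurable borel" by (rule f0)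
  show ?thesis
    unfolding convol_representative[OF assms(1) f0 assms(2), abs_def] by measurable
qed

lemma nn_integral_translate:
  fixes F :: "real^2 \<Rightarrow> ennreal"
  assumes [measurable]: "F \<in> borel_measurable borel"
  shows "(\<integral>\<^sup>+x. F (x - y) \<partial>lborel) = (\<integral>\<^sup>+x. F x \<partial>lborel)"
proof -
  have "(\<integral>\<^sup>+x. F x \<partial>lborel) = (\<integral>\<^sup>+x. F x \<partial>distr lborel borel ((+) (- y)))"
    by (subst lborel_distr_plus[symmetric, of "- y"]) simp
  also have "\<dots> = (\<integral>\<^sup>+x. F (- y + x) \<partial>lborel)"
    by (rule nn_integral_distr) measurable
  finally show ?thesis by (simp add: algebra_simps)
qed

lemma nn_integral_convol_kernel:
  fixes k u :: "real^2 \<Rightarrow> ennreal"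
  assumes [measurable]: "k \<in> borel_measurable borel" "u \<in> borel_measurable borel"
  shows "(\<integral>\<^sup>+x. \<integral>\<^sup>+y. k (x - y) * u y \<partial>lborel \<partial>lborel) = (\<integral>\<^sup>+x. k x \<partial>lborel) * (\<integral>\<^sup>+y. u y \<partial>lborel)"
proof -
  have "(\<integral>\<^sup>+x. \<integral>\<^sup>+y. k (x - y) * u y \<partial>lborel \<partial>lborel) = (\<integral>\<^sup>+y. \<integral>\<^sup>+x. k (x - y) * u y \<partial>lborel \<partial>lborel)"
    by (rule lborel_pair.Fubini') measurable
  also have "\<dots> = (\<integral>\<^sup>+y. (\<integral>\<^sup>+x. k x \<partial>lborel) * u y \<partial>lborel)"
    by (simp add: nn_integral_multc nn_integral_translate)
  finally show ?thesis by (simp add: nn_integral_cmult)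
qed

text \<open>Valid at every point: where the defining integral diverges, the convolution has value
  0.\<close>

lemma norm_convol_le:
  assumes "f \<in> borel_measurable lebesgue" "f0 \<in> borel_measurable borel" "AE x in lborel. f x = f0 x"
    and K: "K \<in> borel_measurable borel"
  shows "ennreal (norm (convol K f x)) \<le> (\<integral>\<^sup>+y. ennreal (norm (K (x - y))) * ennreal (norm (f0 y)) \<partial>lborel)"
proof (cases "integrable lborel (\<lambda>y. K (x - y) * f0 y)")
  case True
  from integral_norm_bound_ennreal[OF True] show ?thesis
    unfolding convol_representative[OF assms] by (simp add: norm_mult ennreal_mult)
next
  case False
  then show ?thesis
    unfolding convol_representative[OF assms] by (simp add: not_integrable_integral_eq)
qed

lemma L1_norm_convol:
  assumes f: "f \<in> borel_measurable lebesgue" and K[measurable]: "K \<in> borel_measurable borel"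
  shows "L1_norm (convol K f) \<le> (mass K) * L1_norm f"
proof -
  obtain f0 where f0[measurable]: "f0 \<in> borel_measurable borel" and ae: "AE x in lborel. f x = f0 x"
    using lebesgue_borel_representative[OF f] by blast
  have "L1_norm (convol K f) = (mass (convol K f))"
    by (simp add: L1_norm_def nn_integral_completion)
  also have "\<dots> \<le> (\<integral>\<^sup>+x. \<integral>\<^sup>+y. ennreal (norm (K (x - y))) * ennreal (norm (f0 y)) \<partial>lborel \<partial>lborel)"
    by (intro nn_integral_mono norm_convol_le f f0 ae K)
  also have "\<dots> = (mass K) * (mass f0)"
    by (rule nn_integral_convol_kernel) measurable
  finally show ?thesis
    unfolding L1_norm_def nn_integral_representative[OF ae, of "\<lambda>z. ennreal (norm z)"] .
qed

section \<open>Young's inequality on L^p by a weighted Hoelder inequality\<close>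

lemma nn_integral_weighted_Hoelder:
  fixes k u :: "'a \<Rightarrow> real"
  assumes [measurable]: "k \<in> borel_measurable M" "u \<in> borel_measurable M"
    and k0: "\<And>y. 0 \<le> k y" and u0: "\<And>y. 0 \<le> u y" and p: "1 < p"
    and \<kappa>: "(\<integral>\<^sup>+y. ennreal (k y) \<partial>M) = ennreal \<kappa>" "0 \<le> \<kappa>"
    and S: "(\<integral>\<^sup>+y. ennreal (k y * u y powr p) \<partial>M) = ennreal S" "0 \<le> S"
  shows "(\<integral>\<^sup>+y. ennreal (k y * u y) \<partial>M) \<le> ennreal (\<kappa> powr (1 - 1 / p) * S powr (1 / p))"
proof (cases "\<kappa> = 0 \<or> S = 0")
  case True
  have "AE y in M. k y * u y = 0"
  proof (cases "\<kappa> = 0")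
    case True
    then have "(\<integral>\<^sup>+y. ennreal (k y) \<partial>M) = 0" using \<kappa> by simp
    then have "AE y in M. ennreal (k y) = 0" by (subst (asm) nn_integral_0_iff_AE) auto
    then show ?thesis by eventually_elim (use k0 in \<open>auto simp: ennreal_eq_0_iff intro: antisym\<close>)
  next
    case False
    then have "(\<integral>\<^sup>+y. ennreal (k y * u y powr p) \<partial>M) = 0" using True S by simp
    then have "AE y in M. ennreal (k y * u y powr p) = 0"
      by (subst (asm) nn_integral_0_iff_AE) auto
    then show ?thesis
    proof eventually_elim
      case (elim y)
      then have "k y * u y powr p \<le> 0" by (simp add: ennreal_eq_0_iff)
      moreover have "0 \<le> k y * u y powr p" using k0 by simp
      ultimately show ?case by auto
    qed
  qed
  then have "AE y in M. ennreal (k y * u y) = 0" by eventually_elim auto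
  then have "(\<integral>\<^sup>+y. ennreal (k y * u y) \<partial>M) = 0" by (subst nn_integral_0_iff_AE) auto
  then show ?thesis by simp
next
  case False
  then have pos: "0 < \<kappa>" "0 < S" using \<kappa> S by auto
  \<comment> \<open>The level with \<kappa> r^p = S. Young's inequality for u / r against 1 then
    integrates to r \<kappa> (1/p + 1 - 1/p), which is the Hoelder bound.\<close>
  define r where "r = (S / \<kappa>) powr (1 / p)"
  have l: "0 < r" using pos by (simp add: r_def)
  have lp: "r powr p = S / \<kappa>" using pos p by (simp add: r_def powr_powr)
  let ?A = "r * \<kappa> / (p * S)" and ?B = "r * (1 - 1 / p)"
  have pw: "k y * u y \<le> ?A * (k y * u y powr p) + ?B * k y" for y
  proof -
    have "(u y / r) * 1 \<le> (u y / r) powr p / p + 1 powr (p / (p - 1)) / (p / (p - 1))"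
      using p u0[of y] l by (intro Youngs_inequality) (auto simp: field_simps)
    also have "(u y / r) powr p = u y powr p * \<kappa> / S"
      using u0[of y] l pos by (simp add: powr_divide lp)
    also have "1 powr (p / (p - 1)) / (p / (p - 1)) = 1 - 1 / p"
      using p by (simp add: field_simps)
    finally have "k y * r * (u y / r) \<le> k y * r * (u y powr p * \<kappa> / S / p + (1 - 1 / p))"
      using k0[of y] l by (intro mult_left_mono) auto
    then show ?thesis using l by (simp add: algebra_simps)
  qed
  have "(\<integral>\<^sup>+y. ennreal (k y * u y) \<partial>M)
     \<le> (\<integral>\<^sup>+y. ennreal (?A) * ennreal (k y * u y powr p) + ennreal (?B) * ennreal (k y) \<partial>M)"
  proof (intro nn_integral_mono)
    fix y
    have nn: "0 \<le> ?A" "0 \<le> ?B" "0 \<le> k y * u y powr p"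
      using l pos p k0 by auto
    have "ennreal (k y * u y) \<le> ennreal (?A * (k y * u y powr p) + ?B * k y)"
      by (rule ennreal_leI[OF pw])
    also have "\<dots> = ennreal (?A) * ennreal (k y * u y powr p) + ennreal (?B) * ennreal (k y)"
      unfolding ennreal_plus[OF mult_nonneg_nonneg[OF nn(1,3)] mult_nonneg_nonneg[OF nn(2) k0]]
        ennreal_mult[OF nn(1,3)] ennreal_mult[OF nn(2) k0] ..
    finally show "ennreal (k y * u y) \<le> ennreal (?A) * ennreal (k y * u y powr p) + ennreal (?B) * ennreal (k y)" .
  qed
  also have "\<dots> = ennreal (?A) * ennreal S + ennreal (?B) * ennreal \<kappa>"
    by (subst nn_integral_add, measurable, simp add: nn_integral_cmult S \<kappa>)
  also have "\<dots> = ennreal (r * \<kappa>)"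
    using l pos p by (simp add: field_simps flip: ennreal_mult ennreal_plus)
  also have "r * \<kappa> = \<kappa> powr (1 - 1 / p) * S powr (1 / p)"
    using pos by (simp add: r_def powr_divide powr_diff)
  finally show ?thesis .
qed

text \<open>Hoelder with weight |K(x - y)| bounds |K * f|^p by \<kappa>^(p - 1) times |K| * |f|^p,
  and Tonelli integrates the latter. Finiteness of |K| * |f|^p almost everywhere also yields the
  absolute convergence of the convolution.\<close>

lemma convol_Lp:
  assumes K[measurable]: "K \<in> borel_measurable borel" and Ki: "mass K = ennreal \<kappa>" "0 \<le> \<kappa>"
    and p: "1 < p" and f: "f \<in> Lp_space p"
    and f0[measurable]: "f0 \<in> borel_measurable borel" and ae: "AE x in lborel. f x = f0 x"
  shows "AE x in lborel. integrable lborel (\<lambda>y. K (x - y) * f0 y)"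
    and "convol K f \<in> Lp_space p" and "Lp_norm p (convol K f) \<le> \<kappa> * Lp_norm p f"
proof -
  let ?c = "\<lambda>x. norm (convol K f x) powr p"
  let ?k = "\<lambda>x y. ennreal (norm (K (x - y)))"
  have fm: "f \<in> borel_measurable lebesgue" and fi: "integrable lebesgue (\<lambda>x. norm (f x) powr p)"
    using f by (auto simp: Lp_space_def)
  define I where "I = (LINT x|lebesgue. norm (f x) powr p)"
  have I: "(\<integral>\<^sup>+y. ennreal (norm (f0 y) powr p) \<partial>lborel) = ennreal I"
    using nn_integral_representative[OF ae, of "\<lambda>z. ennreal (norm z powr p)"] nn_integral_eq_integral[OF fi]
    by (simp add: I_def)
  have I0: "0 \<le> I" unfolding I_def by simp
  define S where "S x = (\<integral>\<^sup>+y. ?k x y * ennreal (norm (f0 y) powr p) \<partial>lborel)" for x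
  have [measurable]: "S \<in> borel_measurable borel" unfolding S_def by measurable
  have Sint: "(\<integral>\<^sup>+x. S x \<partial>lborel) = ennreal (\<kappa> * I)"
    unfolding S_def
    using nn_integral_convol_kernel[of "\<lambda>x. ennreal (norm (K x))" "\<lambda>y. ennreal (norm (f0 y) powr p)"] Ki I I0
    by (simp add: ennreal_mult)
  then have Sfin: "AE x in lborel. S x \<noteq> \<infinity>"
    by (intro nn_integral_PInf_AE) auto
  have Kx: "(\<integral>\<^sup>+y. ?k x y \<partial>lborel) = ennreal \<kappa>" for x
  proof -
    have "(\<integral>\<^sup>+y. ?k x y \<partial>lborel) = (\<integral>\<^sup>+y. ennreal (norm (K (- (y - x)))) \<partial>lborel)" by simp
    also have "\<dots> = (\<integral>\<^sup>+y. ennreal (norm (K (- y))) \<partial>lborel)"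
      by (rule nn_integral_translate[of "\<lambda>y. ennreal (norm (K (- y)))"]) measurable
    also have "\<dots> = (\<integral>\<^sup>+y. ennreal (norm (K y)) \<partial>distr lborel borel uminus)"
      by (subst nn_integral_distr) auto
    also have "distr lborel borel uminus = (lborel :: (real^2) measure)"
      using lborel_affine_euclidean[where c = "\<lambda>_. - 1" and t = "0 :: real^2"]
      by (simp add: density_1 scaleR_sum_left[symmetric] sum_negf euclidean_representation)
    also have "mass K = ennreal \<kappa>" by (rule Ki)
    finally show ?thesis .
  qed
  have G: "(\<integral>\<^sup>+y. ennreal (norm (K (x - y)) * norm (f0 y)) \<partial>lborel) \<le> ennreal (\<kappa> powr (1 - 1 / p) * enn2real (S x) powr (1 / p))"
    if "S x \<noteq> \<infinity>" for x
  proof (rule nn_integral_weighted_Hoelder[OF _ _ _ _ p Kx Ki(2)])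
    show "(\<integral>\<^sup>+y. ennreal (norm (K (x - y)) * norm (f0 y) powr p) \<partial>lborel) = ennreal (enn2real (S x))"
      using that by (simp add: S_def ennreal_mult less_top)
  qed auto
  show "AE x in lborel. integrable lborel (\<lambda>y. K (x - y) * f0 y)"
    using Sfin
  proof eventually_elim
    case (elim x)
    show ?case
    proof (rule integrableI_bounded)
      show "(\<integral>\<^sup>+y. ennreal (norm (K (x - y) * f0 y)) \<partial>lborel) < \<infinity>"
        using le_less_trans[OF G[OF elim]] by (simp add: norm_mult)
    qed measurable
  qed
  have pw: "AE x in lborel. ennreal (?c x) \<le> ennreal (\<kappa> powr (p - 1)) * S x"
    using Sfin
  proof eventually_elim
    case (elim x)
    have "ennreal (norm (convol K f x)) \<le> ennreal (\<kappa> powr (1 - 1 / p) * enn2real (S x) powr (1 / p))"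
      using norm_convol_le[OF fm f0 ae K, of x] G[OF elim] by (simp add: ennreal_mult)
    then have "norm (convol K f x) \<le> \<kappa> powr (1 - 1 / p) * enn2real (S x) powr (1 / p)"
      by (simp add: ennreal_le_iff)
    then have "?c x \<le> (\<kappa> powr (1 - 1 / p) * enn2real (S x) powr (1 / p)) powr p"
      using p by (intro powr_mono2) auto
    also have "\<dots> = \<kappa> powr (p - 1) * enn2real (S x)"
      using p by (simp add: powr_mult powr_powr algebra_simps)
    finally have "ennreal (?c x) \<le> ennreal (\<kappa> powr (p - 1)) * ennreal (enn2real (S x))"
      by (simp add: ennreal_leI flip: ennreal_mult)
    then show ?case using elim by (simp add: less_top)
  qed
  have cm: "convol K f \<in> borel_measurable borel" using fm by measurable
  have bound: "(\<integral>\<^sup>+x. ennreal (?c x) \<partial>lebesgue) \<le> ennreal (\<kappa> powr p * I)"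
  proof -
    have "(\<integral>\<^sup>+x. ennreal (?c x) \<partial>lebesgue) \<le> (\<integral>\<^sup>+x. ennreal (\<kappa> powr (p - 1)) * S x \<partial>lborel)"
      unfolding nn_integral_completion by (rule nn_integral_mono_AE[OF pw])
    also have "\<dots> = ennreal (\<kappa> powr (p - 1)) * ennreal (\<kappa> * I)"
      by (subst nn_integral_cmult) (auto simp: Sint)
    also have "\<dots> = ennreal (\<kappa> powr p * I)"
    proof -
      have "\<kappa> powr (p - 1) * \<kappa> = \<kappa> powr p"
        using Ki(2) p by (cases "\<kappa> = 0") (auto simp: powr_diff)
      then have "\<kappa> powr (p - 1) * (\<kappa> * I) = \<kappa> powr p * I" by (simp add: mult.assoc[symmetric])
      then show ?thesis using Ki(2) I0 by (simp flip: ennreal_mult)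
    qed
    finally show ?thesis .
  qed
  have cml: "convol K f \<in> borel_measurable lebesgue" using cm by (intro measurable_completion) simp
  have ci: "integrable lebesgue (\<lambda>x. ?c x)"
  proof (rule integrableI_bounded)
    show "(\<integral>\<^sup>+x. ennreal (norm (?c x)) \<partial>lebesgue) < \<infinity>"
      using le_less_trans[OF bound] by simp
  qed (use cml in measurable)
  then show "convol K f \<in> Lp_space p" using cml by (simp add: Lp_space_def)
  have "ennreal (LINT x|lebesgue. ?c x) \<le> ennreal (\<kappa> powr p * I)"
    using nn_integral_eq_integral[OF ci] bound by simp
  then have "(LINT x|lebesgue. ?c x) \<le> \<kappa> powr p * I"
    using I0 Ki(2) by (subst (asm) ennreal_le_iff) auto
  then have "Lp_norm p (convol K f) \<le> (\<kappa> powr p * I) powr (1 / p)"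
    unfolding Lp_norm_def using p by (intro powr_mono2) auto
  also have "\<dots> = \<kappa> * Lp_norm p f"
    unfolding Lp_norm_def I_def[symmetric] using p Ki(2) I0 by (simp add: powr_mult powr_powr)
  finally show "Lp_norm p (convol K f) \<le> \<kappa> * Lp_norm p f" .
qed

text \<open>Homogeneity holds at every point, but additivity only where both convolution integrals
  converge, hence almost everywhere.\<close>

lemma bounded_operator_convol:
  assumes K[measurable]: "K \<in> borel_measurable borel" and Ki: "mass K < \<infinity>"
    and p: "1 < p"
  shows "bounded_operator_Lp p (convol K)"
proof -
  obtain \<kappa> where \<kappa>: "mass K = ennreal \<kappa>" "0 \<le> \<kappa>"
    using Ki by (cases "\<integral>\<^sup>+x. ennreal (norm (K x)) \<partial>lborel") auto
  have rep: "\<exists>f0. f0 \<in> borel_measurable borel \<and> (AE x in lborel. f x = f0 x)" if "f \<in> Lp_space p" for f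
    using lebesgue_borel_representative[of f] that by (auto simp: Lp_space_def)
  show ?thesis
    unfolding bounded_operator_Lp_def
  proof (intro conjI ballI allI exI)
    fix f assume f: "f \<in> Lp_space p"
    then obtain f0 where f0: "f0 \<in> borel_measurable borel" "AE x in lborel. f x = f0 x" using rep by blast
    show "convol K f \<in> Lp_space p" "Lp_norm p (convol K f) \<le> \<kappa> * Lp_norm p f"
      using convol_Lp[OF K \<kappa> p f f0] by auto
    show "AE x in lebesgue. convol K (\<lambda>y. c * f y) x = c * convol K f x" for c
      by (simp add: convol_def mult.left_commute)
  next
    fix f g assume f: "f \<in> Lp_space p" and g: "g \<in> Lp_space p"
    then obtain f0 g0 where f0: "f0 \<in> borel_measurable borel" "AE x in lborel. f x = f0 x"
      and g0: "g0 \<in> borel_measurable borel" "AE x in lborel. g x = g0 x" using rep by meson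
    have fm: "f \<in> borel_measurable lebesgue" "g \<in> borel_measurable lebesgue" using f g by (auto simp: Lp_space_def)
    have s0: "AE x in lborel. f x + g x = f0 x + g0 x" using f0(2) g0(2) by eventually_elim simp
    have "AE x in lborel. convol K (\<lambda>y. f y + g y) x = convol K f x + convol K g x"
      using convol_Lp(1)[OF K \<kappa> p f f0] convol_Lp(1)[OF K \<kappa> p g g0]
    proof eventually_elim
      case (elim x)
      have "convol K (\<lambda>y. f y + g y) x = (LINT y|lborel. K (x - y) * (f0 y + g0 y))"
        by (rule convol_representative) (use fm f0 g0 s0 in auto)
      also have "\<dots> = convol K f x + convol K g x"
        unfolding convol_representative[OF fm(1) f0 K] convol_representative[OF fm(2) g0 K] distrib_left
        by (rule Bochner_Integration.integral_add[OF elim])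
      finally show ?case .
    qed
    then show "AE x in lebesgue. convol K (\<lambda>y. f y + g y) x = convol K f x + convol K g x"
      by (rule AE_completion)
  qed
qed

section \<open>The Hardy norm\<close>

lemma nn_integral_gauss_kernel: "(\<integral>\<^sup>+x. ennreal (gauss_kernel 1 x) \<partial>lborel) = 1"
proof -
  have one: "(\<integral>\<^sup>+b. ennreal (std_normal_density b) \<partial>lborel) = 1"
    by (subst nn_integral_eq_integral) auto
  have "gauss_kernel 1 (pt a b) = std_normal_density a * std_normal_density b" for a b
  proof -
    have "(norm (pt a b))\<^sup>2 = a\<^sup>2 + b\<^sup>2"
      unfolding power2_norm_eq_inner inner_pt by (simp add: power2_eq_square)
    moreover have "exp (- (a\<^sup>2 + b\<^sup>2) / 2) = exp (- a\<^sup>2 / 2) * exp (- b\<^sup>2 / 2)"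
      by (simp add: field_simps flip: exp_add)
    moreover have "1 / sqrt (2 * pi) * (1 / sqrt (2 * pi)) = 1 / (2 * pi)"
      by (simp flip: real_sqrt_mult)
    ultimately show ?thesis
      by (simp add: gauss_kernel_def std_normal_density_def)
  qed
  moreover have [measurable]: "gauss_kernel 1 \<in> borel_measurable borel"
    unfolding gauss_kernel_def by measurable
  ultimately have "(\<integral>\<^sup>+x. ennreal (gauss_kernel 1 x) \<partial>lborel)
     = (\<integral>\<^sup>+a. \<integral>\<^sup>+b. ennreal (std_normal_density a) * ennreal (std_normal_density b) \<partial>lborel \<partial>lborel)"
    by (subst nn_integral_real2) (auto simp: ennreal_mult)
  also have "\<dots> = 1"
    by (simp add: nn_integral_cmult one)
  finally show ?thesis .
qed

lemma gauss_kernel_measurable [measurable]: "gauss_kernel t \<in> borel_measurable borel"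
  unfolding gauss_kernel_def by measurable

lemma gauss_kernel_nonneg: "0 \<le> gauss_kernel t x"
  by (simp add: gauss_kernel_def)

lemma integrable_gauss_kernel: "integrable lborel (gauss_kernel 1)"
  by (rule integrableI_bounded) (auto simp: gauss_kernel_nonneg nn_integral_gauss_kernel)

lemma integral_gauss_kernel: "(LINT x|lborel. gauss_kernel 1 x) = 1"
  using nn_integral_eq_integral[OF integrable_gauss_kernel] gauss_kernel_nonneg nn_integral_gauss_kernel
  by simp

lemma gauss_kernel_scale:
  assumes "0 < t"
  shows "gauss_kernel t (t *\<^sub>R v) = gauss_kernel 1 v / t\<^sup>2"
proof -
  have "(norm (t *\<^sub>R v))\<^sup>2 / (2 * t\<^sup>2) = (norm v)\<^sup>2 / 2"
    using assms by (simp add: power_mult_distrib)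
  then show ?thesis by (simp add: gauss_kernel_def field_simps)
qed

lemma lborel_scale_plane:
  assumes "t \<noteq> 0"
  shows "(lborel :: (real^2) measure) = density (distr lborel borel ((*\<^sub>R) t)) (\<lambda>_. ennreal (t\<^sup>2))"
  using lborel_affine[OF assms, of "0 :: real^2"] by simp

lemma nn_integral_scale_plane:
  fixes F :: "real^2 \<Rightarrow> ennreal"
  assumes t: "t \<noteq> 0" and [measurable]: "F \<in> borel_measurable borel"
  shows "(\<integral>\<^sup>+x. F x \<partial>lborel) = ennreal (t\<^sup>2) * (\<integral>\<^sup>+v. F (t *\<^sub>R v) \<partial>lborel)"
  by (subst lborel_scale_plane[OF t]) (simp add: nn_integral_density nn_integral_distr nn_integral_cmult)

lemma integral_scale_plane:
  fixes F :: "real^2 \<Rightarrow> complex"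
  assumes t: "0 < t" and [measurable]: "F \<in> borel_measurable borel"
  shows "(LINT x|lborel. F x) = t\<^sup>2 *\<^sub>R (LINT v|lborel. F (t *\<^sub>R v))"
  using t by (subst lborel_scale_plane[of t]) (simp_all add: integral_density integral_distr)

lemma integral_translate_plane:
  fixes F :: "real^2 \<Rightarrow> complex"
  assumes [measurable]: "F \<in> borel_measurable borel"
  shows "(LINT x|lborel. F x) = (LINT v|lborel. F (c + v))"
  by (subst lborel_distr_plus[symmetric, of c], subst integral_distr) auto

text \<open>Rescaling the integration variable by t moves the dilation from the Gaussian into the
  argument of K; continuity and boundedness of K then allow dominated convergence at every
  point.\<close>

lemma gauss_convol_tendsto:
  fixes K :: "real^2 \<Rightarrow> complex"
  assumes K: "continuous_on UNIV K" and bd: "\<And>z. norm (K z) \<le> B"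
  shows "(\<lambda>n. convol K (\<lambda>y. of_real (gauss_kernel (1 / real (Suc n)) y)) x) \<longlonglongrightarrow> K x"
proof -
  have [measurable]: "K \<in> borel_measurable borel" using K by (rule borel_measurable_continuous_onI)
  have eq: "convol K (\<lambda>y. of_real (gauss_kernel t y)) x = (LINT v|lborel. K (x - t *\<^sub>R v) * of_real (gauss_kernel 1 v))"
    if t: "0 < t" for t
  proof -
    have "convol K (\<lambda>y. of_real (gauss_kernel t y)) x = (LINT y|lborel. K (x - y) * of_real (gauss_kernel t y))"
      by (rule convol_representative) (auto intro!: measurable_completion)
    also have "\<dots> = t\<^sup>2 *\<^sub>R (LINT v|lborel. K (x - t *\<^sub>R v) * of_real (gauss_kernel t (t *\<^sub>R v)))"
      by (rule integral_scale_plane[OF t]) measurable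
    also have "\<dots> = (LINT v|lborel. t\<^sup>2 *\<^sub>R (K (x - t *\<^sub>R v) * of_real (gauss_kernel t (t *\<^sub>R v))))"
      by (rule integral_scaleR_right[symmetric])
    also have "\<dots> = (LINT v|lborel. K (x - t *\<^sub>R v) * of_real (gauss_kernel 1 v))"
      using t by (intro Bochner_Integration.integral_cong) (auto simp: gauss_kernel_scale scaleR_conv_of_real[where 'a = complex])
    finally show ?thesis .
  qed
  have "(\<lambda>n. LINT v|lborel. K (x - (1 / real (Suc n)) *\<^sub>R v) * of_real (gauss_kernel 1 v))
      \<longlonglongrightarrow> (LINT v|lborel. K x * of_real (gauss_kernel 1 v))"
  proof (rule integral_dominated_convergence)
    show "integrable lborel (\<lambda>v. B * gauss_kernel 1 v)"
      by (intro integrable_mult_right integrable_gauss_kernel)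
    show "AE v in lborel. (\<lambda>n. K (x - (1 / real (Suc n)) *\<^sub>R v) * of_real (gauss_kernel 1 v)) \<longlonglongrightarrow> K x * of_real (gauss_kernel 1 v)"
    proof (intro AE_I2 tendsto_intros)
      fix v :: "real^2"
      have "(\<lambda>n. 1 / real (Suc n)) \<longlonglongrightarrow> 0"
        using LIMSEQ_Suc[OF lim_const_over_n[of "1::real"]] by simp
      then have "(\<lambda>n. x - (1 / real (Suc n)) *\<^sub>R v) \<longlonglongrightarrow> x - 0 *\<^sub>R v" by (intro tendsto_intros)
      then have "(\<lambda>n. x - (1 / real (Suc n)) *\<^sub>R v) \<longlonglongrightarrow> x" by simp
      then show "(\<lambda>n. K (x - (1 / real (Suc n)) *\<^sub>R v)) \<longlonglongrightarrow> K x"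
        using K by (intro continuous_on_tendsto_compose[OF K]) auto
    qed
    show "AE v in lborel. norm (K (x - (1 / real (Suc n)) *\<^sub>R v) * of_real (gauss_kernel 1 v)) \<le> B * gauss_kernel 1 v" for n
      using bd gauss_kernel_nonneg by (intro AE_I2) (auto simp: norm_mult intro!: mult_right_mono)
  qed measurable
  also have "(LINT v|lborel. K x * of_real (gauss_kernel 1 v)) = K x"
    by (simp add: integral_gauss_kernel)
  finally show ?thesis by (simp add: eq)
qed

text \<open>Boundedness of K makes the double integrand absolutely integrable for each x, with G and
  f in L^1. The identity thus holds everywhere and not merely almost everywhere.\<close>

lemma convol_assoc:
  fixes K G f :: "real^2 \<Rightarrow> complex"
  assumes K[measurable]: "K \<in> borel_measurable borel" and bd: "\<And>z. norm (K z) \<le> B"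
    and G: "integrable lborel G" and f: "integrable lebesgue f"
  shows "convol K (convol G f) x = convol (convol K G) f x"
proof -
  have fm: "f \<in> borel_measurable lebesgue" using f by auto
  have [measurable]: "G \<in> borel_measurable borel" using G by auto
  have Gl: "G \<in> borel_measurable lebesgue" by (rule measurable_completion) simp
  obtain f0 where f0[measurable]: "f0 \<in> borel_measurable borel" and ae: "AE x in lborel. f x = f0 x"
    using lebesgue_borel_representative[OF fm] by blast
  have f0fin: "mass f0 < \<infinity>"
    using f nn_integral_representative[OF ae, of "\<lambda>z. ennreal (norm z)"] by (simp add: integrable_iff_bounded)
  have KG[measurable]: "convol K G \<in> borel_measurable borel" using Gl by measurable
  have Gf: "convol G f \<in> borel_measurable borel" using fm by measurable
  define h where "h = (\<lambda>(y, z). K (x - y) * (G (y - z) * f0 z))"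
  have [measurable]: "h \<in> borel_measurable (lborel \<Otimes>\<^sub>M lborel)" unfolding h_def by measurable
  have B0: "0 \<le> B" using bd[of 0] norm_ge_zero order_trans by blast
  have hi: "integrable (lborel \<Otimes>\<^sub>M lborel) h"
  proof (rule integrableI_bounded)
    have "(\<integral>\<^sup>+z. ennreal (norm (h z)) \<partial>(lborel \<Otimes>\<^sub>M lborel)) = (\<integral>\<^sup>+y. \<integral>\<^sup>+z. ennreal (norm (h (y, z))) \<partial>lborel \<partial>lborel)"
      by (rule lborel.nn_integral_fst[symmetric]) measurable
    also have "\<dots> \<le> (\<integral>\<^sup>+y. \<integral>\<^sup>+z. ennreal B * (ennreal (norm (G (y - z))) * ennreal (norm (f0 z))) \<partial>lborel \<partial>lborel)"
      using bd B0 by (intro nn_integral_mono) (auto simp: h_def norm_mult intro!: ennreal_leI mult_right_mono simp flip: ennreal_mult)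
    also have "\<dots> = ennreal B * (\<integral>\<^sup>+y. \<integral>\<^sup>+z. ennreal (norm (G (y - z))) * ennreal (norm (f0 z)) \<partial>lborel \<partial>lborel)"
      by (simp add: nn_integral_cmult)
    also have "(\<integral>\<^sup>+y. \<integral>\<^sup>+z. ennreal (norm (G (y - z))) * ennreal (norm (f0 z)) \<partial>lborel \<partial>lborel)
        = (mass G) * (mass f0)"
      by (rule nn_integral_convol_kernel[of "\<lambda>y. ennreal (norm (G y))"]) measurable
    also have "ennreal B * \<dots> < \<infinity>"
      using G f0fin by (auto simp: integrable_iff_bounded ennreal_mult_less_top)
    finally show "(\<integral>\<^sup>+z. ennreal (norm (h z)) \<partial>(lborel \<Otimes>\<^sub>M lborel)) < \<infinity>" .
  qed simp
  have "convol K (convol G f) x = (LINT y|lborel. K (x - y) * convol G f y)"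
    by (rule convol_representative) (use Gf in \<open>auto intro!: measurable_completion\<close>)
  also have "\<dots> = (LINT y|lborel. LINT z|lborel. h (y, z))"
    unfolding convol_representative[OF fm f0 ae \<open>G \<in> borel_measurable borel\<close>] h_def by simp
  also have "\<dots> = (LINT z|lborel. LINT y|lborel. h (y, z))"
    using lborel_pair.Fubini_integral[of "\<lambda>y z. h (y, z)"] hi by simp
  also have "\<dots> = (LINT z|lborel. convol K G (x - z) * f0 z)"
  proof (intro Bochner_Integration.integral_cong refl)
    fix z
    have "(LINT y|lborel. h (y, z)) = (LINT u|lborel. h (z + u, z))"
      by (rule integral_translate_plane) (simp add: h_def)
    also have "\<dots> = (LINT u|lborel. (K (x - z - u) * G u) * f0 z)"
      by (simp add: h_def diff_diff_eq mult.assoc)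
    also have "\<dots> = (LINT u|lborel. K (x - z - u) * G u) * f0 z"
      by (rule integral_mult_left_zero)
    also have "(LINT u|lborel. K (x - z - u) * G u) = convol K G (x - z)"
      by (rule convol_representative[symmetric]) (use Gl in auto)
    finally show "(LINT y|lborel. h (y, z)) = convol K G (x - z) * f0 z" .
  qed
  also have "\<dots> = convol (convol K G) f x"
    by (rule convol_representative[symmetric, OF fm f0 ae KG])
  finally show ?thesis .
qed

lemma convol_kernel_tendsto:
  fixes A :: "nat \<Rightarrow> real^2 \<Rightarrow> complex"
  assumes A[measurable]: "\<And>n. A n \<in> borel_measurable borel" and K[measurable]: "K \<in> borel_measurable borel"
    and bd: "\<And>n z. norm (A n z) \<le> B" and lim: "\<And>z. (\<lambda>n. A n z) \<longlonglongrightarrow> K z" and f: "integrable lebesgue f"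
  shows "(\<lambda>n. convol (A n) f x) \<longlonglongrightarrow> convol K f x"
proof -
  have fm[measurable]: "f \<in> borel_measurable lebesgue" using f by auto
  have m: "(\<lambda>y. k (x - y)) \<in> borel_measurable lebesgue" if "k \<in> borel_measurable borel" for k :: "real^2 \<Rightarrow> complex"
    by (rule measurable_completion) (use that in measurable)
  show ?thesis
    unfolding convol_def
  proof (rule integral_dominated_convergence)
    show "integrable lebesgue (\<lambda>y. B * norm (f y))"
      by (intro integrable_mult_right integrable_norm f)
    show "AE y in lebesgue. (\<lambda>n. A n (x - y) * f y) \<longlonglongrightarrow> K (x - y) * f y"
      by (intro AE_I2 tendsto_intros lim)
    show "AE y in lebesgue. norm (A n (x - y) * f y) \<le> B * norm (f y)" for n
      using bd by (intro AE_I2) (auto simp: norm_mult intro!: mult_right_mono)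
  qed (use m[OF A] m[OF K] fm in measurable)
qed

lemma L1_norm_gauss_convol:
  assumes "0 < t"
  shows "L1_norm (convol (\<lambda>y. of_real (gauss_kernel t y)) f) \<le> H1_norm f"
  unfolding L1_norm_def H1_norm_def hardy_maximal_def convol_def
  using assms by (intro nn_integral_mono SUP_upper) auto

lemma norm_convol_bounded:
  fixes K G :: "real^2 \<Rightarrow> complex"
  assumes K[measurable]: "K \<in> borel_measurable borel" and bd: "\<And>z. norm (K z) \<le> B"
    and G[measurable]: "G \<in> borel_measurable borel" and G1: "mass G \<le> 1"
  shows "norm (convol K G x) \<le> B"
proof -
  have B0: "0 \<le> B" using bd[of 0] norm_ge_zero order_trans by blast
  have "ennreal (norm (convol K G x)) \<le> (\<integral>\<^sup>+y. ennreal (norm (K (x - y))) * ennreal (norm (G y)) \<partial>lborel)"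
    by (rule norm_convol_le) (auto intro!: measurable_completion)
  also have "\<dots> \<le> (\<integral>\<^sup>+y. ennreal B * ennreal (norm (G y)) \<partial>lborel)"
    using bd by (intro nn_integral_mono mult_right_mono ennreal_leI) auto
  also have "\<dots> = ennreal B * (mass G)"
    by (rule nn_integral_cmult) measurable
  also have "\<dots> \<le> ennreal B * 1" by (intro mult_left_mono G1) auto
  finally show ?thesis using B0 by simp
qed

lemma nn_integral_gauss_kernel_scaled:
  assumes t: "0 < t"
  shows "(\<integral>\<^sup>+y. ennreal (gauss_kernel t y) \<partial>lborel) = 1"
proof -
  have "(\<integral>\<^sup>+y. ennreal (gauss_kernel t y) \<partial>lborel)
     = ennreal (t\<^sup>2) * (\<integral>\<^sup>+v. ennreal (gauss_kernel t (t *\<^sub>R v)) \<partial>lborel)"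
    using t by (intro nn_integral_scale_plane) auto
  also have "\<dots> = (\<integral>\<^sup>+v. ennreal (t\<^sup>2) * ennreal (gauss_kernel 1 v / t\<^sup>2) \<partial>lborel)"
    unfolding gauss_kernel_scale[OF t] by (rule nn_integral_cmult[symmetric]) measurable
  also have "\<dots> = (\<integral>\<^sup>+v. ennreal (gauss_kernel 1 v) \<partial>lborel)"
    using t by (intro nn_integral_cong) (simp add: gauss_kernel_nonneg flip: ennreal_mult)
  finally show ?thesis by (simp add: nn_integral_gauss_kernel)
qed

text \<open>\<open>K * f\<close> is the limit of \<open>K * (f * \<Phi>\<^sub>t)\<close>, and the \<open>L\<^sup>1\<close> norm of \<open>f * \<Phi>\<^sub>t\<close> is bounded by the Hardy norm. This
  avoids the pointwise bound of \<open>f\<close> by its maximal function.\<close>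

lemma L1_norm_convol_le_H1_norm:
  assumes K: "continuous_on UNIV K" and bd: "\<And>z. norm (K z) \<le> B" and f: "integrable lebesgue f"
  shows "L1_norm (convol K f) \<le> (mass K) * H1_norm f"
proof -
  have Km[measurable]: "K \<in> borel_measurable borel" using K by (rule borel_measurable_continuous_onI)
  have fm: "f \<in> borel_measurable lebesgue" using f by auto
  define \<Phi> where "\<Phi> n = (\<lambda>y::real^2. complex_of_real (gauss_kernel (1 / real (Suc n)) y))" for n
  have \<Phi>m[measurable]: "\<Phi> n \<in> borel_measurable borel" for n unfolding \<Phi>_def by measurable
  have \<Phi>l: "\<Phi> n \<in> borel_measurable lebesgue" for n by (rule measurable_completion) simp
  have \<Phi>1: "mass (\<Phi> n) = 1" for n
    using nn_integral_gauss_kernel_scaled[of "1 / real (Suc n)"] by (simp add: \<Phi>_def gauss_kernel_nonneg)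
  have \<Phi>i: "integrable lborel (\<Phi> n)" for n
    by (rule integrableI_bounded) (auto simp: \<Phi>1)
  have lim: "(\<lambda>n. convol K (convol (\<Phi> n) f) x) \<longlonglongrightarrow> convol K f x" for x
    unfolding convol_assoc[OF Km bd \<Phi>i f]
  proof (rule convol_kernel_tendsto[OF _ Km _ _ f])
    show "convol K (\<Phi> n) \<in> borel_measurable borel" for n using \<Phi>l by measurable
    show "norm (convol K (\<Phi> n) z) \<le> B" for n z by (rule norm_convol_bounded[OF Km bd \<Phi>m]) (simp add: \<Phi>1)
    show "(\<lambda>n. convol K (\<Phi> n) z) \<longlonglongrightarrow> K z" for z
      unfolding \<Phi>_def by (rule gauss_convol_tendsto[OF K bd])
  qed
  have m: "convol (\<Phi> n) f \<in> borel_measurable lebesgue" for n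
    using convol_measurable[OF fm \<Phi>m] by (intro measurable_completion) simp
  have "L1_norm (convol K f) = (\<integral>\<^sup>+x. liminf (\<lambda>n. ennreal (norm (convol K (convol (\<Phi> n) f) x))) \<partial>lebesgue)"
    unfolding L1_norm_def
  proof (intro nn_integral_cong)
    fix x
    have "(\<lambda>n. ennreal (norm (convol K (convol (\<Phi> n) f) x))) \<longlonglongrightarrow> ennreal (norm (convol K f x))"
      by (intro tendsto_ennrealI tendsto_norm lim)
    then show "ennreal (norm (convol K f x)) = liminf (\<lambda>n. ennreal (norm (convol K (convol (\<Phi> n) f) x)))"
      by (rule lim_imp_Liminf[OF trivial_limit_sequentially, symmetric])
  qed
  also have "\<dots> \<le> liminf (\<lambda>n. L1_norm (convol K (convol (\<Phi> n) f)))"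
    unfolding L1_norm_def nn_integral_completion
  proof (rule nn_integral_liminf)
    fix n
    have "convol K (convol (\<Phi> n) f) \<in> borel_measurable lborel"
      using convol_measurable[OF m Km] by simp
    then show "(\<lambda>x. ennreal (norm (convol K (convol (\<Phi> n) f) x))) \<in> borel_measurable lborel"
      by (rule measurable_compose) measurable
  qed
  also have "\<dots> \<le> liminf (\<lambda>n. (mass K) * H1_norm f)"
  proof (intro Liminf_mono always_eventually allI)
    fix n
    have "L1_norm (convol K (convol (\<Phi> n) f)) \<le> (mass K) * L1_norm (convol (\<Phi> n) f)"
      by (rule L1_norm_convol[OF m Km])
    also have "\<dots> \<le> (mass K) * H1_norm f"
      unfolding \<Phi>_def by (intro mult_left_mono L1_norm_gauss_convol) auto
    finally show "L1_norm (convol K (convol (\<Phi> n) f)) \<le> (mass K) * H1_norm f" .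
  qed
  finally show ?thesis by (simp add: Liminf_const)
qed

section \<open>Fourier multipliers as convolutions\<close>

lemma inverse_fourier_multiplier:
  fixes g f :: "real^2 \<Rightarrow> complex"
  assumes g: "integrable lborel g" and f: "integrable lebesgue f"
  shows "inverse_fourier (\<lambda>\<xi>. g \<xi> * fourier f \<xi>) x = convol (inverse_fourier g) f x"
proof -
  have fm: "f \<in> borel_measurable lebesgue" using f by auto
  have [measurable]: "g \<in> borel_measurable borel" using g by auto
  obtain f0 where f0[measurable]: "f0 \<in> borel_measurable borel" and ae: "AE x in lborel. f x = f0 x"
    using lebesgue_borel_representative[OF fm] by blast
  have f0i: "integrable lborel f0"
    using f nn_integral_representative[OF ae, of "\<lambda>z. ennreal (norm z)"] by (simp add: integrable_iff_bounded)
  have F: "fourier f \<xi> = (LINT y|lborel. cis (- (y \<bullet> \<xi>)) * f0 y)" for \<xi>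
    unfolding fourier_def by (rule lebesgue_integral_representative[OF fm f0 ae]) (simp add: borel_measurable_cis)
  have ig: "inverse_fourier g z = of_real (1 / (2 * pi) ^ DIM(real^2)) * (LINT \<xi>|lborel. cis (z \<bullet> \<xi>) * g \<xi>)" for z
    unfolding inverse_fourier_def by (subst integral_completion) auto
  \<comment> \<open>The phases of the two transforms combine to one in x - y. Integrability of both
    g and f justifies Fubini for every x.\<close>
  define h where "h = (\<lambda>(\<xi>, y). cis ((x - y) \<bullet> \<xi>) * g \<xi> * f0 y)"
  have [measurable]: "h \<in> borel_measurable (lborel \<Otimes>\<^sub>M lborel)" unfolding h_def by measurable
  have hi: "integrable (lborel \<Otimes>\<^sub>M lborel) h"
  proof (rule Bochner_Integration.integrable_bound)
    show "integrable (lborel \<Otimes>\<^sub>M lborel) (\<lambda>(\<xi>, y). norm (g \<xi>) * norm (f0 y))"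
      using g f0i by (intro lborel_pair.Fubini_integrable) (auto simp: abs_mult intro!: integrable_mult_left)
    show "AE z in lborel \<Otimes>\<^sub>M lborel. norm (h z) \<le> norm (case z of (\<xi>, y) \<Rightarrow> norm (g \<xi>) * norm (f0 y))"
      by (intro AE_I2) (auto simp: h_def norm_mult abs_mult split_beta')
  qed simp
  have "(LINT \<xi>|lebesgue. cis (x \<bullet> \<xi>) * (g \<xi> * fourier f \<xi>)) = (LINT \<xi>|lborel. cis (x \<bullet> \<xi>) * (g \<xi> * fourier f \<xi>))"
    unfolding F by (rule integral_completion) measurable
  also have "\<dots> = (LINT \<xi>|lborel. LINT y|lborel. h (\<xi>, y))"
  proof (intro Bochner_Integration.integral_cong refl)
    fix \<xi>
    have "cis (x \<bullet> \<xi>) * (g \<xi> * fourier f \<xi>) = (LINT y|lborel. cis (x \<bullet> \<xi>) * (g \<xi> * (cis (- (y \<bullet> \<xi>)) * f0 y)))"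
      unfolding F by (simp only: integral_mult_right_zero)
    also have "\<dots> = (LINT y|lborel. h (\<xi>, y))"
    proof (intro Bochner_Integration.integral_cong refl)
      fix y
      have "cis ((x - y) \<bullet> \<xi>) = cis (x \<bullet> \<xi>) * cis (- (y \<bullet> \<xi>))"
        by (simp add: cis_mult inner_diff_left)
      then show "cis (x \<bullet> \<xi>) * (g \<xi> * (cis (- (y \<bullet> \<xi>)) * f0 y)) = h (\<xi>, y)"
        by (simp add: h_def)
    qed
    finally show "cis (x \<bullet> \<xi>) * (g \<xi> * fourier f \<xi>) = (LINT y|lborel. h (\<xi>, y))" .
  qed
  also have "\<dots> = (LINT y|lborel. LINT \<xi>|lborel. h (\<xi>, y))"
    using lborel_pair.Fubini_integral[of "\<lambda>\<xi> y. h (\<xi>, y)"] hi by simp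
  also have "\<dots> = (LINT y|lborel. (LINT \<xi>|lborel. cis ((x - y) \<bullet> \<xi>) * g \<xi>) * f0 y)"
    by (simp add: h_def)
  finally have "inverse_fourier (\<lambda>\<xi>. g \<xi> * fourier f \<xi>) x
      = (LINT y|lborel. of_real (1 / (2 * pi) ^ DIM(real^2)) * ((LINT \<xi>|lborel. cis ((x - y) \<bullet> \<xi>) * g \<xi>) * f0 y))"
    unfolding inverse_fourier_def integral_mult_right_zero by simp
  also have "\<dots> = (LINT y|lborel. inverse_fourier g (x - y) * f0 y)"
    by (simp add: ig mult.assoc)
  also have "\<dots> = convol (inverse_fourier g) f x"
    by (rule convol_representative[symmetric, OF fm f0 ae]) (unfold ig, measurable)
  finally show ?thesis .
qed

lemma inverse_fourier_bounded_continuous: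
  fixes g :: "real^2 \<Rightarrow> complex"
  assumes g: "integrable lborel g"
  shows "continuous_on UNIV (inverse_fourier g)"
    and "norm (inverse_fourier g z) \<le> (1 / (2 * pi) ^ DIM(real^2)) * (LINT \<xi>|lborel. norm (g \<xi>))"
proof -
  have [measurable]: "g \<in> borel_measurable borel" using g by auto
  have ig: "inverse_fourier g z = of_real (1 / (2 * pi) ^ DIM(real^2)) * (LINT \<xi>|lborel. cis (z \<bullet> \<xi>) * g \<xi>)" for z
    unfolding inverse_fourier_def by (subst integral_completion) auto
  have "continuous_on UNIV (\<lambda>z. LINT \<xi>|lborel. cis (z \<bullet> \<xi>) * g \<xi>)"
  proof (rule continuous_on_sequentiallyI)
    fix u :: "nat \<Rightarrow> real^2" and a assume u: "u \<longlonglongrightarrow> a"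
    show "(\<lambda>n. LINT \<xi>|lborel. cis (u n \<bullet> \<xi>) * g \<xi>) \<longlonglongrightarrow> (LINT \<xi>|lborel. cis (a \<bullet> \<xi>) * g \<xi>)"
    proof (rule integral_dominated_convergence)
      show "integrable lborel (\<lambda>\<xi>. norm (g \<xi>))" using g by (rule integrable_norm)
      show "AE \<xi> in lborel. (\<lambda>n. cis (u n \<bullet> \<xi>) * g \<xi>) \<longlonglongrightarrow> cis (a \<bullet> \<xi>) * g \<xi>"
        by (intro AE_I2 tendsto_mult tendsto_const continuous_on_tendsto_compose[of UNIV cis] tendsto_inner u)
           (auto intro!: continuous_intros)
    qed (auto simp: norm_mult)
  qed
  then show "continuous_on UNIV (inverse_fourier g)"
    unfolding ig[abs_def] by (intro continuous_intros)
  have "norm (LINT \<xi>|lborel. cis (z \<bullet> \<xi>) * g \<xi>) \<le> (LINT \<xi>|lborel. norm (g \<xi>))"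
    using integral_norm_bound[of lborel "\<lambda>\<xi>. cis (z \<bullet> \<xi>) * g \<xi>"] by (simp add: norm_mult)
  then have "(1 / (2 * pi) ^ DIM(real^2)) * norm (LINT \<xi>|lborel. cis (z \<bullet> \<xi>) * g \<xi>)
      \<le> (1 / (2 * pi) ^ DIM(real^2)) * (LINT \<xi>|lborel. norm (g \<xi>))"
    by (intro mult_left_mono) auto
  then show "norm (inverse_fourier g z) \<le> (1 / (2 * pi) ^ DIM(real^2)) * (LINT \<xi>|lborel. norm (g \<xi>))"
    unfolding ig by (simp add: norm_mult norm_divide norm_power)
qed

lemma inverse_fourier_cong_AE:
  assumes g: "g \<in> borel_measurable lebesgue" and ae: "AE \<xi> in lborel. g \<xi> = h \<xi>"
  shows "inverse_fourier g x = inverse_fourier (h :: real^2 \<Rightarrow> complex) x"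
proof -
  have h: "h \<in> borel_measurable lebesgue"
    by (rule borel_measurable_AE[OF g AE_completion[OF ae]])
  have c: "(\<lambda>\<xi>. cis (x \<bullet> \<xi>)) \<in> borel_measurable lebesgue"
    by (rule measurable_completion) (simp add: borel_measurable_cis)
  have "(LINT \<xi>|lebesgue. cis (x \<bullet> \<xi>) * g \<xi>) = (LINT \<xi>|lebesgue. cis (x \<bullet> \<xi>) * h \<xi>)"
  proof (rule integral_cong_AE)
    show "AE \<xi> in lebesgue. cis (x \<bullet> \<xi>) * g \<xi> = cis (x \<bullet> \<xi>) * h \<xi>"
      using AE_completion[OF ae] by eventually_elim simp
  qed (use g h c in auto)
  then show ?thesis by (simp add: inverse_fourier_def)
qed

lemma schwartz_integrable:
  assumes "schwartz f"
  shows "integrable lebesgue f"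
proof -
  have d: "f differentiable (at x)" for x
    using assms unfolding schwartz_def by (metis partial_derivs.simps(1))
  have "continuous_on UNIV f"
    by (intro continuous_at_imp_continuous_on ballI differentiable_imp_continuous_within d)
  then have [measurable]: "f \<in> borel_measurable borel" by (rule borel_measurable_continuous_onI)
  \<comment> \<open>Order 4 leaves decay of order 2 in each coordinate separately, which is
    integrable on the line.\<close>
  have "bounded (range (\<lambda>x. (1 + norm x) ^ 4 * norm (f x)))"
    using assms unfolding schwartz_def by (metis partial_derivs.simps(1))
  then obtain C where C: "\<And>x. norm ((1 + norm x) ^ 4 * norm (f x)) \<le> C"
    by (auto simp: bounded_iff)
  have C0: "0 \<le> C" using C[of 0] norm_ge_zero order_trans by blast
  have "norm (f (pt a b)) \<le> C * ((1 + \<bar>a\<bar>) powr (-2) * (1 + \<bar>b\<bar>) powr (-2))" for a b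
  proof -
    have n: "\<bar>a\<bar> \<le> norm (pt a b)" "\<bar>b\<bar> \<le> norm (pt a b)"
      using component_le_norm_cart[of "pt a b" 1] component_le_norm_cart[of "pt a b" 2] by simp_all
    have "(1 + \<bar>a\<bar>)\<^sup>2 * (1 + \<bar>b\<bar>)\<^sup>2 \<le> (1 + norm (pt a b))\<^sup>2 * (1 + norm (pt a b))\<^sup>2"
      using n by (intro mult_mono power_mono) auto
    also have "\<dots> = (1 + norm (pt a b)) ^ 4" by (simp flip: power_add)
    finally have "(1 + \<bar>a\<bar>)\<^sup>2 * (1 + \<bar>b\<bar>)\<^sup>2 * norm (f (pt a b)) \<le> (1 + norm (pt a b)) ^ 4 * norm (f (pt a b))"
      by (intro mult_right_mono) auto
    also have "\<dots> \<le> C" using C[of "pt a b"] by (simp add: abs_mult)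
    finally have "norm (f (pt a b)) \<le> C / ((1 + \<bar>a\<bar>)\<^sup>2 * (1 + \<bar>b\<bar>)\<^sup>2)"
      by (subst pos_le_divide_eq) (auto simp: mult_ac add_pos_nonneg)
    also have "\<dots> = C * ((1 + \<bar>a\<bar>) powr (-2) * (1 + \<bar>b\<bar>) powr (-2))"
      by (simp add: powr_minus_divide powr_numeral add_pos_nonneg)
    finally show ?thesis .
  qed
  then have "mass f
     \<le> (\<integral>\<^sup>+a. \<integral>\<^sup>+b. ennreal C * ennreal ((1 + \<bar>a\<bar>) powr (-2)) * ennreal ((1 + \<bar>b\<bar>) powr (-2)) \<partial>lborel \<partial>lborel)"
    using C0 by (subst nn_integral_real2) (auto intro!: nn_integral_mono ennreal_leI simp: mult.assoc simp flip: ennreal_mult)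
  also have "\<dots> < \<infinity>"
    using nn_integral_powr_tail[of 1 2]
    by (simp add: nn_integral_cmult nn_integral_multc ennreal_mult_less_top)
  finally have "integrable lborel f" by (intro integrableI_bounded) auto
  then show ?thesis by (subst integrable_completion) auto
qed

section \<open>The main theorem\<close>

lemma gauge_minkowski_functional:
  assumes cvx: "convex \<Omega>" and inner: "cball 0 8 \<subseteq> \<Omega>" and outer: "\<Omega> \<subseteq> ball 0 P" and P: "1 \<le> P"
  shows "planar_gauge (minkowski_functional \<Omega>) P"
proof -
  define A where "A \<xi> = {t. t > 0 \<and> (1 / t) *\<^sub>R \<xi> \<in> \<Omega>}" for \<xi>
  define \<rho> where "\<rho> = minkowski_functional \<Omega>"
  have \<rho>: "\<rho> \<xi> = Inf (A \<xi>)" for \<xi> by (simp add: \<rho>_def A_def minkowski_functional_def)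
  have bdd: "bdd_below (A \<xi>)" for \<xi> by (intro bdd_belowI[of _ 0]) (auto simp: A_def)
  have mem: "t \<in> A \<xi>" if "0 < t" "norm \<xi> \<le> 8 * t" for t \<xi>
  proof -
    have "norm ((1 / t) *\<^sub>R \<xi>) \<le> 8" using that by (simp add: field_simps)
    then show ?thesis using that inner by (auto simp: A_def)
  qed
  have ne: "A \<xi> \<noteq> {}" for \<xi>
    using mem[of "norm \<xi> / 8 + 1" \<xi>] norm_ge_zero[of \<xi>] by (auto simp: field_simps add_pos_nonneg)
  have le: "\<rho> \<xi> \<le> t" if "t \<in> A \<xi>" for t \<xi> unfolding \<rho> by (rule cInf_lower[OF that bdd])
  have ge: "c \<le> \<rho> \<xi>" if "\<And>t. t \<in> A \<xi> \<Longrightarrow> c \<le> t" for c \<xi> unfolding \<rho> by (rule cInf_greatest[OF ne that])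
  \<comment> \<open>For \<xi> = 0 the natural choice t = |\<xi>| / 8 is not positive, which is why a
    small e is added.\<close>
  have upper: "\<rho> \<xi> \<le> norm \<xi> / 8" for \<xi>
  proof (rule field_le_epsilon)
    fix e :: real assume "0 < e"
    then show "\<rho> \<xi> \<le> norm \<xi> / 8 + e"
      using norm_ge_zero[of \<xi>] by (intro le mem) (auto intro: add_nonneg_pos)
  qed
  have lower: "norm \<xi> \<le> P * \<rho> \<xi>" for \<xi>
  proof -
    have "norm \<xi> / P \<le> \<rho> \<xi>"
    proof (rule ge)
      fix t assume "t \<in> A \<xi>"
      then have "t > 0" "norm ((1 / t) *\<^sub>R \<xi>) < P" using outer by (auto simp: A_def)
      then show "norm \<xi> / P \<le> t" using P by (simp add: field_simps)
    qed
    then show ?thesis using P by (simp add: field_simps)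
  qed
  have subadd: "\<rho> (x + y) \<le> \<rho> x + \<rho> y" for x y
  proof -
    have ab: "\<rho> (x + y) \<le> a + b" if "a \<in> A x" "b \<in> A y" for a b
    proof (rule le)
      have pos: "a > 0" "b > 0" and mem': "(1 / a) *\<^sub>R x \<in> \<Omega>" "(1 / b) *\<^sub>R y \<in> \<Omega>" using that by (auto simp: A_def)
      \<comment> \<open>These convex weights cancel the separate dilations and leave (x + y) / (a +
        b).\<close>
      have "(a / (a + b)) *\<^sub>R ((1 / a) *\<^sub>R x) + (b / (a + b)) *\<^sub>R ((1 / b) *\<^sub>R y) \<in> \<Omega>"
        using pos by (intro convexD[OF cvx mem']) (auto simp: add_divide_distrib[symmetric])
      also have "(a / (a + b)) *\<^sub>R ((1 / a) *\<^sub>R x) + (b / (a + b)) *\<^sub>R ((1 / b) *\<^sub>R y) = (1 / (a + b)) *\<^sub>R (x + y)"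
        using pos by (simp add: scaleR_add_right)
      finally show "a + b \<in> A (x + y)" using pos by (simp add: A_def)
    qed
    have "\<rho> (x + y) - b \<le> \<rho> x" if "b \<in> A y" for b
    proof (rule ge)
      fix a assume "a \<in> A x"
      from ab[OF this that] show "\<rho> (x + y) - b \<le> a" by simp
    qed
    then have "\<rho> (x + y) - \<rho> x \<le> \<rho> y" by (intro ge) (simp add: algebra_simps)
    then show ?thesis by simp
  qed
  have hle: "\<rho> (t *\<^sub>R x) \<le> t * \<rho> x" if t: "0 < t" for t x
  proof -
    have "\<rho> (t *\<^sub>R x) / t \<le> \<rho> x"
    proof (rule ge)
      fix a assume "a \<in> A x"
      then have "t * a \<in> A (t *\<^sub>R x)" using t by (simp add: A_def)
      from le[OF this] show "\<rho> (t *\<^sub>R x) / t \<le> a" using t by (simp add: field_simps)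
    qed
    then show ?thesis using t by (simp add: field_simps)
  qed
  have hom: "\<rho> (t *\<^sub>R x) = t * \<rho> x" if "0 \<le> t" for t x
  proof (cases "t = 0")
    case True
    have "\<rho> 0 \<le> 0" using upper[of 0] by simp
    moreover have "0 \<le> \<rho> 0" using lower[of 0] P by (simp add: zero_le_mult_iff)
    ultimately show ?thesis using True by simp
  next
    case False
    then have t: "0 < t" using that by simp
    \<comment> \<open>The inequality for the dilation 1 / t, applied at t x, is the reverse
      inequality.\<close>
    have "\<rho> ((1 / t) *\<^sub>R (t *\<^sub>R x)) \<le> (1 / t) * \<rho> (t *\<^sub>R x)" using t by (intro hle) simp
    then have "t * \<rho> x \<le> \<rho> (t *\<^sub>R x)" using t by (simp add: field_simps)
    then show ?thesis using hle[OF t, of x] by simp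
  qed
  show ?thesis
    unfolding \<rho>_def[symmetric] using hom subadd lower upper P by unfold_locales
qed

section \<open>Null sets and Borel representatives of the multiplier\<close>

context planar_gauge
begin

text \<open>For fixed \<open>\<xi> \<noteq> 0\<close> almost every dilate \<open>t \<xi>\<close> satisfies \<open>\<rho> (t \<xi>) \<notin> N\<close>; so by Tonelli there is a dilation
  for which this holds almost everywhere in \<open>\<xi>\<close>, and dilations preserve null sets.\<close>

lemma AE_gauge:
  assumes Q: "AE s in lborel. Q s"
  shows "AE \<xi> in lborel. Q (\<rho> \<xi>)"
proof -
  obtain N where N: "{s. \<not> Q s} \<subseteq> N" "N \<in> null_sets lborel"
    using Q by (auto elim!: AE_E simp: null_sets_def)
  have [measurable]: "N \<in> sets borel" using N(2) by (auto simp: null_sets_def)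
  have N0: "(\<integral>\<^sup>+s. indicator N s \<partial>lborel) = 0" using N(2) by (auto simp: null_sets_def)
  have "(\<integral>\<^sup>+t. \<integral>\<^sup>+\<xi>. indicator N (t * \<rho> \<xi>) \<partial>lborel \<partial>lborel) = (\<integral>\<^sup>+\<xi>. \<integral>\<^sup>+t. indicator N (t * \<rho> \<xi>) \<partial>lborel \<partial>lborel)"
    by (rule lborel_pair.Fubini') measurable
  also have "\<dots> = (\<integral>\<^sup>+\<xi>. 0 \<partial>(lborel :: (real^2) measure))"
  proof (rule nn_integral_cong_AE)
    have "AE \<xi>::real^2 in lborel. \<xi> \<noteq> 0" by (rule AE_lborel_singleton)
    then show "AE \<xi> in lborel. (\<integral>\<^sup>+t. indicator N (t * \<rho> \<xi>) \<partial>lborel) = 0"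
    proof eventually_elim
      case (elim \<xi>)
      from nn_integral_real_linear[of "indicator N" "\<rho> \<xi>" 0] gauge_pos[OF elim]
      show ?case by (simp add: N0 mult.commute)
    qed
  qed
  also have "\<dots> = 0" by simp
  finally have "AE t in lborel. (\<integral>\<^sup>+\<xi>. indicator N (t * \<rho> \<xi>) \<partial>lborel) = 0"
    by (subst (asm) nn_integral_0_iff_AE) auto
  moreover have "\<not> (AE t::real in lborel. t \<notin> {1<..<2})"
  proof
    assume "AE t::real in lborel. t \<notin> {1<..<2}"
    then have "emeasure lborel {1<..<2::real} = 0"
      by (simp add: AE_iff_null null_sets_def del: greaterThanLessThan_iff)
    then show False by simp
  qed
  ultimately obtain t where t: "t \<in> {1<..<2}" "(\<integral>\<^sup>+\<xi>. indicator N (t * \<rho> \<xi>) \<partial>lborel) = 0"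
    by (metis (mono_tags, lifting) eventually_mono)
  have "(\<integral>\<^sup>+\<xi>. indicator N (\<rho> \<xi>) \<partial>lborel) = ennreal (t\<^sup>2) * (\<integral>\<^sup>+\<xi>. indicator N (\<rho> (t *\<^sub>R \<xi>)) \<partial>lborel)"
    using t by (intro nn_integral_scale_plane) auto
  also have "\<dots> = 0" using t by (simp add: homogeneous)
  finally have "AE \<xi> in lborel. (indicator N (\<rho> \<xi>) :: ennreal) = 0"
    by (subst (asm) nn_integral_0_iff_AE) auto
  then show ?thesis
    by eventually_elim (use N(1) in \<open>auto simp: indicator_def split: if_splits\<close>)
qed

end

lemma bounded_multiplier_representative:
  fixes m :: "real \<Rightarrow> complex"
  assumes m: "m \<in> borel_measurable lebesgue" and bd: "bounded (range m)"
    and supp: "\<And>s. s \<notin> {1/2<..<2} \<Longrightarrow> m s = 0"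
  obtains m' B where "m' \<in> borel_measurable borel" "\<And>s. norm (m' s) \<le> B"
    "\<And>s. s \<notin> {0<..<2} \<Longrightarrow> m' s = 0" "AE s in lborel. m s = m' s"
proof -
  obtain m0 where [measurable]: "m0 \<in> borel_measurable borel" and ae: "AE s in lborel. m s = m0 s"
    using lebesgue_borel_representative[OF m] by blast
  obtain B where B: "\<And>s. norm (m s) \<le> B" using bd by (auto simp: bounded_iff)
  have B0: "0 \<le> B" using B[of 0] norm_ge_zero order_trans by blast
  \<comment> \<open>Truncation to the support and to values of norm at most B makes both bounds hold
    everywhere. It changes \<open>m0\<close> only where it differs from \<open>m\<close>, on a null
    set.\<close>
  define m' where "m' s = (if 1/2 < s \<and> s < 2 \<and> norm (m0 s) \<le> B then m0 s else 0)" for s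
  show thesis
  proof
    show "m' \<in> borel_measurable borel" unfolding m'_def by measurable
    show "norm (m' s) \<le> B" for s using B0 by (simp add: m'_def)
    show "m' s = 0" if "s \<notin> {0<..<2}" for s using that by (auto simp: m'_def)
    show "AE s in lborel. m s = m' s"
      using ae
    proof eventually_elim
      case (elim s)
      then show ?case using B[of s] supp[of s] by (auto simp: m'_def)
    qed
  qed
qed

text \<open>The two transforms differ by the reflection of the frequency, under which the weight is
  invariant.\<close>

lemma B_half_norm_eq_osc:
  assumes m: "m \<in> borel_measurable lebesgue" and m'[measurable]: "m' \<in> borel_measurable borel"
    and ae: "AE s in lborel. m s = m' s"
  shows "B_half_norm m = (weighted_mass (osc m'))"
proof -
  have "fourier m \<tau> = osc m' (- \<tau>)" for \<tau>
  proof -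
    have "fourier m \<tau> = (LINT s|lborel. cis (- (s \<bullet> \<tau>)) * m' s)"
      unfolding fourier_def by (rule lebesgue_integral_representative[OF m m' ae]) (simp add: borel_measurable_cis)
    then show ?thesis by (simp add: osc_def mult.commute)
  qed
  then have "B_half_norm m = (\<integral>\<^sup>+\<tau>. ennreal (norm (osc m' (- \<tau>)) * sqrt (1 + \<bar>- \<tau>\<bar>)) \<partial>lborel)"
    by (simp add: B_half_norm_def nn_integral_completion powr_half_sqrt)
  also have "\<dots> = (weighted_mass (osc m'))"
    using nn_integral_real_linear[of "\<lambda>a. ennreal (norm (osc m' a) * sqrt (1 + \<bar>a\<bar>))" "-1" 0] by simp
  finally show ?thesis .
qed

lemma fourier_measurable:
  fixes f :: "real^2 \<Rightarrow> complex"
  assumes "f \<in> borel_measurable lebesgue"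
  shows "fourier f \<in> borel_measurable borel"
proof -
  obtain f0 where f0[measurable]: "f0 \<in> borel_measurable borel" and ae: "AE x in lborel. f x = f0 x"
    using lebesgue_borel_representative[OF assms] by blast
  have "fourier f = (\<lambda>\<xi>. LINT y|lborel. cis (- (y \<bullet> \<xi>)) * f0 y)"
    unfolding fourier_def
    by (intro ext lebesgue_integral_representative[OF assms f0 ae]) (simp add: borel_measurable_cis)
  then show ?thesis by simp
qed

text \<open>One kernel represents the operator on all integrable functions, as an equality of
  functions, and so serves the Schwartz class and the Hardy space alike. The factor (2 pi)^(-2) is
  that of the inverse transform in the plane.\<close>

lemma quasiradial_multiplier_convol:
  fixes m :: "real \<Rightarrow> complex"
  assumes gauge: "planar_gauge (minkowski_functional \<Omega>) P"
    and m: "m \<in> borel_measurable lebesgue" "bounded (range m)" "\<And>s. s \<notin> {1/2<..<2} \<Longrightarrow> m s = 0"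
  obtains K B where "continuous_on UNIV K" "\<And>z. norm (K z) \<le> B"
    "mass K \<le> ennreal (kernel_const P / (2 * pi)\<^sup>2) * B_half_norm m"
    "\<And>f. integrable lebesgue f \<Longrightarrow> quasiradial_multiplier \<Omega> m f = convol K f"
proof -
  interpret planar_gauge "minkowski_functional \<Omega>" P by (rule gauge)
  let ?\<rho> = "minkowski_functional \<Omega>"
  obtain m' B where m'[measurable]: "m' \<in> borel_measurable borel" and bd: "\<And>s. norm (m' s) \<le> B"
    and supp: "\<And>s. s \<notin> {0<..<2} \<Longrightarrow> m' s = 0" and ae: "AE s in lborel. m s = m' s"
    using bounded_multiplier_representative[OF m] by blast
  define g where "g \<xi> = m' (?\<rho> \<xi>)" for \<xi>
  have g: "integrable lborel g"
    unfolding g_def by (rule integrable_gauge_multiplier[OF m' bd supp])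
  have gm[measurable]: "g \<in> borel_measurable borel" using g by auto
  define K where "K = inverse_fourier g"
  show thesis
  proof
    show "continuous_on UNIV K" "norm (K z) \<le> (1 / (2 * pi) ^ DIM(real^2)) * (LINT \<xi>|lborel. norm (g \<xi>))" for z
      unfolding K_def by (rule inverse_fourier_bounded_continuous[OF g])+
    define \<psi> where "\<psi> = osc (times_id m')"
    have c: "0 \<le> 1 / (2 * pi)\<^sup>2" by simp
    have Kc: "K z = of_real (1 / (2 * pi)\<^sup>2) * curve_kernel \<psi> z" for z
    proof -
      have "(LINT \<xi>|lebesgue. cis (z \<bullet> \<xi>) * g \<xi>) = (LINT \<xi>|lborel. cis (z \<bullet> \<xi>) * g \<xi>)"
        by (rule integral_completion) (simp add: borel_measurable_cis)
      also have "\<dots> = curve_kernel \<psi> z"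
        unfolding g_def \<psi>_def by (rule transform_gauge_multiplier[OF m' bd supp])
      finally show ?thesis by (simp add: K_def inverse_fourier_def)
    qed
    have Km: "K \<in> borel_measurable borel"
      unfolding K_def by (rule borel_measurable_continuous_onI) (rule inverse_fourier_bounded_continuous[OF g])
    have "curve_kernel \<psi> = (\<lambda>z. of_real ((2 * pi)\<^sup>2) * K z)" by (simp add: Kc fun_eq_iff)
    then have [measurable]: "curve_kernel \<psi> \<in> borel_measurable borel" using Km by simp
    have "mass K = (\<integral>\<^sup>+z. ennreal (1 / (2 * pi)\<^sup>2) * ennreal (norm (curve_kernel \<psi> z)) \<partial>lborel)"
      unfolding Kc norm_mult norm_of_real abs_of_nonneg[OF c] by (simp only: ennreal_mult[OF c norm_ge_zero])
    also have "\<dots> = ennreal (1 / (2 * pi)\<^sup>2) * (mass (curve_kernel \<psi>))"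
      by (rule nn_integral_cmult) measurable
    also have "\<dots> \<le> ennreal (1 / (2 * pi)\<^sup>2) * (ennreal (kernel_const P) * B_half_norm m)"
      unfolding \<psi>_def B_half_norm_eq_osc[OF m(1) m' ae]
      by (intro mult_left_mono nn_integral_curve_kernel[OF m' bd supp]) auto
    also have "\<dots> = ennreal (kernel_const P / (2 * pi)\<^sup>2) * B_half_norm m"
      using ennreal_mult[OF c less_imp_le[OF kernel_const_pos[OF P1]]] by (simp add: mult.assoc)
    finally show "mass K \<le> ennreal (kernel_const P / (2 * pi)\<^sup>2) * B_half_norm m" .
    fix f :: "real^2 \<Rightarrow> complex" assume f: "integrable lebesgue f"
    have [measurable]: "fourier f \<in> borel_measurable borel" using f by (intro fourier_measurable) auto
    have "inverse_fourier (\<lambda>\<xi>. g \<xi> * fourier f \<xi>) x = inverse_fourier (\<lambda>\<xi>. m (?\<rho> \<xi>) * fourier f \<xi>) x" for x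
    proof (rule inverse_fourier_cong_AE)
      show "(\<lambda>\<xi>. g \<xi> * fourier f \<xi>) \<in> borel_measurable lebesgue"
        by (rule measurable_completion) simp
      show "AE \<xi> in lborel. g \<xi> * fourier f \<xi> = m (?\<rho> \<xi>) * fourier f \<xi>"
        using AE_gauge[OF ae] by eventually_elim (simp add: g_def)
    qed
    then show "quasiradial_multiplier \<Omega> m f = convol K f"
      unfolding quasiradial_multiplier_def K_def
      by (simp add: fun_eq_iff inverse_fourier_multiplier[OF g f, symmetric])
  qed
qed

theorem corollary1p4:
  fixes M :: nat
  assumes "M > 0"
  shows "\<exists>C::real. C > 0 \<and>
    (\<forall>(\<Omega> :: (real^2) set) (m :: real \<Rightarrow> complex).
       bounded \<Omega> \<longrightarrow> open \<Omega> \<longrightarrow> convex \<Omega> \<longrightarrow>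
       cball 0 8 \<subseteq> \<Omega> \<longrightarrow> closure \<Omega> \<subseteq> ball 0 (2 ^ M) \<longrightarrow>
       kappa \<Omega> = ereal (1/2) \<longrightarrow>
       m \<in> borel_measurable lebesgue \<longrightarrow> bounded (range m) \<longrightarrow>
       (\<forall>s. s \<notin> {1/2<..<2} \<longrightarrow> m s = 0) \<longrightarrow>
         (B_half_norm m < \<infinity> \<longrightarrow>
            (\<forall>p. 1 < p \<longrightarrow> extends_to_bounded_operator_Lp p (quasiradial_multiplier \<Omega> m))) \<and>
         opnorm_H1_L1 (quasiradial_multiplier \<Omega> m) \<le> ennreal C * B_half_norm m)"
proof -
  \<comment> \<open>The radius 2^M of the outer ball serves as P, so C depends on M alone.\<close>
  define C where "C = kernel_const (2 ^ M) / (2 * pi)\<^sup>2"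
  have P: "(1::real) \<le> 2 ^ M" by simp
  have "C > 0" using kernel_const_pos[OF P] by (simp add: C_def)
  moreover have "(B_half_norm m < \<infinity> \<longrightarrow>
            (\<forall>p. 1 < p \<longrightarrow> extends_to_bounded_operator_Lp p (quasiradial_multiplier \<Omega> m))) \<and>
         opnorm_H1_L1 (quasiradial_multiplier \<Omega> m) \<le> ennreal C * B_half_norm m"
    if \<Omega>: "convex \<Omega>" "cball 0 8 \<subseteq> \<Omega>" "closure \<Omega> \<subseteq> ball 0 (2 ^ M)"
      and m: "m \<in> borel_measurable lebesgue" "bounded (range m)" "\<forall>s. s \<notin> {1/2<..<2} \<longrightarrow> m s = 0"
    for \<Omega> :: "(real^2) set" and m :: "real \<Rightarrow> complex"
  proof -
    have g: "planar_gauge (minkowski_functional \<Omega>) (2 ^ M)"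
      using \<Omega> closure_subset[of \<Omega>] P by (intro gauge_minkowski_functional) auto
    have m3: "m s = 0" if "s \<notin> {1/2<..<2}" for s using m(3) that by blast
    obtain K B where K: "continuous_on UNIV K" "\<And>z. norm (K z) \<le> B"
      and K1: "mass K \<le> ennreal C * B_half_norm m"
      and T: "\<And>f. integrable lebesgue f \<Longrightarrow> quasiradial_multiplier \<Omega> m f = convol K f"
      using quasiradial_multiplier_convol[OF g m(1,2) m3] unfolding C_def[symmetric] by blast
    have Km: "K \<in> borel_measurable borel" by (rule borel_measurable_continuous_onI[OF K(1)])
    show ?thesis
    proof (intro conjI impI allI)
      fix p :: real assume fin: "B_half_norm m < \<infinity>" and p: "1 < p"
      \<comment> \<open>Finiteness of the multiplier norm makes K integrable, and convolution with K
        is then the required extension; on Schwartz functions it agrees with the multiplier at every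
        point.\<close>
      have "mass K < \<infinity>"
        using fin by (intro le_less_trans[OF K1]) (simp add: ennreal_mult_less_top)
      then have "bounded_operator_Lp p (convol K)" by (rule bounded_operator_convol[OF Km _ p])
      then show "extends_to_bounded_operator_Lp p (quasiradial_multiplier \<Omega> m)"
        unfolding extends_to_bounded_operator_Lp_def
        by (intro exI[of _ "convol K"]) (simp add: T schwartz_integrable)
    next
      show "opnorm_H1_L1 (quasiradial_multiplier \<Omega> m) \<le> ennreal C * B_half_norm m"
        unfolding opnorm_H1_L1_def
      proof (rule SUP_least)
        fix f assume "f \<in> {f \<in> H1_space. H1_norm f \<le> 1}"
        then have f: "integrable lebesgue f" and f1: "H1_norm f \<le> 1" by (auto simp: H1_space_def)
        have "L1_norm (quasiradial_multiplier \<Omega> m f) \<le> (mass K) * H1_norm f"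
          unfolding T[OF f] by (rule L1_norm_convol_le_H1_norm[OF K f])
        also have "\<dots> \<le> (ennreal C * B_half_norm m) * 1"
          by (intro mult_mono K1 f1) auto
        finally show "L1_norm (quasiradial_multiplier \<Omega> m f) \<le> ennreal C * B_half_norm m" by simp
      qed
    qed
  qed
  ultimately show ?thesis by blast
qed

end
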